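(* Let $X$ and $Y$ be Banach spaces, let $p,q\in[1,+\infty)$, and let $f:\mathbb{R}\times X\to Y$ be a map. Put $\mathcal{N}_f(u)(t)=f(t,u(t))$ for $u:\mathbb{R}\to X$, $t\in\mathbb{R}$. Suppose that the following three hypotheses hold. (H1) There exist a constant $a>0$ and $b\in S^q_{aa}(\mathbb{R})$ such that for a.e. $t\in\mathbb{R}$ and all $x\in X$, $\|f(t,x)\|\le a\|x\|^{p/q}+b(t)$. (H2) For a.e. $t\in\mathbb{R}$, the map $f(t,\cdot)$ is continuous from $X$ into $Y$. (H3) For every compact set $K\subset X$ and every $r>0$, there exists a measurable set $N\subset\mathbb{R}$ such that $\sup_{t\in\mathbb{R}}\mathrm{meas}\big((t,t+1)\cap N\big)<r$ and such that for every $\varepsilon>0$ there exists $\delta>0$ such that for all $x_1,x_2\in K$ and all $t\in\mathbb{R}\setminus N$: $\|x_1-x_2\|\le\delta$ implies $\|f(t,x_1)-f(t,x_2)\|\le\varepsilon$. Then: (i) If $f(\cdot,x)\in S^q_{aa}(\mathbb{R},Y)$ for all $x\in X$, then $\mathcal{N}_f$ maps $S^p_{aa}(\mathbb{R},X)$ into $S^q_{aa}(\mathbb{R},Y)$ and $\mathcal{N}_f:S^p_{aa}(\mathbb{R},X)\to S^q_{aa}(\mathbb{R},Y)$ is continuous. (ii) If $f(\cdot,x)\in S^q_{ap}(\mathbb{R},Y)$ for all $x\in X$, then $\mathcal{N}_f$ maps $S^p_{ap}(\mathbb{R},X)$ into $S^q_{ap}(\mathbb{R},Y)$ and $\mathcal{N}_f:S^p_{ap}(\mathbb{R},X)\to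 S^q_{ap}(\mathbb{R},Y)$ is continuous.
   Context: $\mathrm{meas}$ is Lebesgue measure on $\mathbb{R}$. For a Banach space $E$ and $1\le p<\infty$: $L^p(a,b;E)$ is the space of Bochner $p$-integrable functions on $(a,b)$ (functions equal a.e. are identified), and $L^p_{loc}(\mathbb{R},E)$ is the space of functions $u:\mathbb{R}\to E$ whose restriction to every bounded interval is in $L^p$ of that interval. The Bochner transform of $u\in L^p_{loc}(\mathbb{R},E)$ is the (continuous) map $u^b:\mathbb{R}\to L^p(0,1;E)$, $u^b(t)(\theta)=u(t+\theta)$, $\theta\in(0,1)$. A continuous function $u:\mathbb{R}\to E$ is almost periodic (in the sense of Bohr) if for each $\varepsilon>0$ the set $\{\tau\in\mathbb{R}:\sup_{t\in\mathbb{R}}\|u(t+\tau)-u(t)\|\le\varepsilon\}$ is relatively dense in $\mathbb{R}$ (meets every interval of some fixed length); the space of such functions is $AP(\mathbb{R},E)$. A continuous function $u:\mathbb{R}\to E$ is almost automorphic if every sequence of real numbers has a subsequence $(t_k)$ for which there is a function $v:\mathbb{R}\to E$ with $\lim_k u(t+t_k)=v(t)$ and $\lim_k v(t-t_k)=u(t)$ for every $t\in\mathbb{R}$; the space of such functions is $AA(\mathbb{R},E)$. $S^p_{aa}(\mathbb{R},E)=\{u\in L^p_{loc}(\mathbb{R},E): u^b\in AA(\mathbb{R},L^p(0,1;E))\}$ and $S^p_{ap}(\mathbb{R},E)=\{u\in L^p_{loc}(\mathbb{R},E): u^b\in AP(\mathbb{R},L^p(0,1;E))\}$ are Banach spaces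 with the norm $\|u\|_{S^p}=\sup_{t\in\mathbb{R}}\left(\int_0^1\|u(t+\theta)\|^p\,d\theta\right)^{1/p}$. We write $S^q_{aa}(\mathbb{R})$ for $S^q_{aa}(\mathbb{R},\mathbb{R})$. *)

theory Defs
  imports "HOL-Analysis.Analysis"
begin

section \<open>The spaces \<open>L\<^sup>p(a,b;E)\<close>\<close>

text \<open>
  The library's Bochner integral is restricted to second countable range types, whereas the Banach
  spaces considered here need not be separable.  Strong (Bochner) measurability is therefore defined
  directly; \<open>simple_function\<close> puts no restriction on the range type.
\<close>

definition strongly_measurable :: "'a measure \<Rightarrow> ('a \<Rightarrow> 'e::real_normed_vector) \<Rightarrow> bool" where
  "strongly_measurable M u \<longleftrightarrow>
     (\<exists>s :: nat \<Rightarrow> 'a \<Rightarrow> 'e. (\<forall>n. simple_function M (s n)) \<and>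
        (AE x in M. (\<lambda>n. s n x) \<longlonglongrightarrow> u x))"

text \<open>
  Representatives of elements of \<open>L\<^sup>p(a,b;E)\<close> are total functions on \<open>\<real>\<close>; their values outside
  \<open>(a,b)\<close> are irrelevant and are divided out by \<open>Lp_rel\<close>.
\<close>

definition Lp :: "real \<Rightarrow> real \<Rightarrow> real \<Rightarrow> (real \<Rightarrow> 'e::banach) set" where
  "Lp p a b = {u. strongly_measurable (lebesgue_on {a<..<b}) u \<and>
                  integrable (lebesgue_on {a<..<b}) (\<lambda>\<theta>. norm (u \<theta>) powr p)}"

definition Lp_norm :: "real \<Rightarrow> real \<Rightarrow> real \<Rightarrow> (real \<Rightarrow> 'e::banach) \<Rightarrow> real" where
  "Lp_norm p a b u = (\<integral>\<theta>. norm (u \<theta>) powr p \<partial>lebesgue_on {a<..<b}) powr (1 / p)"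

definition Lp_rel :: "real \<Rightarrow> real \<Rightarrow> real \<Rightarrow> ((real \<Rightarrow> 'e::banach) \<times> (real \<Rightarrow> 'e)) set" where
  "Lp_rel p a b = {(u, v). u \<in> Lp p a b \<and> v \<in> Lp p a b \<and>
                           (AE \<theta> in lebesgue_on {a<..<b}. u \<theta> = v \<theta>)}"

definition Lp_class :: "real \<Rightarrow> real \<Rightarrow> real \<Rightarrow> (real \<Rightarrow> 'e::banach) \<Rightarrow> (real \<Rightarrow> 'e) set" where
  "Lp_class p a b u = Lp_rel p a b `` {u}"

definition Lp_dist ::
    "real \<Rightarrow> real \<Rightarrow> real \<Rightarrow> (real \<Rightarrow> 'e::banach) set \<Rightarrow> (real \<Rightarrow> 'e) set \<Rightarrow> real" where
  "Lp_dist p a b U V =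
     Lp_norm p a b (\<lambda>\<theta>. (SOME u. u \<in> U) \<theta> - (SOME v. v \<in> V) \<theta>)"

text \<open>
  The Banach space \<open>L\<^sup>p(a,b;E)\<close> of a.e.-equivalence classes, as a metric space.  The metric axioms
  (for \<open>1 \<le> p\<close>) and independence of representatives are proved below.
\<close>

definition Lp_metric :: "real \<Rightarrow> real \<Rightarrow> real \<Rightarrow> (real \<Rightarrow> 'e::banach) set metric" where
  "Lp_metric p a b = metric (Lp p a b // Lp_rel p a b, Lp_dist p a b)"

lemma strongly_measurable_diff:
  assumes "strongly_measurable M u" "strongly_measurable M v"
  shows "strongly_measurable M (\<lambda>x. u x - v x)"
proof -
  obtain s where s: "\<And>n. simple_function M (s n)" "AE x in M. (\<lambda>n. s n x) \<longlonglongrightarrow> u x"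
    using assms(1) unfolding strongly_measurable_def by blast
  obtain t where t: "\<And>n. simple_function M (t n)" "AE x in M. (\<lambda>n. t n x) \<longlonglongrightarrow> v x"
    using assms(2) unfolding strongly_measurable_def by blast
  have "AE x in M. (\<lambda>n. s n x - t n x) \<longlonglongrightarrow> u x - v x"
    using s(2) t(2) by eventually_elim (rule tendsto_diff)
  moreover have "simple_function M (\<lambda>x. s n x - t n x)" for n
    by (rule simple_function_compose2[OF s(1) t(1)])
  ultimately show ?thesis
    unfolding strongly_measurable_def by (intro exI[of _ "\<lambda>n x. s n x - t n x"]) auto
qed

lemma strongly_measurable_norm:
  fixes S :: "real set"
  assumes S: "S \<in> sets lebesgue" and u: "strongly_measurable (lebesgue_on S) u"
  shows "(\<lambda>x. norm (u x)) \<in> borel_measurable (lebesgue_on S)"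
proof -
  let ?M = "lebesgue_on S"
  obtain s where s: "\<And>n. simple_function ?M (s n)" "AE x in ?M. (\<lambda>n. s n x) \<longlonglongrightarrow> u x"
    using u unfolding strongly_measurable_def by blast
  have "(\<lambda>x. norm (s n x)) \<in> borel_measurable ?M" for n
    by (rule borel_measurable_simple_function[OF simple_function_compose1[OF s(1)]])
  then have m: "(\<lambda>x. lim (\<lambda>n. norm (s n x))) \<in> borel_measurable ?M"
    by (rule borel_measurable_lim_metric)
  have ae: "AE x in ?M. lim (\<lambda>n. norm (s n x)) = norm (u x)"
    using s(2) by eventually_elim (intro limI tendsto_norm)
  have ae': "AE x in lebesgue. x \<in> S \<longrightarrow> lim (\<lambda>n. norm (s n x)) = norm (u x)"
    using ae S by (simp add: AE_restrict_space_iff)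
  have "(\<lambda>x. if x \<in> S then lim (\<lambda>n. norm (s n x)) else 0) \<in> borel_measurable lebesgue"
    using borel_measurable_if_I[OF m S] .
  then have "(\<lambda>x. if x \<in> S then norm (u x) else 0) \<in> borel_measurable lebesgue"
    by (rule borel_measurable_AE) (use ae' in \<open>eventually_elim, auto\<close>)
  then show ?thesis
    by (rule borel_measurable_if_D)
qed

lemma powr_add_le:
  fixes x y p :: real
  assumes "0 \<le> x" "0 \<le> y" "0 \<le> p"
  shows "(x + y) powr p \<le> 2 powr p * (x powr p + y powr p)"
proof -
  have "(x + y) powr p \<le> (2 * max x y) powr p"
    using assms by (intro powr_mono2) auto
  also have "\<dots> = 2 powr p * max x y powr p"
    using assms by (simp add: powr_mult)
  also have "max x y powr p \<le> x powr p + y powr p"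
    by (auto simp: max_def)
  finally show ?thesis by simp
qed

lemma Lp_diff:
  assumes p: "1 \<le> p" and u: "u \<in> Lp p a b" and v: "v \<in> Lp p a b"
  shows "(\<lambda>\<theta>. u \<theta> - v \<theta>) \<in> Lp p a b"
proof -
  let ?M = "lebesgue_on {a<..<b}"
  have sm: "strongly_measurable ?M (\<lambda>\<theta>. u \<theta> - v \<theta>)"
    using u v by (intro strongly_measurable_diff) (auto simp: Lp_def)
  have "(\<lambda>\<theta>. norm (u \<theta> - v \<theta>)) \<in> borel_measurable ?M"
    by (rule strongly_measurable_norm[OF _ sm]) auto
  then have m: "(\<lambda>\<theta>. norm (u \<theta> - v \<theta>) powr p) \<in> borel_measurable ?M"
    by measurable
  have "integrable ?M (\<lambda>\<theta>. 2 powr p * (norm (u \<theta>) powr p + norm (v \<theta>) powr p))"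
    using u v by (auto simp: Lp_def)
  then have "integrable ?M (\<lambda>\<theta>. norm (u \<theta> - v \<theta>) powr p)"
  proof (rule Bochner_Integration.integrable_bound[OF _ m], intro AE_I2)
    fix \<theta>
    have "norm (u \<theta> - v \<theta>) powr p \<le> (norm (u \<theta>) + norm (v \<theta>)) powr p"
      using p by (intro powr_mono2 norm_triangle_ineq4) auto
    also have "\<dots> \<le> 2 powr p * (norm (u \<theta>) powr p + norm (v \<theta>) powr p)"
      using p by (intro powr_add_le) auto
    finally show "norm (norm (u \<theta> - v \<theta>) powr p)
        \<le> norm (2 powr p * (norm (u \<theta>) powr p + norm (v \<theta>) powr p))"
      by simp
  qed
  with sm show ?thesis
    by (simp add: Lp_def)
qed

lemma Lp_norm_nonneg: "0 \<le> Lp_norm p a b u"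
  by (simp add: Lp_norm_def)

lemma Lp_norm_powr:
  assumes "1 \<le> p"
  shows "Lp_norm p a b u powr p = (\<integral>\<theta>. norm (u \<theta>) powr p \<partial>lebesgue_on {a<..<b})"
  using assms by (simp add: Lp_norm_def powr_powr integral_nonneg_AE)

lemma Lp_norm_cong_AE:
  assumes "u \<in> Lp p a b" "v \<in> Lp p a b"
    and "AE \<theta> in lebesgue_on {a<..<b}. norm (u \<theta>) = norm (v \<theta>)"
  shows "Lp_norm p a b u = Lp_norm p a b v"
proof -
  have "(\<integral>\<theta>. norm (u \<theta>) powr p \<partial>lebesgue_on {a<..<b})
      = (\<integral>\<theta>. norm (v \<theta>) powr p \<partial>lebesgue_on {a<..<b})"
    using assms by (intro integral_cong_AE) (auto simp: Lp_def)
  then show ?thesis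
    by (simp add: Lp_norm_def)
qed

lemma Lp_norm_eq_0_iff:
  assumes p: "1 \<le> p" and u: "u \<in> Lp p a b"
  shows "Lp_norm p a b u = 0 \<longleftrightarrow> (AE \<theta> in lebesgue_on {a<..<b}. u \<theta> = 0)"
proof -
  have "Lp_norm p a b u = 0 \<longleftrightarrow> (\<integral>\<theta>. norm (u \<theta>) powr p \<partial>lebesgue_on {a<..<b}) = 0"
    by (simp add: Lp_norm_def)
  also have "\<dots> \<longleftrightarrow> (AE \<theta> in lebesgue_on {a<..<b}. norm (u \<theta>) powr p = 0)"
    using u by (intro integral_nonneg_eq_0_iff_AE) (auto simp: Lp_def)
  finally show ?thesis
    by simp
qed

lemma powr_convex_weighted:
  fixes x y A B p :: real
  assumes p: "1 \<le> p" and x: "0 \<le> x" and y: "0 \<le> y" and A: "0 < A" and B: "0 < B"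
  shows "(x + y) powr p
    \<le> (A + B) powr p * (A / (A + B) * (x powr p / A powr p) + B / (A + B) * (y powr p / B powr p))"
proof -
  define l where "l = A / (A + B)"
  have l: "0 < l" "l < 1" "1 - l = B / (A + B)"
    using A B by (auto simp: l_def field_simps)
  have conv: "(l * s + (1 - l) * t) powr p \<le> l * s powr p + (1 - l) * t powr p"
    if st: "0 \<le> s" "0 \<le> t" for s t
  proof -
    have le: "(r * z) powr p \<le> r * z powr p" if "0 < r" "r < 1" "0 \<le> z" for r z :: real
    proof -
      have "r powr p \<le> r powr 1"
        using that p by (intro powr_mono') auto
      then show ?thesis
        using that by (simp add: powr_mult mult_right_mono)
    qed
    consider "s = 0" | "t = 0" | "0 < s" "0 < t"
      using st by linarith
    then show ?thesis
    proof cases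
      case 3
      then show ?thesis
        using convex_onD[OF powr_convex[OF p], of "1 - l" s t] l(1,2) by simp
    next
      case 1
      then show ?thesis using le[of "1 - l" t] l st by simp
    next
      case 2
      then show ?thesis using le[of l s] l st by simp
    qed
  qed
  have "x + y = (A + B) * (l * (x / A) + (1 - l) * (y / B))"
    unfolding l(3) using A B by (simp add: l_def distrib_left)
  then have "(x + y) powr p = (A + B) powr p * (l * (x / A) + (1 - l) * (y / B)) powr p"
    using A B x y l by (simp add: powr_mult)
  also have "\<dots> \<le> (A + B) powr p * (l * (x / A) powr p + (1 - l) * (y / B) powr p)"
    using A B x y by (intro mult_left_mono conv) auto
  also have "\<dots> = (A + B) powr p * (l * (x powr p / A powr p) + (1 - l) * (y powr p / B powr p))"
    using A B x y by (simp add: powr_divide)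
  finally show ?thesis
    unfolding l(3) by (simp add: l_def)
qed

text \<open>Minkowski's inequality.\<close>

lemma Lp_norm_triangle:
  fixes u v w :: "real \<Rightarrow> 'e::banach"
  assumes p: "1 \<le> p" and u: "u \<in> Lp p a b" and v: "v \<in> Lp p a b" and w: "w \<in> Lp p a b"
    and le: "AE \<theta> in lebesgue_on {a<..<b}. norm (w \<theta>) \<le> norm (u \<theta>) + norm (v \<theta>)"
  shows "Lp_norm p a b w \<le> Lp_norm p a b u + Lp_norm p a b v"
proof -
  let ?M = "lebesgue_on {a<..<b}"
  define A B where "A = Lp_norm p a b u" and "B = Lp_norm p a b v"
  have mono: "Lp_norm p a b f \<le> Lp_norm p a b g"
    if "f \<in> Lp p a b" "g \<in> Lp p a b" "AE \<theta> in ?M. norm (f \<theta>) \<le> norm (g \<theta>)"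
    for f g :: "real \<Rightarrow> 'e"
  proof -
    have "(\<integral>\<theta>. norm (f \<theta>) powr p \<partial>?M) \<le> (\<integral>\<theta>. norm (g \<theta>) powr p \<partial>?M)"
    proof (rule integral_mono_AE)
      show "AE \<theta> in ?M. norm (f \<theta>) powr p \<le> norm (g \<theta>) powr p"
        using that(3) by eventually_elim (use p in \<open>auto intro!: powr_mono2\<close>)
    qed (use that in \<open>auto simp: Lp_def\<close>)
    then show ?thesis
      unfolding Lp_norm_def using p by (intro powr_mono2) (auto simp: integral_nonneg_AE)
  qed
  have AB: "0 \<le> A" "0 \<le> B"
    by (auto simp: A_def B_def Lp_norm_nonneg)
  consider "A = 0" | "B = 0" | "0 < A" "0 < B"
    using AB by linarith
  then show ?thesis
  proof cases
    case 1
    then have "AE \<theta> in ?M. u \<theta> = 0"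
      using Lp_norm_eq_0_iff[OF p u] by (simp add: A_def)
    then have "AE \<theta> in ?M. norm (w \<theta>) \<le> norm (v \<theta>)"
      using le by eventually_elim auto
    then show ?thesis
      using mono[OF w v] AB by (simp add: A_def)
  next
    case 2
    then have "AE \<theta> in ?M. v \<theta> = 0"
      using Lp_norm_eq_0_iff[OF p v] by (simp add: B_def)
    then have "AE \<theta> in ?M. norm (w \<theta>) \<le> norm (u \<theta>)"
      using le by eventually_elim auto
    then show ?thesis
      using mono[OF w u] AB by (simp add: B_def)
  next
    case 3
    let ?h = "\<lambda>\<theta>. (A + B) powr p * (A / (A + B) * (norm (u \<theta>) powr p / A powr p)
                    + B / (A + B) * (norm (v \<theta>) powr p / B powr p))"
    have iu: "integrable ?M (\<lambda>\<theta>. norm (u \<theta>) powr p)"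
      and iv: "integrable ?M (\<lambda>\<theta>. norm (v \<theta>) powr p)"
      and iw: "integrable ?M (\<lambda>\<theta>. norm (w \<theta>) powr p)"
      using u v w by (auto simp: Lp_def)
    have ih: "integrable ?M ?h"
      using iu iv by (intro integrable_mult_right Bochner_Integration.integrable_add integrable_divide)
    have "Lp_norm p a b w powr p = (\<integral>\<theta>. norm (w \<theta>) powr p \<partial>?M)"
      by (rule Lp_norm_powr[OF p])
    also have "\<dots> \<le> (\<integral>\<theta>. ?h \<theta> \<partial>?M)"
    proof (rule integral_mono_AE[OF iw ih])
      show "AE \<theta> in ?M. norm (w \<theta>) powr p \<le> ?h \<theta>"
        using le
      proof eventually_elim
        case (elim \<theta>)
        have "norm (w \<theta>) powr p \<le> (norm (u \<theta>) + norm (v \<theta>)) powr p"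
          using elim p by (intro powr_mono2) auto
        also have "\<dots> \<le> ?h \<theta>"
          using p 3 by (intro powr_convex_weighted) auto
        finally show ?case .
      qed
    qed
    also have "\<dots> = (A + B) powr p * (A / (A + B) * ((\<integral>\<theta>. norm (u \<theta>) powr p \<partial>?M) / A powr p)
                    + B / (A + B) * ((\<integral>\<theta>. norm (v \<theta>) powr p \<partial>?M) / B powr p))"
      using iu iv by (simp add: Bochner_Integration.integral_add)
    also have "\<dots> = (A + B) powr p * (A / (A + B) + B / (A + B))"
      using 3 by (simp add: A_def B_def Lp_norm_powr[OF p, symmetric])
    also have "\<dots> = (A + B) powr p"
      using 3 by (simp add: add_divide_distrib[symmetric])
    finally have "Lp_norm p a b w powr p \<le> (A + B) powr p" .
    then have "Lp_norm p a b w \<le> A + B"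
      using p 3 powr_less_mono2[of p "A + B" "Lp_norm p a b w"]
      by (smt (verit))
    then show ?thesis
      by (simp add: A_def B_def)
  qed
qed

lemma equiv_Lp_rel: "equiv (Lp p a b) (Lp_rel p a b)"
proof (rule equivI)
  show "trans (Lp_rel p a b :: ((real \<Rightarrow> 'a) \<times> (real \<Rightarrow> 'a)) set)"
  proof (rule transI)
    fix u v w :: "real \<Rightarrow> 'a"
    assume uv: "(u, v) \<in> Lp_rel p a b" and vw: "(v, w) \<in> Lp_rel p a b"
    then have "AE \<theta> in lebesgue_on {a<..<b}. u \<theta> = v \<theta>" "AE \<theta> in lebesgue_on {a<..<b}. v \<theta> = w \<theta>"
      by (auto simp: Lp_rel_def)
    then have "AE \<theta> in lebesgue_on {a<..<b}. u \<theta> = w \<theta>"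
      by eventually_elim simp
    with uv vw show "(u, w) \<in> Lp_rel p a b"
      by (auto simp: Lp_rel_def)
  qed
qed (auto simp: Lp_rel_def refl_on_def sym_def elim!: eventually_mono)

lemma Lp_class_in_space: "u \<in> Lp p a b \<Longrightarrow> Lp_class p a b u \<in> Lp p a b // Lp_rel p a b"
  by (simp add: Lp_class_def quotientI)

lemma Lp_class_eq_iff:
  assumes "u \<in> Lp p a b" "v \<in> Lp p a b"
  shows "Lp_class p a b u = Lp_class p a b v \<longleftrightarrow> (AE \<theta> in lebesgue_on {a<..<b}. u \<theta> = v \<theta>)"
  unfolding Lp_class_def eq_equiv_class_iff[OF equiv_Lp_rel assms]
  using assms by (simp add: Lp_rel_def)

lemma Lp_space_cases:
  assumes "U \<in> Lp p a b // Lp_rel p a b"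
  obtains u where "u \<in> Lp p a b" "U = Lp_class p a b u"
  using assms by (auto simp: Lp_class_def elim: quotientE)

lemma Lp_dist_class:
  assumes p: "1 \<le> p" and u: "u \<in> Lp p a b" and v: "v \<in> Lp p a b"
  shows "Lp_dist p a b (Lp_class p a b u) (Lp_class p a b v) = Lp_norm p a b (\<lambda>\<theta>. u \<theta> - v \<theta>)"
proof -
  have some: "(f, SOME g. g \<in> Lp_class p a b f) \<in> Lp_rel p a b" if "f \<in> Lp p a b"
    for f :: "real \<Rightarrow> 'a"
  proof -
    have "f \<in> Lp_class p a b f"
      unfolding Lp_class_def using equiv_class_self[OF equiv_Lp_rel that] .
    then have "(SOME g. g \<in> Lp_class p a b f) \<in> Lp_class p a b f"
      by (rule someI[where P = "\<lambda>g. g \<in> Lp_class p a b f"])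
    then show ?thesis
      by (simp add: Lp_class_def)
  qed
  define u' v' where "u' = (SOME g. g \<in> Lp_class p a b u)"
    and "v' = (SOME g. g \<in> Lp_class p a b v)"
  have uv': "u' \<in> Lp p a b" "v' \<in> Lp p a b"
    "AE \<theta> in lebesgue_on {a<..<b}. u \<theta> = u' \<theta>" "AE \<theta> in lebesgue_on {a<..<b}. v \<theta> = v' \<theta>"
    using some[OF u] some[OF v] by (auto simp: u'_def v'_def Lp_rel_def)
  have "Lp_norm p a b (\<lambda>\<theta>. u' \<theta> - v' \<theta>) = Lp_norm p a b (\<lambda>\<theta>. u \<theta> - v \<theta>)"
  proof (rule Lp_norm_cong_AE)
    show "AE \<theta> in lebesgue_on {a<..<b}. norm (u' \<theta> - v' \<theta>) = norm (u \<theta> - v \<theta>)"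
      using uv'(3,4) by eventually_elim simp
  qed (use uv' u v p in \<open>auto intro: Lp_diff\<close>)
  then show ?thesis
    by (simp add: Lp_dist_def u'_def v'_def)
qed

lemma Metric_space_Lp:
  assumes p: "1 \<le> p"
  shows "Metric_space (Lp p a b // Lp_rel p a b) (Lp_dist p a b)"
proof
  fix U V :: "(real \<Rightarrow> 'a) set"
  show "0 \<le> Lp_dist p a b U V"
    by (simp add: Lp_dist_def Lp_norm_nonneg)
  show "Lp_dist p a b U V = Lp_dist p a b V U"
    by (simp add: Lp_dist_def Lp_norm_def norm_minus_commute)
next
  fix U V :: "(real \<Rightarrow> 'a) set"
  assume "U \<in> Lp p a b // Lp_rel p a b" "V \<in> Lp p a b // Lp_rel p a b"
  then obtain u v where u: "u \<in> Lp p a b" "U = Lp_class p a b u"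
    and v: "v \<in> Lp p a b" "V = Lp_class p a b v"
    by (metis Lp_space_cases)
  show "Lp_dist p a b U V = 0 \<longleftrightarrow> U = V"
    using u v by (simp add: Lp_dist_class[OF p] Lp_class_eq_iff Lp_norm_eq_0_iff[OF p] Lp_diff[OF p])
next
  fix U V W :: "(real \<Rightarrow> 'a) set"
  assume "U \<in> Lp p a b // Lp_rel p a b" "V \<in> Lp p a b // Lp_rel p a b"
    "W \<in> Lp p a b // Lp_rel p a b"
  then obtain u v w where u: "u \<in> Lp p a b" "U = Lp_class p a b u"
    and v: "v \<in> Lp p a b" "V = Lp_class p a b v"
    and w: "w \<in> Lp p a b" "W = Lp_class p a b w"
    by (metis Lp_space_cases)
  have "Lp_norm p a b (\<lambda>\<theta>. u \<theta> - w \<theta>)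
      \<le> Lp_norm p a b (\<lambda>\<theta>. u \<theta> - v \<theta>) + Lp_norm p a b (\<lambda>\<theta>. v \<theta> - w \<theta>)"
  proof (rule Lp_norm_triangle[OF p])
    have "norm (u \<theta> - w \<theta>) \<le> norm (u \<theta> - v \<theta>) + norm (v \<theta> - w \<theta>)" for \<theta>
      using norm_triangle_ineq[of "u \<theta> - v \<theta>" "v \<theta> - w \<theta>"] by simp
    then show "AE \<theta> in lebesgue_on {a<..<b}.
        norm (u \<theta> - w \<theta>) \<le> norm (u \<theta> - v \<theta>) + norm (v \<theta> - w \<theta>)"
      by simp
  qed (use u v w p in \<open>auto intro: Lp_diff\<close>)
  then show "Lp_dist p a b U W \<le> Lp_dist p a b U V + Lp_dist p a b V W"
    using u v w by (simp add: Lp_dist_class[OF p])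
qed

lemma mspace_Lp_metric: "1 \<le> p \<Longrightarrow> mspace (Lp_metric p a b) = Lp p a b // Lp_rel p a b"
  by (simp add: Lp_metric_def Metric_space.mspace_metric[OF Metric_space_Lp])

lemma mdist_Lp_metric: "1 \<le> p \<Longrightarrow> mdist (Lp_metric p a b) = Lp_dist p a b"
  by (simp add: Lp_metric_def Metric_space.mdist_metric[OF Metric_space_Lp])


section \<open>Almost periodic and almost automorphic functions\<close>

text \<open>
  Only the norm distance of the target Banach space enters these notions, so they are stated for an
  abstract metric space \<open>m\<close>; they are used with \<open>m = L\<^sup>p(0,1;E)\<close>.
\<close>

definition relatively_dense :: "real set \<Rightarrow> bool" where
  "relatively_dense S \<longleftrightarrow> (\<exists>l>0. \<forall>c. {c..c + l} \<inter> S \<noteq> {})"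

text \<open>
  The condition \<open>sup\<^sub>t d(u(t+\<tau>), u(t)) \<le> \<epsilon>\<close> is written pointwise, since the real-valued \<open>SUP\<close> of an
  unbounded family is unspecified.
\<close>

definition almost_periodic :: "'a metric \<Rightarrow> (real \<Rightarrow> 'a) \<Rightarrow> bool" where
  "almost_periodic m u \<longleftrightarrow>
     continuous_map euclideanreal (mtopology_of m) u \<and>
     (\<forall>\<epsilon>>0. relatively_dense {\<tau>. \<forall>t. mdist m (u (t + \<tau>)) (u t) \<le> \<epsilon>})"

definition almost_automorphic :: "'a metric \<Rightarrow> (real \<Rightarrow> 'a) \<Rightarrow> bool" where
  "almost_automorphic m u \<longleftrightarrow>
     continuous_map euclideanreal (mtopology_of m) u \<and>
     (\<forall>s :: nat \<Rightarrow> real. \<exists>r :: nat \<Rightarrow> nat. strict_mono r \<and>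
        (\<exists>v :: real \<Rightarrow> 'a. range v \<subseteq> mspace m \<and>
          (\<forall>t. limitin (mtopology_of m) (\<lambda>k. u (t + s (r k))) (v t) sequentially \<and>
               limitin (mtopology_of m) (\<lambda>k. v (t - s (r k))) (u t) sequentially)))"


section \<open>Stepanov spaces\<close>

definition Lp_loc :: "real \<Rightarrow> (real \<Rightarrow> 'e::banach) set" where
  "Lp_loc p = {u. \<forall>a b. a < b \<longrightarrow> u \<in> Lp p a b}"

definition bochner_transform :: "real \<Rightarrow> (real \<Rightarrow> 'e::banach) \<Rightarrow> real \<Rightarrow> (real \<Rightarrow> 'e) set" where
  "bochner_transform p u t = Lp_class p 0 1 (\<lambda>\<theta>. u (t + \<theta>))"

definition Stepanov_aa :: "real \<Rightarrow> (real \<Rightarrow> 'e::banach) set" where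
  "Stepanov_aa p = {u \<in> Lp_loc p. almost_automorphic (Lp_metric p 0 1) (bochner_transform p u)}"

definition Stepanov_ap :: "real \<Rightarrow> (real \<Rightarrow> 'e::banach) set" where
  "Stepanov_ap p = {u \<in> Lp_loc p. almost_periodic (Lp_metric p 0 1) (bochner_transform p u)}"

text \<open>
  On the two spaces above the family over which the supremum is taken is bounded, so the real-valued
  \<open>SUP\<close> is the genuine supremum.
\<close>

definition Stepanov_norm :: "real \<Rightarrow> (real \<Rightarrow> 'e::banach) \<Rightarrow> real" where
  "Stepanov_norm p u = (SUP t. Lp_norm p 0 1 (\<lambda>\<theta>. u (t + \<theta>)))"

text \<open>
  The elements of the Stepanov spaces are functions, on which the norm is a seminorm vanishing exactly
  on the functions that are zero a.e.; continuity is with respect to that seminorm, which is continuity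
  between the normed spaces obtained by identifying functions that agree a.e.
\<close>

definition Stepanov_continuous_on ::
    "real \<Rightarrow> real \<Rightarrow> (real \<Rightarrow> 'x::banach) set \<Rightarrow> ((real \<Rightarrow> 'x) \<Rightarrow> real \<Rightarrow> 'y::banach) \<Rightarrow> bool" where
  "Stepanov_continuous_on p q A T \<longleftrightarrow>
     (\<forall>u\<in>A. \<forall>\<epsilon>>0. \<exists>\<delta>>0. \<forall>v\<in>A.
        Stepanov_norm p (\<lambda>t. v t - u t) < \<delta> \<longrightarrow> Stepanov_norm q (\<lambda>t. T v t - T u t) < \<epsilon>)"

definition Nemytskii :: "(real \<Rightarrow> 'x \<Rightarrow> 'y) \<Rightarrow> (real \<Rightarrow> 'x) \<Rightarrow> real \<Rightarrow> 'y" where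
  "Nemytskii f u t = f t (u t)"

end

theory Submission
  imports Defs "HOL-Library.Diagonal_Subsequence"
begin

text \<open>
  Every notion in the theorem depends on a function \<open>u\<close> only through the pseudometric
  \<open>D\<^sub>u(s,t) = \<parallel>u(s + \<cdot>) - u(t + \<cdot>)\<parallel>\<close>, the norm being that of \<open>L\<^sup>p(0,1)\<close>, provided \<open>L\<^sup>p\<close> is complete
  (which supplies the limit functions of almost automorphy).  It therefore suffices to bound \<open>D\<close> for
  \<open>f(\<cdot>,u(\<cdot>))\<close> by \<open>\<epsilon>\<close> as soon as \<open>D\<^sub>u\<close> and \<open>D\<close> for finitely many functions \<open>f(\<cdot>,x)\<close> are small; a diagonal
  subsequence then handles almost automorphy, and total boundedness of the set of translates handles
  almost periodicity.

  For that bound, the windows \<open>u(t + \<cdot>)\<close> form a totally bounded set in \<open>L\<^sup>p(0,1)\<close>.  Hence they are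
  \<open>p\<close>-equiintegrable and, outside sets of uniformly small measure, take values in one compact set \<open>K\<close>.
  By (H3) the maps \<open>f(t,\<cdot>)\<close> are equicontinuous on \<open>K\<close> for \<open>t\<close> outside a set of small measure, so there
  \<open>f(t,u(t))\<close> is within \<open>\<epsilon>\<close> of \<open>f(t,x)\<close> for some \<open>x\<close> in a finite net of \<open>K\<close>; by (H1) the remaining exceptional
  sets contribute little.
\<close>

section \<open>Pseudometrics on the real line\<close>

text \<open>For almost periodicity the obstacle is that several functions need common almost
  periods, while two relatively dense sets can have empty intersection. Total boundedness of the
  translates in the uniform distance (Bochner's criterion) does survive finite sums of
  pseudometrics, and therefore passes to whatever such sums control. For almost automorphy the
  finite set of points x depends on the tolerance, so countably many sums have to be served by one
  subsequence.

  The order of choices in the main estimate is forced. The exponent in (H1) turns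
  p-equiintegrability of the windows of u into q-equiintegrability of those of f(t,u(t)), which
  fixes a measure r that is negligible for all windows at once. Then K is chosen for a fraction of
  r, then N from (H3), which needs both K and that fraction, then \<delta> and a finite \<delta>-net
  of K.

  Neither Banach space is assumed separable. Measurability of f(t,u(t)) is therefore obtained
  through simple functions, and compactness of K from finite sets of values of simple
  functions.\<close>

definition pseudometric :: "(real \<Rightarrow> real \<Rightarrow> real) \<Rightarrow> bool" where
  "pseudometric D \<longleftrightarrow> (\<forall>s. D s s = 0) \<and> (\<forall>s t. 0 \<le> D s t) \<and> (\<forall>s t. D s t = D t s) \<and>
     (\<forall>r s t. D r t \<le> D r s + D s t)"

definition continuous_pm :: "(real \<Rightarrow> real \<Rightarrow> real) \<Rightarrow> bool" where
  "continuous_pm D \<longleftrightarrow> (\<forall>t. \<forall>\<epsilon>>0. \<exists>\<delta>>0. \<forall>s. \<bar>s - t\<bar> < \<delta> \<longrightarrow> D s t < \<epsilon>)"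

text \<open>Bochner's form of almost periodicity: the translates of u are totally bounded in the
  uniform distance. The centres are translates too, so that only D enters.\<close>

definition translates_tb :: "(real \<Rightarrow> real \<Rightarrow> real) \<Rightarrow> bool" where
  "translates_tb D \<longleftrightarrow>
     (\<forall>\<epsilon>>0. \<exists>T. finite T \<and> (\<forall>\<tau>. \<exists>\<sigma>\<in>T. \<forall>t. D (t + \<tau>) (t + \<sigma>) < \<epsilon>))"

text \<open>
  The second condition is \<open>lim\<^sub>k lim\<^sub>m u(t - \<sigma>\<^sub>k + \<sigma>\<^sub>m) = u(t)\<close>, so that the limit function of
  the definition of almost automorphy does not occur.
\<close>

definition returning :: "(real \<Rightarrow> real \<Rightarrow> real) \<Rightarrow> (nat \<Rightarrow> real) \<Rightarrow> bool" where
  "returning D \<sigma> \<longleftrightarrow> (\<forall>t. \<forall>\<epsilon>>0.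
     (\<exists>k0. \<forall>k\<ge>k0. \<forall>l\<ge>k0. D (t + \<sigma> k) (t + \<sigma> l) < \<epsilon>) \<and>
     (\<exists>k0. \<forall>k\<ge>k0. \<exists>m0. \<forall>m\<ge>m0. D (t - \<sigma> k + \<sigma> m) t < \<epsilon>))"

definition automorphic_pm :: "(real \<Rightarrow> real \<Rightarrow> real) \<Rightarrow> bool" where
  "automorphic_pm D \<longleftrightarrow> (\<forall>s :: nat \<Rightarrow> real. \<exists>r. strict_mono r \<and> returning D (s \<circ> r))"

text \<open>The index n absorbs the dependence on the tolerance: in the application E n is D of u
  plus the pseudometrics of those finitely many f(.,x) that the tolerance 1/(n+1) requires.\<close>

definition controlled_by :: "(real \<Rightarrow> real \<Rightarrow> real) \<Rightarrow> (nat \<Rightarrow> real \<Rightarrow> real \<Rightarrow> real) \<Rightarrow> bool" where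
  "controlled_by G E \<longleftrightarrow> (\<forall>\<epsilon>>0. \<exists>n. \<exists>\<eta>>0. \<forall>s t. E n s t < \<eta> \<longrightarrow> G s t < \<epsilon>)"

section \<open>Transfer of continuity, total boundedness and automorphy along control\<close>

lemma controlled_byE:
  assumes "controlled_by G E" "0 < \<epsilon>"
  obtains n \<eta> where "0 < \<eta>" "\<And>s t. E n s t < \<eta> \<Longrightarrow> G s t < \<epsilon>"
  using assms unfolding controlled_by_def by metis

lemma continuous_pm_controlled:
  assumes "controlled_by G E" "\<And>n. continuous_pm (E n)"
  shows "continuous_pm G"
  unfolding continuous_pm_def
proof (intro allI impI)
  fix t \<epsilon> :: real assume "0 < \<epsilon>"
  with assms(1) obtain n \<eta> where n: "0 < \<eta>" "\<And>s t. E n s t < \<eta> \<Longrightarrow> G s t < \<epsilon>"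
    by (rule controlled_byE) blast
  then obtain \<delta> where "\<delta> > 0" "\<And>s. \<bar>s - t\<bar> < \<delta> \<Longrightarrow> E n s t < \<eta>"
    using assms(2)[of n] unfolding continuous_pm_def by metis
  with n show "\<exists>\<delta>>0. \<forall>s. \<bar>s - t\<bar> < \<delta> \<longrightarrow> G s t < \<epsilon>" by blast
qed

lemma translates_tb_controlled:
  assumes "controlled_by G E" "\<And>n. translates_tb (E n)"
  shows "translates_tb G"
  unfolding translates_tb_def
proof (intro allI impI)
  fix \<epsilon> :: real assume "0 < \<epsilon>"
  with assms(1) obtain n \<eta> where n: "0 < \<eta>" "\<And>s t. E n s t < \<eta> \<Longrightarrow> G s t < \<epsilon>"
    by (rule controlled_byE) blast
  then obtain T where "finite T" "\<And>\<tau>. \<exists>\<sigma>\<in>T. \<forall>t. E n (t + \<tau>) (t + \<sigma>) < \<eta>"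
    using assms(2)[of n] unfolding translates_tb_def by metis
  with n show "\<exists>T. finite T \<and> (\<forall>\<tau>. \<exists>\<sigma>\<in>T. \<forall>t. G (t + \<tau>) (t + \<sigma>) < \<epsilon>)"
    by (intro exI[of _ T]) blast
qed

lemma returning_controlled:
  assumes "controlled_by G E" "\<And>n. returning (E n) \<sigma>"
  shows "returning G \<sigma>"
  unfolding returning_def
proof (intro allI impI)
  fix t \<epsilon> :: real assume "0 < \<epsilon>"
  with assms(1) obtain n \<eta> where n: "0 < \<eta>" "\<And>s t. E n s t < \<eta> \<Longrightarrow> G s t < \<epsilon>"
    by (rule controlled_byE) blast
  have "(\<exists>k0. \<forall>k\<ge>k0. \<forall>l\<ge>k0. E n (t + \<sigma> k) (t + \<sigma> l) < \<eta>) \<and>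
     (\<exists>k0. \<forall>k\<ge>k0. \<exists>m0. \<forall>m\<ge>m0. E n (t - \<sigma> k + \<sigma> m) t < \<eta>)"
    using assms(2)[of n] n(1) unfolding returning_def by blast
  with n(2) show "(\<exists>k0. \<forall>k\<ge>k0. \<forall>l\<ge>k0. G (t + \<sigma> k) (t + \<sigma> l) < \<epsilon>) \<and>
     (\<exists>k0. \<forall>k\<ge>k0. \<exists>m0. \<forall>m\<ge>m0. G (t - \<sigma> k + \<sigma> m) t < \<epsilon>)"
    by meson
qed

lemma returning_CauchyD:
  "returning D \<sigma> \<Longrightarrow> 0 < \<epsilon> \<Longrightarrow> \<exists>k0. \<forall>k\<ge>k0. \<forall>l\<ge>k0. D (t + \<sigma> k) (t + \<sigma> l) < \<epsilon>"
  unfolding returning_def by blast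

lemma returning_returnD:
  "returning D \<sigma> \<Longrightarrow> 0 < \<epsilon> \<Longrightarrow> \<exists>k0. \<forall>k\<ge>k0. \<exists>m0. \<forall>m\<ge>m0. D (t - \<sigma> k + \<sigma> m) t < \<epsilon>"
  unfolding returning_def by blast

text \<open>Both conditions in \<open>returning\<close> concern tails only, so it is enough that
  \<rho> k is eventually a term of \<sigma> whose index tends to infinity. The lag N is there for
  diagonal sequences, which follow the n-th extracted sequence only after finitely many
  terms.\<close>

lemma returning_subseq:
  assumes D: "returning D \<sigma>" and r: "\<And>k. k \<ge> N \<Longrightarrow> \<exists>j. k \<le> j + N \<and> \<rho> k = \<sigma> j"
  shows "returning D \<rho>"
proof -
  obtain j where j: "\<And>k. k \<ge> N \<Longrightarrow> k \<le> j k + N" "\<And>k. k \<ge> N \<Longrightarrow> \<rho> k = \<sigma> (j k)"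
    using r by metis
  show ?thesis
    unfolding returning_def
  proof (intro allI impI conjI)
    fix t \<epsilon> :: real assume \<epsilon>: "0 < \<epsilon>"
    obtain k0 where k0: "\<And>k l. k \<ge> k0 \<Longrightarrow> l \<ge> k0 \<Longrightarrow> D (t + \<sigma> k) (t + \<sigma> l) < \<epsilon>"
      using returning_CauchyD[OF D \<epsilon>] by metis
    show "\<exists>k0. \<forall>k\<ge>k0. \<forall>l\<ge>k0. D (t + \<rho> k) (t + \<rho> l) < \<epsilon>"
    proof (intro exI allI impI)
      fix k l assume "k0 + N \<le> k" "k0 + N \<le> l"
      then show "D (t + \<rho> k) (t + \<rho> l) < \<epsilon>"
        using j(1)[of k] j(1)[of l] by (simp add: j(2) k0)
    qed
    obtain k1 where k1: "\<And>k. k \<ge> k1 \<Longrightarrow> \<exists>m0. \<forall>m\<ge>m0. D (t - \<sigma> k + \<sigma> m) t < \<epsilon>"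
      using returning_returnD[OF D \<epsilon>] by metis
    show "\<exists>k0. \<forall>k\<ge>k0. \<exists>m0. \<forall>m\<ge>m0. D (t - \<rho> k + \<rho> m) t < \<epsilon>"
    proof (rule exI, intro allI impI)
      fix k assume k: "k1 + N \<le> k"
      then have "j k \<ge> k1" using j(1)[of k] by simp
      then obtain m0 where m0: "\<And>m. m \<ge> m0 \<Longrightarrow> D (t - \<sigma> (j k) + \<sigma> m) t < \<epsilon>"
        using k1 by blast
      have "D (t - \<rho> k + \<rho> m) t < \<epsilon>" if "m \<ge> m0 + N" for m
        using that k j(1)[of m] by (simp add: j(2) m0)
      then show "\<exists>m0. \<forall>m\<ge>m0. D (t - \<rho> k + \<rho> m) t < \<epsilon>" by blast
    qed
  qed
qed

lemma returning_strict_mono: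
  assumes "returning D \<sigma>" "strict_mono r"
  shows "returning D (\<sigma> \<circ> r)"
proof (rule returning_subseq[OF assms(1), where N = 0])
  show "\<exists>j. k \<le> j + 0 \<and> (\<sigma> \<circ> r) k = \<sigma> j" for k
    using seq_suble[OF assms(2)] by (intro exI[of _ "r k"]) simp
qed

lemma automorphic_pm_diagonal:
  fixes s :: "nat \<Rightarrow> real"
  assumes "\<And>n :: nat. automorphic_pm (E n)"
  shows "\<exists>r. strict_mono r \<and> (\<forall>n. returning (E n) (s \<circ> r))"
proof -
  interpret subseqs "\<lambda>n r. returning (E n) (s \<circ> r)"
  proof
    fix n and r :: "nat \<Rightarrow> nat" assume "strict_mono r"
    show "\<exists>r'. strict_mono r' \<and> returning (E n) (s \<circ> (r \<circ> r'))"
      using assms[of n] unfolding automorphic_pm_def by (metis comp_assoc)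
  qed
  have "returning (E n) (s \<circ> diagseq)" for n
  proof -
    \<comment> \<open>The diagonal sequence is a subsequence of the n-th extracted one only once its
      first \<open>Suc n\<close> terms are dropped; \<open>returning_subseq\<close> with that lag
      puts them back.\<close>
    have "returning (E n) (s \<circ> (diagseq \<circ> (+) (Suc n)))"
      by (rule diagseq_holds) (metis comp_assoc returning_strict_mono)
    then show ?thesis
    proof (rule returning_subseq[where N = "Suc n"])
      fix k assume "Suc n \<le> k"
      then show "\<exists>j. k \<le> j + Suc n \<and> (s \<circ> diagseq) k = (s \<circ> (diagseq \<circ> (+) (Suc n))) j"
        by (intro exI[of _ "k - Suc n"]) simp
    qed
  qed
  with subseq_diagseq show ?thesis by blast
qed

lemma automorphic_pm_controlled:
  assumes "controlled_by G E" "\<And>n. automorphic_pm (E n)"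
  shows "automorphic_pm G"
  unfolding automorphic_pm_def
proof
  fix s :: "nat \<Rightarrow> real"
  obtain r where "strict_mono r" "\<And>n. returning (E n) (s \<circ> r)"
    using automorphic_pm_diagonal[of E s] assms(2) by blast
  with returning_controlled[OF assms(1)] show "\<exists>r. strict_mono r \<and> returning G (s \<circ> r)"
    by blast
qed

section \<open>Sums of pseudometrics\<close>

lemma pseudometric_add:
  assumes D: "pseudometric D" and D': "pseudometric D'"
  shows "pseudometric (\<lambda>s t. D s t + D' s t)"
proof -
  have "D r t + D' r t \<le> (D r s + D' r s) + (D s t + D' s t)" for r s t
  proof -
    have "D r t \<le> D r s + D s t" "D' r t \<le> D' r s + D' s t"
      using D D' unfolding pseudometric_def by blast+
    then show ?thesis by simp
  qed
  moreover have "D s t + D' s t = D t s + D' t s" for s t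
    using D D' unfolding pseudometric_def by metis
  moreover have "0 \<le> D s t + D' s t" "D s s + D' s s = 0" for s t
    using D D' unfolding pseudometric_def by simp_all
  ultimately show ?thesis
    unfolding pseudometric_def by blast
qed

lemma continuous_pm_add:
  assumes "continuous_pm D" "continuous_pm D'"
  shows "continuous_pm (\<lambda>s t. D s t + D' s t)"
  unfolding continuous_pm_def
proof (intro allI impI)
  fix t \<epsilon> :: real assume "0 < \<epsilon>"
  then have \<epsilon>: "0 < \<epsilon> / 2" by simp
  obtain d where d: "d > 0" "\<forall>s. \<bar>s - t\<bar> < d \<longrightarrow> D s t < \<epsilon> / 2"
    using assms(1) \<epsilon> unfolding continuous_pm_def by blast
  obtain d' where d': "d' > 0" "\<forall>s. \<bar>s - t\<bar> < d' \<longrightarrow> D' s t < \<epsilon> / 2"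
    using assms(2) \<epsilon> unfolding continuous_pm_def by blast
  have "D s t + D' s t < \<epsilon> / 2 + \<epsilon> / 2" if "\<bar>s - t\<bar> < min d d'" for s
    using that d d' by (intro add_strict_mono) auto
  then show "\<exists>\<delta>>0. \<forall>s. \<bar>s - t\<bar> < \<delta> \<longrightarrow> D s t + D' s t < \<epsilon>"
    using d(1) d'(1) by (intro exI[of _ "min d d'"]) simp
qed

lemma returning_add:
  assumes D: "returning D \<sigma>" and D': "returning D' \<sigma>"
  shows "returning (\<lambda>s t. D s t + D' s t) \<sigma>"
  unfolding returning_def
proof (intro allI impI conjI)
  fix t \<epsilon> :: real assume "0 < \<epsilon>"
  then have \<epsilon>: "0 < \<epsilon> / 2" by simp
  obtain k where k: "\<forall>i\<ge>k. \<forall>l\<ge>k. D (t + \<sigma> i) (t + \<sigma> l) < \<epsilon> / 2"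
    using returning_CauchyD[OF D \<epsilon>] by blast
  obtain k' where k': "\<forall>i\<ge>k'. \<forall>l\<ge>k'. D' (t + \<sigma> i) (t + \<sigma> l) < \<epsilon> / 2"
    using returning_CauchyD[OF D' \<epsilon>] by blast
  have "D (t + \<sigma> i) (t + \<sigma> l) + D' (t + \<sigma> i) (t + \<sigma> l) < \<epsilon> / 2 + \<epsilon> / 2"
    if "max k k' \<le> i" "max k k' \<le> l" for i l
    using that k k' by (intro add_strict_mono) auto
  then show "\<exists>k0. \<forall>k\<ge>k0. \<forall>l\<ge>k0. D (t + \<sigma> k) (t + \<sigma> l) + D' (t + \<sigma> k) (t + \<sigma> l) < \<epsilon>"
    by (intro exI[of _ "max k k'"]) simp
next
  fix t \<epsilon> :: real assume "0 < \<epsilon>"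
  then have \<epsilon>: "0 < \<epsilon> / 2" by simp
  obtain k where k: "\<forall>i\<ge>k. \<exists>m0. \<forall>m\<ge>m0. D (t - \<sigma> i + \<sigma> m) t < \<epsilon> / 2"
    using returning_returnD[OF D \<epsilon>] by blast
  obtain k' where k': "\<forall>i\<ge>k'. \<exists>m0. \<forall>m\<ge>m0. D' (t - \<sigma> i + \<sigma> m) t < \<epsilon> / 2"
    using returning_returnD[OF D' \<epsilon>] by blast
  have "\<exists>m0. \<forall>m\<ge>m0. D (t - \<sigma> i + \<sigma> m) t + D' (t - \<sigma> i + \<sigma> m) t < \<epsilon>" if "i \<ge> max k k'" for i
  proof -
    have "k \<le> i" "k' \<le> i" using that by auto
    then obtain m m' where m: "\<forall>j\<ge>m. D (t - \<sigma> i + \<sigma> j) t < \<epsilon> / 2"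
      and m': "\<forall>j\<ge>m'. D' (t - \<sigma> i + \<sigma> j) t < \<epsilon> / 2"
      using k k' by blast
    have "D (t - \<sigma> i + \<sigma> j) t + D' (t - \<sigma> i + \<sigma> j) t < \<epsilon> / 2 + \<epsilon> / 2" if "max m m' \<le> j" for j
      using that m m' by (intro add_strict_mono) auto
    then show ?thesis by (intro exI[of _ "max m m'"]) simp
  qed
  then show "\<exists>k0. \<forall>k\<ge>k0. \<exists>m0. \<forall>m\<ge>m0. D (t - \<sigma> k + \<sigma> m) t + D' (t - \<sigma> k + \<sigma> m) t < \<epsilon>"
    by blast
qed

lemma automorphic_pm_add:
  assumes "automorphic_pm D" "automorphic_pm D'"
  shows "automorphic_pm (\<lambda>s t. D s t + D' s t)"
  unfolding automorphic_pm_def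
proof
  fix s :: "nat \<Rightarrow> real"
  obtain r where r: "strict_mono r" "returning D (s \<circ> r)"
    using assms(1) unfolding automorphic_pm_def by blast
  obtain r' where r': "strict_mono r'" "returning D' (s \<circ> r \<circ> r')"
    using assms(2) unfolding automorphic_pm_def by blast
  have "returning (\<lambda>s t. D s t + D' s t) (s \<circ> r \<circ> r')"
    by (intro returning_add returning_strict_mono r r')
  then show "\<exists>r. strict_mono r \<and> returning (\<lambda>s t. D s t + D' s t) (s \<circ> r)"
    using strict_mono_o[OF r(1) r'(1)] by (auto simp: comp_assoc)
qed

text \<open>The centres a and b that the two nets assign to one translation are unrelated, so
  neither serves the sum. Each pair (a, b) instead gets one representative translation near both;
  comparison through a and through b takes two steps in each pseudometric, hence \<epsilon> /
  4.\<close>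

lemma translates_tb_add:
  assumes D: "translates_tb D" "pseudometric D" and D': "translates_tb D'" "pseudometric D'"
  shows "translates_tb (\<lambda>s t. D s t + D' s t)"
  unfolding translates_tb_def
proof (intro allI impI)
  fix \<epsilon> :: real assume "0 < \<epsilon>"
  then have \<epsilon>: "0 < \<epsilon> / 4" by simp
  obtain T where T: "finite T" "\<And>\<tau>. \<exists>\<sigma>\<in>T. \<forall>t. D (t + \<tau>) (t + \<sigma>) < \<epsilon> / 4"
    using D \<epsilon> unfolding translates_tb_def by metis
  obtain T' where T': "finite T'" "\<And>\<tau>. \<exists>\<sigma>\<in>T'. \<forall>t. D' (t + \<tau>) (t + \<sigma>) < \<epsilon> / 4"
    using D' \<epsilon> unfolding translates_tb_def by metis
  define near where "near = (\<lambda>(a, b) \<tau>. (\<forall>t. D (t + \<tau>) (t + a) < \<epsilon> / 4) \<and> (\<forall>t. D' (t + \<tau>) (t + b) < \<epsilon> / 4))"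
  \<comment> \<open>For a pair that no translation realises the choice is arbitrary; it only adds a
    harmless point to the finite net.\<close>
  define rep where "rep = (\<lambda>c. SOME \<tau>. near c \<tau>)"
  show "\<exists>S. finite S \<and> (\<forall>\<tau>. \<exists>\<sigma>\<in>S. \<forall>t. D (t + \<tau>) (t + \<sigma>) + D' (t + \<tau>) (t + \<sigma>) < \<epsilon>)"
  proof (intro exI[of _ "rep ` (T \<times> T')"] conjI allI)
    fix \<tau>
    obtain a b where ab: "a \<in> T" "b \<in> T'" "near (a, b) \<tau>"
      using T(2)[of \<tau>] T'(2)[of \<tau>] unfolding near_def by auto
    then have rep: "near (a, b) (rep (a, b))"
      unfolding rep_def by (metis someI)
    have "D (t + \<tau>) (t + rep (a, b)) + D' (t + \<tau>) (t + rep (a, b)) < \<epsilon>" for t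
    proof -
      have "D (t + \<tau>) (t + rep (a, b)) \<le> D (t + \<tau>) (t + a) + D (t + rep (a, b)) (t + a)"
        "D' (t + \<tau>) (t + rep (a, b)) \<le> D' (t + \<tau>) (t + b) + D' (t + rep (a, b)) (t + b)"
        using D(2) D'(2) unfolding pseudometric_def by metis+
      moreover have "D (t + \<tau>) (t + a) < \<epsilon> / 4" "D (t + rep (a, b)) (t + a) < \<epsilon> / 4"
        "D' (t + \<tau>) (t + b) < \<epsilon> / 4" "D' (t + rep (a, b)) (t + b) < \<epsilon> / 4"
        using ab(3) rep unfolding near_def by auto
      ultimately show ?thesis by linarith
    qed
    with ab show "\<exists>\<sigma>\<in>rep ` (T \<times> T'). \<forall>t. D (t + \<tau>) (t + \<sigma>) + D' (t + \<tau>) (t + \<sigma>) < \<epsilon>"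
      by blast
  qed (use T T' in auto)
qed

text \<open>An arbitrary P covers continuity, automorphy and the conjunction of
  \<open>pseudometric\<close> with \<open>translates_tb\<close>; the conjunction is carried along
  because adding nets uses the triangle inequality.\<close>

lemma pm_sum_induct:
  assumes "P D" "\<And>x. x \<in> F \<Longrightarrow> P (E x)" "finite F"
    and "\<And>D D'. P D \<Longrightarrow> P D' \<Longrightarrow> P (\<lambda>s t. D s t + D' s t)"
  shows "P (\<lambda>s t. D s t + (\<Sum>x\<in>F. E x s t) :: real)"
  using assms(3,2)
proof (induction F)
  case (insert x F)
  have "P (\<lambda>s t. E x s t + (D s t + (\<Sum>x\<in>F. E x s t)))"
    by (rule assms(4)[of "E x"]) (use insert in auto)
  then show ?case using insert.hyps by (simp add: add.left_commute)
qed (simp add: assms)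

text \<open>Up to an almost period every translation lies in a compact interval, on which \<open>D\<close> is
  uniformly continuous.\<close>

lemma translates_tb_if_almost_periodic:
  assumes D: "pseudometric D" and c: "continuous_pm D"
    and ap: "\<And>\<epsilon>. 0 < \<epsilon> \<Longrightarrow> relatively_dense {\<tau>. \<forall>t. D (t + \<tau>) t \<le> \<epsilon>}"
  shows "translates_tb D"
proof -
  have D0: "D s s = 0" and D_commute: "D s t = D t s" and D_tri: "D r t \<le> D r s + D s t" for r s t
    using D unfolding pseudometric_def by metis+
  have ap': "\<exists>l>0. \<forall>c. \<exists>\<tau>\<in>{c..c+l}. \<forall>t. D (t + \<tau>) t \<le> \<epsilon>" if "0 < \<epsilon>" for \<epsilon>
    using ap[OF that] unfolding relatively_dense_def by blast
  have cont: "continuous_on UNIV (\<lambda>z. D (fst z) (snd z))"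
    unfolding continuous_on_iff
  proof (intro ballI allI impI)
    fix z :: "real \<times> real" and \<epsilon> :: real assume "0 < \<epsilon>"
    then have "0 < \<epsilon> / 2" by simp
    then obtain d d' where d: "d > 0" "d' > 0"
      "\<And>s. \<bar>s - fst z\<bar> < d \<Longrightarrow> D s (fst z) < \<epsilon> / 2" "\<And>s. \<bar>s - snd z\<bar> < d' \<Longrightarrow> D s (snd z) < \<epsilon> / 2"
      using c unfolding continuous_pm_def by metis
    show "\<exists>d>0. \<forall>y\<in>UNIV. dist y z < d \<longrightarrow> dist (D (fst y) (snd y)) (D (fst z) (snd z)) < \<epsilon>"
    proof (intro exI[of _ "min d d'"] conjI ballI impI)
      fix y assume y: "dist y z < min d d'"
      have "\<bar>fst y - fst z\<bar> < d" "\<bar>snd y - snd z\<bar> < d'"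
        using y dist_fst_le[of y z] dist_snd_le[of y z] by (auto simp: dist_real_def)
      then have "D (fst y) (fst z) < \<epsilon> / 2" "D (snd y) (snd z) < \<epsilon> / 2"
        using d by auto
      then show "dist (D (fst y) (snd y)) (D (fst z) (snd z)) < \<epsilon>"
        using D_tri[of "fst y" "snd y" "fst z"] D_tri[of "fst z" "snd y" "snd z"]
          D_tri[of "fst z" "snd z" "fst y"] D_tri[of "fst y" "snd z" "snd y"]
          D_commute[of "fst y" "fst z"] D_commute[of "snd y" "snd z"]
        by (auto simp: dist_real_def)
    qed (use d in auto)
  qed
  have unif: "\<exists>\<delta>>0. \<forall>s t. \<bar>s - t\<bar> < \<delta> \<longrightarrow> D s t < \<epsilon>" if \<epsilon>: "0 < \<epsilon>" for \<epsilon>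
  proof -
    have \<epsilon>': "0 < \<epsilon> / 4" using \<epsilon> by simp
    obtain l where l: "l > 0" "\<And>c. \<exists>\<tau>\<in>{c..c+l}. \<forall>t. D (t + \<tau>) t \<le> \<epsilon> / 4"
      using ap'[OF \<epsilon>'] by metis
    \<comment> \<open>An almost period moves s into [0,l]; as t lies less than 1 to the right of s,
      it lands in [0,l+1].\<close>
    have "uniformly_continuous_on ({0..l+1} \<times> {0..l+1}) (\<lambda>z. D (fst z) (snd z))"
      by (intro compact_uniformly_continuous compact_Times continuous_on_subset[OF cont]) auto
    then obtain \<delta> where \<delta>: "\<delta> > 0" "\<And>y z. y \<in> {0..l+1} \<times> {0..l+1} \<Longrightarrow> z \<in> {0..l+1} \<times> {0..l+1} \<Longrightarrow>
        dist y z < \<delta> \<Longrightarrow> dist (D (fst y) (snd y)) (D (fst z) (snd z)) < \<epsilon> / 4"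
      unfolding uniformly_continuous_on_def using \<epsilon>' by metis
    show ?thesis
    proof (intro exI[of _ "min \<delta> 1"] conjI allI impI)
      have *: "D s t < \<epsilon>" if st: "s \<le> t" "t - s < min \<delta> 1" for s t
      proof -
        obtain \<tau> where \<tau>: "\<tau> \<in> {-s..-s+l}" "\<And>t. D (t + \<tau>) t \<le> \<epsilon> / 4"
          using l(2)[of "-s"] by blast
        have "dist (D (s + \<tau>) (t + \<tau>)) (D (s + \<tau>) (s + \<tau>)) < \<epsilon> / 4"
          using \<delta>(2)[of "(s + \<tau>, t + \<tau>)" "(s + \<tau>, s + \<tau>)"] st \<tau>
          by (auto simp: dist_Pair_Pair dist_real_def)
        then have "D (s + \<tau>) (t + \<tau>) < \<epsilon> / 4" by (auto simp: D0 dist_real_def)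
        then show ?thesis
          using \<tau>(2)[of s] \<tau>(2)[of t] D_tri[of s t "s + \<tau>"] D_tri[of "s + \<tau>" t "t + \<tau>"]
            D_commute[of s "s + \<tau>"] \<epsilon> by linarith
      qed
      fix s t assume "\<bar>s - t\<bar> < min \<delta> 1"
      then show "D s t < \<epsilon>"
        using *[of s t] *[of t s] D_commute[of s t] by (cases "s \<le> t") auto
    qed (use \<delta> in auto)
  qed
  show ?thesis
    unfolding translates_tb_def
  proof (intro allI impI)
    fix \<epsilon> :: real assume \<epsilon>: "0 < \<epsilon>"
    then have \<epsilon>': "0 < \<epsilon> / 4" by simp
    obtain l where l: "l > 0" "\<And>c. \<exists>\<tau>\<in>{c..c+l}. \<forall>t. D (t + \<tau>) t \<le> \<epsilon> / 4"
      using ap'[OF \<epsilon>'] by metis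
    obtain \<delta> where \<delta>: "\<delta> > 0" "\<And>s t. \<bar>s - t\<bar> < \<delta> \<Longrightarrow> D s t < \<epsilon> / 4"
      using unif[OF \<epsilon>'] by metis
    obtain T where T: "finite T" "{0..l} \<subseteq> (\<Union>x\<in>T. ball x \<delta>)"
      using compact_Icc[of 0 l] \<delta>(1) unfolding compact_eq_totally_bounded by metis
    show "\<exists>T. finite T \<and> (\<forall>\<tau>. \<exists>\<sigma>\<in>T. \<forall>t. D (t + \<tau>) (t + \<sigma>) < \<epsilon>)"
    proof (intro exI[of _ T] conjI allI T(1))
      fix \<tau>
      obtain \<tau>' where \<tau>': "\<tau>' \<in> {-\<tau>..-\<tau>+l}" "\<And>t. D (t + \<tau>') t \<le> \<epsilon> / 4"
        using l(2)[of "-\<tau>"] by blast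
      then have "\<tau> + \<tau>' \<in> {0..l}" by auto
      then obtain \<sigma> where \<sigma>: "\<sigma> \<in> T" "\<bar>\<tau> + \<tau>' - \<sigma>\<bar> < \<delta>"
        using T(2) by (auto simp: dist_real_def abs_minus_commute)
      have "D (t + \<tau>) (t + \<sigma>) < \<epsilon>" for t
        using \<tau>'(2)[of "t + \<tau>"] \<delta>(2)[of "t + \<tau> + \<tau>'" "t + \<sigma>"] \<sigma>(2)
          D_tri[of "t + \<tau>" "t + \<sigma>" "t + \<tau> + \<tau>'"] D_commute[of "t + \<tau>" "t + \<tau> + \<tau>'"] \<epsilon>
        by (simp add: diff_diff_eq2 algebra_simps)
      with \<sigma> show "\<exists>\<sigma>\<in>T. \<forall>t. D (t + \<tau>) (t + \<sigma>) < \<epsilon>" by blast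
    qed
  qed
qed

text \<open>If the translations by \<tau> and \<sigma> are \<epsilon>-close, then \<tau> - \<sigma>
  is an \<epsilon>-almost period. Taking \<tau> = c + B, where B bounds the finite net, places it in
  [c, c + 2B].\<close>

lemma relatively_dense_if_translates_tb:
  assumes "translates_tb D" "0 < \<epsilon>"
  shows "relatively_dense {\<tau>. \<forall>t. D (t + \<tau>) t \<le> \<epsilon>}"
proof -
  obtain T where T: "finite T" "\<And>\<tau>. \<exists>\<sigma>\<in>T. \<forall>t. D (t + \<tau>) (t + \<sigma>) < \<epsilon>"
    using assms unfolding translates_tb_def by metis
  obtain B where B: "B > 0" "\<And>\<sigma>. \<sigma> \<in> T \<Longrightarrow> \<bar>\<sigma>\<bar> \<le> B"
    using finite_imp_bounded[OF T(1)] unfolding bounded_pos by auto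
  have "\<exists>\<rho>\<in>{c..c + 2 * B}. \<forall>t. D (t + \<rho>) t \<le> \<epsilon>" for c
  proof -
    obtain \<sigma> where \<sigma>: "\<sigma> \<in> T" "\<And>t. D (t + (c + B)) (t + \<sigma>) < \<epsilon>"
      using T(2) by blast
    have "D (t + (c + B - \<sigma>)) t \<le> \<epsilon>" for t
      using \<sigma>(2)[of "t - \<sigma>"] by (simp add: algebra_simps)
    then show ?thesis
      using B(2)[OF \<sigma>(1)] by (intro bexI[of _ "c + B - \<sigma>"]) auto
  qed
  then show ?thesis
    unfolding relatively_dense_def using B(1) by (intro exI[of _ "2 * B"]) auto
qed

text \<open>Total boundedness of the set of single windows of u; unlike in
  \<open>translates_tb\<close>, no uniformity over a common shift is asked.\<close>

definition tb_pm :: "(real \<Rightarrow> real \<Rightarrow> real) \<Rightarrow> bool" where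
  "tb_pm D \<longleftrightarrow> (\<forall>\<epsilon>>0. \<exists>T. finite T \<and> (\<forall>t. \<exists>s\<in>T. D t s < \<epsilon>))"

lemma tb_pm_if_translates_tb:
  assumes "translates_tb D"
  shows "tb_pm D"
  unfolding tb_pm_def
proof (intro allI impI)
  fix \<epsilon> :: real assume "0 < \<epsilon>"
  then obtain T where "finite T" "\<And>\<tau>. \<exists>\<sigma>\<in>T. \<forall>t. D (t + \<tau>) (t + \<sigma>) < \<epsilon>"
    using assms unfolding translates_tb_def by metis
  then show "\<exists>T. finite T \<and> (\<forall>t. \<exists>s\<in>T. D t s < \<epsilon>)"
    by (intro exI[of _ T]) (metis add_0)
qed

text \<open>Otherwise there is an \<epsilon>-separated sequence of windows, and the Cauchy condition
  at t = 0 fails along each of its subsequences.\<close>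

lemma tb_pm_if_automorphic:
  assumes D: "pseudometric D" and aa: "automorphic_pm D"
  shows "tb_pm D"
  unfolding tb_pm_def
proof (intro allI impI, rule ccontr)
  fix \<epsilon> :: real assume \<epsilon>: "0 < \<epsilon>"
  assume "\<not> (\<exists>T. finite T \<and> (\<forall>t. \<exists>s\<in>T. D t s < \<epsilon>))"
  then have ex: "\<exists>t. \<forall>s\<in>T. \<epsilon> \<le> D t s" if "finite T" for T
    using that by (meson not_le)
  have "\<exists>x::nat \<Rightarrow> real. \<forall>n. \<forall>s\<in>x ` {..<n}. \<epsilon> \<le> D (x n) s"
    by (rule dependent_wellorder_choice) (use ex[OF finite_imageI[OF finite_lessThan]] in auto)
  then obtain x :: "nat \<Rightarrow> real" where x: "\<And>m n. m < n \<Longrightarrow> \<epsilon> \<le> D (x n) (x m)"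
    by auto
  obtain r where r: "strict_mono r" "returning D (x \<circ> r)"
    using aa unfolding automorphic_pm_def by blast
  then obtain k0 where "\<And>k l. k \<ge> k0 \<Longrightarrow> l \<ge> k0 \<Longrightarrow> D (0 + (x \<circ> r) k) (0 + (x \<circ> r) l) < \<epsilon>"
    using returning_CauchyD[of D "x \<circ> r" \<epsilon>] \<epsilon> by metis
  from this[of "Suc k0" k0] x[of "r k0" "r (Suc k0)"] r(1) show False
    by (auto simp: strict_mono_Suc_iff)
qed

section \<open>Strong measurability and translations\<close>

lemma finite_measure_lebesgue_on_Ioo [simp]: "finite_measure (lebesgue_on {a<..<b::real})"
  using emeasure_lborel_Ioo[of a b] by (cases "a \<le> b") (auto intro!: finite_measureI simp: emeasure_restrict_space)

lemma strongly_measurable_simple: "simple_function M s \<Longrightarrow> strongly_measurable M s"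
  unfolding strongly_measurable_def by (intro exI[of _ "\<lambda>_. s"]) auto

text \<open>Truncating at 1 makes the distance integrable on a finite measure space however large u
  is, so dominated convergence applies to the defining simple functions. Smallness of this integral
  expresses closeness in measure.\<close>

lemma strongly_measurable_approx:
  fixes S :: "real set" and u :: "real \<Rightarrow> 'e::real_normed_vector"
  assumes S: "S \<in> sets lebesgue" "finite_measure (lebesgue_on S)"
    and u: "strongly_measurable (lebesgue_on S) u" and "0 < \<epsilon>"
  obtains s where "simple_function (lebesgue_on S) s"
    "(\<lambda>x. min 1 (norm (u x - s x))) \<in> borel_measurable (lebesgue_on S)"
    "(\<integral>x. min 1 (norm (u x - s x)) \<partial>lebesgue_on S) < \<epsilon>"
proof -
  let ?M = "lebesgue_on S"
  interpret finite_measure ?M by fact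
  obtain s where s: "\<And>n. simple_function ?M (s n)" "AE x in ?M. (\<lambda>n. s n x) \<longlonglongrightarrow> u x"
    using u unfolding strongly_measurable_def by blast
  have m: "(\<lambda>x. min 1 (norm (u x - s n x))) \<in> borel_measurable ?M" for n
    using strongly_measurable_norm[OF S(1) strongly_measurable_diff[OF u strongly_measurable_simple[OF s(1)[of n]]]]
    by measurable
  have "(\<lambda>n. \<integral>x. min 1 (norm (u x - s n x)) \<partial>?M) \<longlonglongrightarrow> (\<integral>x. 0 \<partial>?M)"
  proof (rule integral_dominated_convergence[where w = "\<lambda>_. 1"])
    show "AE x in ?M. (\<lambda>n. min 1 (norm (u x - s n x))) \<longlonglongrightarrow> 0"
      using s(2)
    proof eventually_elim
      case (elim x)
      have "(\<lambda>n. min 1 (norm (u x - s n x))) \<longlonglongrightarrow> min 1 (norm (u x - u x))"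
        using elim by (intro tendsto_intros)
      then show ?case by simp
    qed
  qed (use m in auto)
  then have "eventually (\<lambda>n. (\<integral>x. min 1 (norm (u x - s n x)) \<partial>?M) < \<epsilon>) sequentially"
    using \<open>0 < \<epsilon>\<close> by (auto dest: order_tendstoD(2))
  then obtain n where "(\<integral>x. min 1 (norm (u x - s n x)) \<partial>?M) < \<epsilon>"
    by (auto simp: eventually_sequentially)
  then show thesis using that s(1) m by blast
qed

lemma strongly_measurable_AE_limit:
  fixes S :: "real set" and u :: "real \<Rightarrow> 'e::real_normed_vector"
  assumes S: "S \<in> sets lebesgue" "finite_measure (lebesgue_on S)"
    and v: "\<And>n. strongly_measurable (lebesgue_on S) (v n)"
    and lim: "AE x in lebesgue_on S. (\<lambda>n. v n x) \<longlonglongrightarrow> u x"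
  shows "strongly_measurable (lebesgue_on S) u"
proof -
  let ?M = "lebesgue_on S"
  interpret finite_measure ?M by fact
  have "\<exists>s. simple_function ?M s \<and> (\<lambda>x. min 1 (norm (v n x - s x))) \<in> borel_measurable ?M \<and>
      (\<integral>x. min 1 (norm (v n x - s x)) \<partial>?M) < inverse (real (Suc n))" for n
    by (rule strongly_measurable_approx[OF S v[of n], of "inverse (real (Suc n))"]) auto
  then have "\<exists>s. \<forall>n. simple_function ?M (s n) \<and> (\<lambda>x. min 1 (norm (v n x - s n x))) \<in> borel_measurable ?M \<and>
      (\<integral>x. min 1 (norm (v n x - s n x)) \<partial>?M) < inverse (real (Suc n))"
    by (intro choice allI)
  then obtain s where s: "\<And>n. simple_function ?M (s n)"
    "\<And>n. (\<lambda>x. min 1 (norm (v n x - s n x))) \<in> borel_measurable ?M"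
    "\<And>n. (\<integral>x. min 1 (norm (v n x - s n x)) \<partial>?M) < inverse (real (Suc n))"
    by blast
  let ?g = "\<lambda>n x. min 1 (norm (v n x - s n x))"
  have i: "integrable ?M (?g n)" for n
    by (rule integrable_const_bound[where B = 1]) (use s(2) in auto)
  have "(\<lambda>n. \<integral>x. norm (?g n x) \<partial>?M) \<longlonglongrightarrow> 0"
    by (rule tendsto_sandwich[OF _ _ tendsto_const LIMSEQ_inverse_real_of_nat])
       (use s(3) in \<open>auto intro!: always_eventually less_imp_le\<close>)
  from tendsto_L1_AE_subseq[OF i this] obtain r :: "nat \<Rightarrow> nat"
    where r: "strict_mono r" "AE x in ?M. (\<lambda>n. ?g (r n) x) \<longlonglongrightarrow> 0" by blast
  have "AE x in ?M. (\<lambda>n. s (r n) x) \<longlonglongrightarrow> u x"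
    using r(2) lim
  proof eventually_elim
    case (elim x)
    \<comment> \<open>A value below 1 means that the truncation is inactive, so the genuine norms
      tend to 0.\<close>
    have "eventually (\<lambda>n. ?g (r n) x < 1) sequentially"
      using elim(1) by (rule order_tendstoD(2)) simp
    then have "eventually (\<lambda>n. ?g (r n) x = norm (v (r n) x - s (r n) x)) sequentially"
      by eventually_elim auto
    then have "(\<lambda>n. norm (v (r n) x - s (r n) x)) \<longlonglongrightarrow> 0"
      using elim(1) by (rule Lim_transform_eventually[rotated])
    then have "(\<lambda>n. v (r n) x - s (r n) x) \<longlonglongrightarrow> 0"
      by (rule tendsto_norm_zero_cancel)
    moreover have "(\<lambda>n. v (r n) x) \<longlonglongrightarrow> u x"
      using LIMSEQ_subseq_LIMSEQ[OF elim(2) r(1)] by (simp add: comp_def)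
    ultimately have "(\<lambda>n. v (r n) x - (v (r n) x - s (r n) x)) \<longlonglongrightarrow> u x - 0"
      by (intro tendsto_diff)
    then show ?case by simp
  qed
  with s(1) show ?thesis
    unfolding strongly_measurable_def by (intro exI[of _ "\<lambda>n. s (r n)"]) auto
qed

text \<open>On each of the finitely many level sets of s the function is a single F y. This is how
  f(t, s(t)) is approximated when s is simple.\<close>

lemma simple_function_of_finite_choice:
  assumes s: "simple_function M s" and F: "\<And>y. y \<in> s ` space M \<Longrightarrow> simple_function M (F y)"
  shows "simple_function M (\<lambda>x. F (s x) x)"
proof -
  have fin: "finite (s ` space M)" using s by (simp add: simple_function_def)
  have "finite (\<Union>y\<in>s ` space M. F y ` space M)"
    using fin F by (intro finite_UN_I) (auto simp: simple_function_def)
  then have "finite ((\<lambda>x. F (s x) x) ` space M)"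
    by (rule finite_subset[rotated]) auto
  moreover have "(\<lambda>x. F (s x) x) -` {z} \<inter> space M \<in> sets M" for z
  proof -
    have "(\<lambda>x. F (s x) x) -` {z} \<inter> space M
        = (\<Union>y\<in>s ` space M. (s -` {y} \<inter> space M) \<inter> (F y -` {z} \<inter> space M))"
      by auto
    also have "\<dots> \<in> sets M"
      by (intro sets.finite_UN fin sets.Int simple_functionD(2)[OF s] simple_functionD(2)[OF F])
    finally show ?thesis .
  qed
  ultimately show ?thesis by (simp add: simple_function_def)
qed

text \<open>For simple s the function f(t, s(t)) patches finitely many f(.,x); continuity of f(t,.)
  then gives f(t, u(t)) as an a.e. limit of such functions.\<close>

lemma strongly_measurable_superposition:
  fixes S :: "real set" and u :: "real \<Rightarrow> 'x::real_normed_vector"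
    and f :: "real \<Rightarrow> 'x \<Rightarrow> 'y::real_normed_vector"
  assumes S: "S \<in> sets lebesgue" "finite_measure (lebesgue_on S)"
    and u: "strongly_measurable (lebesgue_on S) u"
    and f: "\<And>x. strongly_measurable (lebesgue_on S) (\<lambda>t. f t x)"
    and cont: "AE t in lebesgue_on S. continuous_on UNIV (f t)"
  shows "strongly_measurable (lebesgue_on S) (\<lambda>t. f t (u t))"
proof -
  let ?M = "lebesgue_on S"
  obtain s where s: "\<And>n. simple_function ?M (s n)" "AE x in ?M. (\<lambda>n. s n x) \<longlonglongrightarrow> u x"
    using u unfolding strongly_measurable_def by blast
  obtain \<phi> where \<phi>: "\<And>x n. simple_function ?M (\<phi> x n)"
    "\<And>x. AE t in ?M. (\<lambda>n. \<phi> x n t) \<longlonglongrightarrow> f t x"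
    using f unfolding strongly_measurable_def by metis
  have "strongly_measurable ?M (\<lambda>t. f t (s n t))" for n
    unfolding strongly_measurable_def
  proof (intro exI[of _ "\<lambda>k t. \<phi> (s n t) k t"] conjI allI)
    show "simple_function ?M (\<lambda>t. \<phi> (s n t) k t)" for k
      by (rule simple_function_of_finite_choice[OF s(1)[of n], of "\<lambda>x. \<phi> x k"]) (rule \<phi>)
    \<comment> \<open>The null set of non-convergence depends on x, but only the finitely many
      values x of s n matter.\<close>
    have "AE t in ?M. \<forall>x\<in>s n ` space ?M. (\<lambda>k. \<phi> x k t) \<longlonglongrightarrow> f t x"
      using s(1)[of n] \<phi>(2) by (intro AE_finite_allI) (auto simp: simple_function_def)
    with AE_space show "AE t in ?M. (\<lambda>k. \<phi> (s n t) k t) \<longlonglongrightarrow> f t (s n t)"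
      by eventually_elim auto
  qed
  moreover have "AE t in ?M. (\<lambda>n. f t (s n t)) \<longlonglongrightarrow> f t (u t)"
    using s(2) cont by eventually_elim (auto intro: continuous_on_tendsto_compose)
  ultimately show ?thesis
    by (rule strongly_measurable_AE_limit[OF S])
qed

section \<open>Translation of windows\<close>

lemma distr_lebesgue_on_translation:
  "distr (lebesgue_on {a<..<b}) (lebesgue_on {c + a<..<c + b}) ((+) c) = lebesgue_on {c + a<..<c + b::real}"
  and measurable_translation_lebesgue_on:
  "(+) c \<in> lebesgue_on {a<..<b} \<rightarrow>\<^sub>M lebesgue_on {c + a<..<c + b}"
proof -
  have T: "(+) c \<in> lebesgue \<rightarrow>\<^sub>M lebesgue"
    using lebesgue_affine_measurable[of "\<lambda>_. 1" c] by simp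
  have D: "distr lebesgue lebesgue ((+) c) = lebesgue"
    using lebesgue_real_affine[of 1 c] by (simp add: density_1)
  show M: "(+) c \<in> lebesgue_on {a<..<b} \<rightarrow>\<^sub>M lebesgue_on {c + a<..<c + b}"
    using T by (intro measurable_restrict_space3) auto
  show "distr (lebesgue_on {a<..<b}) (lebesgue_on {c + a<..<c + b}) ((+) c) = lebesgue_on {c + a<..<c + b}"
  proof (rule measure_eqI)
    fix A assume "A \<in> sets (distr (lebesgue_on {a<..<b}) (lebesgue_on {c + a<..<c + b}) ((+) c))"
    then have A: "A \<in> sets (lebesgue_on {c + a<..<c + b})" by simp
    then have A': "A \<in> sets lebesgue" "A \<subseteq> {c + a<..<c + b}"
      by (auto simp: sets_restrict_space)
    have "emeasure (distr (lebesgue_on {a<..<b}) (lebesgue_on {c + a<..<c + b}) ((+) c)) A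
        = emeasure (lebesgue_on {a<..<b}) ((+) c -` A \<inter> {a<..<b})"
      by (simp add: emeasure_distr[OF M A])
    also have "\<dots> = emeasure lebesgue ((+) c -` A \<inter> {a<..<b})"
      by (intro emeasure_restrict_space) auto
    also have "(+) c -` A \<inter> {a<..<b} = (+) c -` A \<inter> space lebesgue"
      using A'(2) by auto
    also have "emeasure lebesgue \<dots> = emeasure (distr lebesgue lebesgue ((+) c)) A"
      by (rule emeasure_distr[OF T A'(1), symmetric])
    also have "\<dots> = emeasure (lebesgue_on {c + a<..<c + b}) A"
      unfolding D using A' by (intro emeasure_restrict_space[symmetric]) auto
    finally show "emeasure (distr (lebesgue_on {a<..<b}) (lebesgue_on {c + a<..<c + b}) ((+) c)) A
        = emeasure (lebesgue_on {c + a<..<c + b}) A" .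
  qed simp
qed

lemma AE_translation:
  fixes a b c :: real
  assumes "AE x in lebesgue_on {c + a<..<c + b}. P x"
  shows "AE x in lebesgue_on {a<..<b}. P (c + x)"
  by (rule AE_distrD[OF measurable_translation_lebesgue_on])
     (subst distr_lebesgue_on_translation, rule assms)

lemma Lp_translation:
  assumes u: "u \<in> Lp p (c + a) (c + b)"
  shows "(\<lambda>\<theta>. u (c + \<theta>)) \<in> Lp p a b"
proof -
  note M = measurable_translation_lebesgue_on[of c a b]
  have "integrable (lebesgue_on {c + a<..<c + b}) (\<lambda>\<theta>. norm (u \<theta>) powr p)"
    using u by (simp add: Lp_def)
  then have "integrable (distr (lebesgue_on {a<..<b}) (lebesgue_on {c + a<..<c + b}) ((+) c))
       (\<lambda>\<theta>. norm (u \<theta>) powr p)"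
    by (simp only: distr_lebesgue_on_translation)
  then have i: "integrable (lebesgue_on {a<..<b}) (\<lambda>\<theta>. norm (u (c + \<theta>)) powr p)"
    by (rule integrable_distr[OF M])
  obtain s where s: "\<And>n. simple_function (lebesgue_on {c + a<..<c + b}) (s n)"
    "AE x in lebesgue_on {c + a<..<c + b}. (\<lambda>n. s n x) \<longlonglongrightarrow> u x"
    using u unfolding Lp_def strongly_measurable_def by blast
  have "simple_function (lebesgue_on {a<..<b}) (\<lambda>x. s n (c + x))" for n
    by (rule simple_function_comp[OF M s(1), unfolded comp_def])
  then have "strongly_measurable (lebesgue_on {a<..<b}) (\<lambda>\<theta>. u (c + \<theta>))"
    unfolding strongly_measurable_def using AE_translation[OF s(2)]
    by (intro exI[of _ "\<lambda>n x. s n (c + x)"]) auto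
  with i show ?thesis by (simp add: Lp_def)
qed

lemma Lp_loc_shift: "u \<in> Lp_loc p \<Longrightarrow> (\<lambda>\<theta>. u (t + \<theta>)) \<in> Lp p 0 1"
  by (rule Lp_translation) (simp add: Lp_loc_def)

lemma measure_translation_lebesgue_on:
  fixes N :: "real set"
  assumes "N \<in> sets lebesgue"
  shows "{x. a < x \<and> x < b \<and> c + x \<in> N} \<in> sets (lebesgue_on {a<..<b})"
    and "measure (lebesgue_on {a<..<b}) {x. a < x \<and> x < b \<and> c + x \<in> N}
       = measure lebesgue ({c + a<..<c + b} \<inter> N)"
proof -
  note M = measurable_translation_lebesgue_on[of c a b]
  let ?A = "{c + a<..<c + b} \<inter> N"
  have A: "?A \<in> sets (lebesgue_on {c + a<..<c + b})"
    using assms by (auto simp: sets_restrict_space)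
  have eq: "{x. a < x \<and> x < b \<and> c + x \<in> N} = (+) c -` ?A \<inter> space (lebesgue_on {a<..<b})"
    by auto
  show "{x. a < x \<and> x < b \<and> c + x \<in> N} \<in> sets (lebesgue_on {a<..<b})"
    unfolding eq by (rule measurable_sets[OF M A])
  have "measure (lebesgue_on {a<..<b}) {x. a < x \<and> x < b \<and> c + x \<in> N}
      = measure (distr (lebesgue_on {a<..<b}) (lebesgue_on {c + a<..<c + b}) ((+) c)) ?A"
    unfolding eq by (rule measure_distr[OF M A, symmetric])
  also have "\<dots> = measure lebesgue ?A"
    unfolding distr_lebesgue_on_translation by (intro measure_restrict_space) auto
  finally show "measure (lebesgue_on {a<..<b}) {x. a < x \<and> x < b \<and> c + x \<in> N}
       = measure lebesgue ?A" .
qed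

section \<open>Completeness of \<open>L\<^sup>p(a,b;E)\<close>\<close>

lemma Lp_norm_less_iff:
  assumes "1 \<le> p" "0 < \<epsilon>"
  shows "Lp_norm p a b u < \<epsilon> \<longleftrightarrow> (\<integral>\<theta>. norm (u \<theta>) powr p \<partial>lebesgue_on {a<..<b}) < \<epsilon> powr p"
  unfolding Lp_norm_powr[OF assms(1), symmetric]
  using assms Lp_norm_nonneg[of p a b u]
  by (smt (verit) powr_less_mono2 powr_mono2)

lemma Lp_norm_le_iff:
  assumes "1 \<le> p" "0 < \<epsilon>"
  shows "Lp_norm p a b u \<le> \<epsilon> \<longleftrightarrow> (\<integral>\<theta>. norm (u \<theta>) powr p \<partial>lebesgue_on {a<..<b}) \<le> \<epsilon> powr p"
  unfolding Lp_norm_powr[OF assms(1), symmetric]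
  using assms Lp_norm_nonneg[of p a b u]
  by (smt (verit) powr_less_mono2 powr_mono2)

lemma LpI_dominated:
  assumes g: "strongly_measurable (lebesgue_on {a<..<b}) g"
    and h: "integrable (lebesgue_on {a<..<b}) h"
    and le: "AE x in lebesgue_on {a<..<b}. norm (g x) powr p \<le> h x"
  shows "g \<in> Lp p a b"
proof -
  have m: "(\<lambda>x. norm (g x) powr p) \<in> borel_measurable (lebesgue_on {a<..<b})"
    using strongly_measurable_norm[OF _ g] by simp
  have "integrable (lebesgue_on {a<..<b}) (\<lambda>x. norm (g x) powr p)"
    by (rule Bochner_Integration.integrable_bound[OF h m]) (use le in eventually_elim, auto)
  with g show ?thesis by (simp add: Lp_def)
qed

text \<open>By monotone convergence the sum of all g n has finite integral, so it is finite a.e. and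
  its terms tend to 0 there.\<close>

lemma AE_tendsto_zero_if_integrals_summable:
  fixes g :: "nat \<Rightarrow> 'a \<Rightarrow> real"
  assumes i: "\<And>n. integrable M (g n)" and nn: "\<And>n x. 0 \<le> g n x"
    and s: "summable (\<lambda>n. \<integral>x. g n x \<partial>M)"
  shows "AE x in M. (\<lambda>n. g n x) \<longlonglongrightarrow> 0"
proof -
  have m: "(\<lambda>x. ennreal (g n x)) \<in> borel_measurable M" for n
    using i by auto
  have "(\<integral>\<^sup>+x. (\<Sum>n. ennreal (g n x)) \<partial>M) = (\<Sum>n. \<integral>\<^sup>+x. ennreal (g n x) \<partial>M)"
    by (rule nn_integral_suminf[OF m])
  also have "\<dots> = (\<Sum>n. ennreal (\<integral>x. g n x \<partial>M))"
    using i nn by (simp add: nn_integral_eq_integral)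
  also have "\<dots> = ennreal (\<Sum>n. \<integral>x. g n x \<partial>M)"
    by (rule suminf_ennreal2) (use nn s in auto)
  finally have "(\<integral>\<^sup>+x. (\<Sum>n. ennreal (g n x)) \<partial>M) \<noteq> \<infinity>" by simp
  then have "AE x in M. (\<Sum>n. ennreal (g n x)) \<noteq> \<infinity>"
    by (intro nn_integral_PInf_AE) (use m in measurable)
  then show ?thesis
    by eventually_elim (use nn in \<open>auto intro!: summable_LIMSEQ_zero summable_suminf_not_top\<close>)
qed

text \<open>Riesz-Fischer: a fast Cauchy subsequence converges a.e., and Fatou's lemma upgrades its
  pointwise limit to the \<open>L^p\<close> limit of the whole sequence.\<close>

lemma Lp_complete:
  fixes h :: "nat \<Rightarrow> real \<Rightarrow> 'e::banach"
  assumes p: "1 \<le> p" and h: "\<And>n. h n \<in> Lp p a b"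
    and Cauchy: "\<And>\<epsilon>. 0 < \<epsilon> \<Longrightarrow> \<exists>N. \<forall>m\<ge>N. \<forall>n\<ge>N. Lp_norm p a b (\<lambda>\<theta>. h m \<theta> - h n \<theta>) < \<epsilon>"
  shows "\<exists>g\<in>Lp p a b. \<forall>\<epsilon>>0. \<exists>N. \<forall>n\<ge>N. Lp_norm p a b (\<lambda>\<theta>. h n \<theta> - g \<theta>) < \<epsilon>"
proof -
  let ?M = "lebesgue_on {a<..<b}"
  have int: "integrable ?M (\<lambda>\<theta>. norm (h m \<theta> - h n \<theta>) powr p)" for m n
    using Lp_diff[OF p h h] by (simp add: Lp_def)
  have Cauchy': "\<exists>N. \<forall>m\<ge>N. \<forall>n\<ge>N. (\<integral>\<theta>. norm (h m \<theta> - h n \<theta>) powr p \<partial>?M) < \<epsilon>"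
    if "0 < \<epsilon>" for \<epsilon>
    using Cauchy[of "\<epsilon> powr (1/p)"] that p by (simp add: Lp_norm_less_iff powr_powr)
  \<comment> \<open>With this c j the weighted powers \<open>e j\<close> have integral at most
    (1/2)^j. Hence \<open>e j\<close> tends to 0 a.e., which forces norm (d j) \<le> (1/2)^j
    eventually and makes the telescoping series converge.\<close>
  define c where "c j = (1/2::real) ^ j / (2 ^ j) powr p" for j :: nat
  have c: "0 < c j" for j by (simp add: c_def)
  have "\<exists>N. \<forall>j. \<forall>m\<ge>N j. \<forall>n\<ge>N j. (\<integral>\<theta>. norm (h m \<theta> - h n \<theta>) powr p \<partial>?M) < c j"
    by (intro choice allI Cauchy' c)
  then obtain N where N: "\<And>j m n. m \<ge> N j \<Longrightarrow> n \<ge> N j \<Longrightarrow>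
      (\<integral>\<theta>. norm (h m \<theta> - h n \<theta>) powr p \<partial>?M) < c j"
    by blast
  \<comment> \<open>Adding j and summing the thresholds makes k increasing, at least j and at least
    \<open>N j\<close> at the same time.\<close>
  define k where "k j = j + (\<Sum>i\<le>j. N i)" for j
  have kN: "N j \<le> k j" and kj: "j \<le> k j" and kS: "k j \<le> k (Suc j)" for j
    by (auto simp: k_def intro: trans_le_add2 member_le_sum)
  define d where "d j \<theta> = h (k (Suc j)) \<theta> - h (k j) \<theta>" for j \<theta>
  define e where "e j \<theta> = (2 ^ j * norm (d j \<theta>)) powr p" for j \<theta>
  have e_eq: "e j = (\<lambda>\<theta>. (2 ^ j) powr p * norm (d j \<theta>) powr p)" for j
    by (auto simp: e_def powr_mult)
  have e_int: "integrable ?M (e j)" for j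
    unfolding e_eq d_def using int by simp
  have "(\<integral>\<theta>. e j \<theta> \<partial>?M) \<le> (1/2) ^ j" for j
  proof -
    have "(\<integral>\<theta>. e j \<theta> \<partial>?M) = (2 ^ j) powr p * (\<integral>\<theta>. norm (d j \<theta>) powr p \<partial>?M)"
      unfolding e_eq by simp
    also have "\<dots> \<le> (2 ^ j) powr p * c j"
      unfolding d_def using N[of j "k (Suc j)" "k j"] kN[of j] kS[of j]
      by (intro mult_left_mono) auto
    also have "\<dots> = (1/2) ^ j" by (simp add: c_def)
    finally show ?thesis .
  qed
  then have "summable (\<lambda>j. \<integral>\<theta>. e j \<theta> \<partial>?M)"
    by (intro summable_comparison_test'[OF summable_geometric[of "1/2 :: real"], of 0])
       (auto simp: e_def integral_nonneg_AE)
  from AE_tendsto_zero_if_integrals_summable[OF e_int _ this]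
  have "AE \<theta> in ?M. (\<lambda>j. e j \<theta>) \<longlonglongrightarrow> 0" by (simp add: e_def)
  then have conv: "AE \<theta> in ?M. convergent (\<lambda>n. h (k n) \<theta>)"
  proof eventually_elim
    case (elim \<theta>)
    have "eventually (\<lambda>j. e j \<theta> < 1) sequentially"
      using elim by (rule order_tendstoD(2)) simp
    then have "eventually (\<lambda>j. norm (d j \<theta>) \<le> (1/2) ^ j) sequentially"
    proof eventually_elim
      case (elim j)
      have "2 ^ j * norm (d j \<theta>) < 1"
      proof (rule ccontr)
        assume "\<not> 2 ^ j * norm (d j \<theta>) < 1"
        then have "1 \<le> e j \<theta>" unfolding e_def using p by (intro ge_one_powr_ge_zero) auto
        with elim show False by simp
      qed
      then show ?case by (simp add: field_simps power_divide)
    qed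
    then have "summable (\<lambda>j. d j \<theta>)"
      by (rule summable_comparison_test_ev) (auto intro: summable_geometric)
    then have "convergent (\<lambda>n. \<Sum>j<n. d j \<theta>)"
      by (simp add: summable_iff_convergent)
    then have "convergent (\<lambda>n. h (k 0) \<theta> + (\<Sum>j<n. d j \<theta>))"
      by (intro convergent_add convergent_const)
    moreover have "(\<Sum>j<n. d j \<theta>) = h (k n) \<theta> - h (k 0) \<theta>" for n
      unfolding d_def by (rule sum_lessThan_telescope)
    ultimately show ?case by simp
  qed
  define g where "g \<theta> = lim (\<lambda>n. h (k n) \<theta>)" for \<theta>
  have lim: "AE \<theta> in ?M. (\<lambda>n. h (k n) \<theta>) \<longlonglongrightarrow> g \<theta>"
    using conv by eventually_elim (simp add: g_def convergent_LIMSEQ_iff)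
  have h_sm: "strongly_measurable ?M (h n)" for n
    using h by (simp add: Lp_def)
  have g_sm: "strongly_measurable ?M g"
    by (rule strongly_measurable_AE_limit[OF _ _ h_sm lim]) auto
  have diff_sm: "strongly_measurable ?M (\<lambda>\<theta>. h n \<theta> - g \<theta>)" for n
    by (intro strongly_measurable_diff h_sm g_sm)
  have diff_m: "(\<lambda>\<theta>. norm (h n \<theta> - g \<theta>) powr p) \<in> borel_measurable ?M" for n
    using strongly_measurable_norm[OF _ diff_sm] by simp
  have Fatou: "(\<integral>\<^sup>+\<theta>. ennreal (norm (h n \<theta> - g \<theta>) powr p) \<partial>?M) \<le> ennreal \<epsilon>"
    if L: "\<And>m. m \<ge> L \<Longrightarrow> (\<integral>\<theta>. norm (h n \<theta> - h m \<theta>) powr p \<partial>?M) < \<epsilon>" for n L \<epsilon>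
  proof -
    have "(\<integral>\<^sup>+\<theta>. ennreal (norm (h n \<theta> - g \<theta>) powr p) \<partial>?M)
        = (\<integral>\<^sup>+\<theta>. liminf (\<lambda>j. ennreal (norm (h n \<theta> - h (k j) \<theta>) powr p)) \<partial>?M)"
    proof (rule nn_integral_cong_AE)
      show "AE \<theta> in ?M. ennreal (norm (h n \<theta> - g \<theta>) powr p) =
          liminf (\<lambda>j. ennreal (norm (h n \<theta> - h (k j) \<theta>) powr p))"
        using lim
      proof eventually_elim
        case (elim \<theta>)
        have "(\<lambda>j. ennreal (norm (h n \<theta> - h (k j) \<theta>) powr p)) \<longlonglongrightarrow> ennreal (norm (h n \<theta> - g \<theta>) powr p)"
          using elim p by (intro tendsto_ennrealI tendsto_powr' tendsto_intros) auto
        then show ?case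
          by (intro lim_imp_Liminf[symmetric]) auto
      qed
    qed
    also have "\<dots> \<le> liminf (\<lambda>j. \<integral>\<^sup>+\<theta>. ennreal (norm (h n \<theta> - h (k j) \<theta>) powr p) \<partial>?M)"
      by (rule nn_integral_liminf) (use int in auto)
    also have "\<dots> \<le> ennreal \<epsilon>"
    proof (rule Liminf_le)
      show "\<forall>\<^sub>F j in sequentially. (\<integral>\<^sup>+\<theta>. ennreal (norm (h n \<theta> - h (k j) \<theta>) powr p) \<partial>?M) \<le> ennreal \<epsilon>"
        unfolding eventually_sequentially
      proof (intro exI allI impI)
        fix j assume "L \<le> j"
        then have "L \<le> k j" using kj[of j] by simp
        then show "(\<integral>\<^sup>+\<theta>. ennreal (norm (h n \<theta> - h (k j) \<theta>) powr p) \<partial>?M) \<le> ennreal \<epsilon>"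
          using L[of "k j"] int by (simp add: nn_integral_eq_integral ennreal_leI)
      qed
    qed simp
    finally show ?thesis .
  qed
  have diff_Lp: "(\<lambda>\<theta>. h n \<theta> - g \<theta>) \<in> Lp p a b" 
    and diff_le: "(\<integral>\<theta>. norm (h n \<theta> - g \<theta>) powr p \<partial>?M) \<le> \<epsilon>"
    if "0 < \<epsilon>" "\<And>m. m \<ge> L \<Longrightarrow> (\<integral>\<theta>. norm (h n \<theta> - h m \<theta>) powr p \<partial>?M) < \<epsilon>" for n L \<epsilon>
  proof -
    have *: "(\<integral>\<^sup>+\<theta>. ennreal (norm (h n \<theta> - g \<theta>) powr p) \<partial>?M) \<le> ennreal \<epsilon>"
      using Fatou[OF that(2)] by simp
    have i: "integrable ?M (\<lambda>\<theta>. norm (h n \<theta> - g \<theta>) powr p)"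
      by (rule integrableI_nonneg[OF diff_m]) (use * in \<open>auto simp: top_unique less_top[symmetric]\<close>)
    then show "(\<lambda>\<theta>. h n \<theta> - g \<theta>) \<in> Lp p a b"
      using diff_sm by (simp add: Lp_def)
    show "(\<integral>\<theta>. norm (h n \<theta> - g \<theta>) powr p \<partial>?M) \<le> \<epsilon>"
      using * i that(1) by (simp add: nn_integral_eq_integral)
  qed
  show ?thesis
  proof (intro bexI allI impI)
    obtain L where L: "\<And>m n. m \<ge> L \<Longrightarrow> n \<ge> L \<Longrightarrow> (\<integral>\<theta>. norm (h m \<theta> - h n \<theta>) powr p \<partial>?M) < 1"
      using Cauchy'[of 1] by auto
    \<comment> \<open>Fatou yields integrability only for differences h n - g; g itself is recovered
      from one of them.\<close>
    have "(\<lambda>\<theta>. h L \<theta> - (h L \<theta> - g \<theta>)) \<in> Lp p a b"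
      by (intro Lp_diff p h diff_Lp[where L = L and \<epsilon> = 1]) (auto intro: L)
    then show "g \<in> Lp p a b" by simp
    fix \<epsilon> :: real assume \<epsilon>: "0 < \<epsilon>"
    then have \<epsilon>': "0 < (\<epsilon> / 2) powr p" by simp
    obtain L where L: "\<And>m n. m \<ge> L \<Longrightarrow> n \<ge> L \<Longrightarrow> (\<integral>\<theta>. norm (h m \<theta> - h n \<theta>) powr p \<partial>?M) < (\<epsilon>/2) powr p"
      using Cauchy'[OF \<epsilon>'] by auto
    have "Lp_norm p a b (\<lambda>\<theta>. h n \<theta> - g \<theta>) < \<epsilon>" if "n \<ge> L" for n
    proof -
      have "Lp_norm p a b (\<lambda>\<theta>. h n \<theta> - g \<theta>) \<le> \<epsilon> / 2"
        using diff_le[OF \<epsilon>' L[OF that]] p \<epsilon> by (subst Lp_norm_le_iff) auto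
      with \<epsilon> show ?thesis by simp
    qed
    then show "\<exists>N. \<forall>n\<ge>N. Lp_norm p a b (\<lambda>\<theta>. h n \<theta> - g \<theta>) < \<epsilon>" by blast
  qed
qed

section \<open>Totally bounded subsets of \<open>L\<^sup>p(a,b;E)\<close>\<close>

definition Lp_totally_bounded :: "real \<Rightarrow> real \<Rightarrow> real \<Rightarrow> (real \<Rightarrow> 'e::banach) set \<Rightarrow> bool" where
  "Lp_totally_bounded p a b G \<longleftrightarrow> G \<subseteq> Lp p a b \<and> (\<forall>\<epsilon>>0. \<exists>H. finite H \<and> H \<subseteq> Lp p a b \<and>
     (\<forall>g\<in>G. \<exists>h\<in>H. Lp_norm p a b (\<lambda>\<theta>. g \<theta> - h \<theta>) < \<epsilon>))"

lemma Lp_totally_boundedD: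
  "Lp_totally_bounded p a b G \<Longrightarrow> 0 < \<epsilon> \<Longrightarrow>
     \<exists>H. finite H \<and> H \<subseteq> Lp p a b \<and> (\<forall>g\<in>G. \<exists>h\<in>H. Lp_norm p a b (\<lambda>\<theta>. g \<theta> - h \<theta>) < \<epsilon>)"
  by (simp add: Lp_totally_bounded_def)

text \<open>The part of h above a level n has small integral by dominated convergence; the part
  below contributes at most n times the measure of A.\<close>

lemma integrable_abs_continuous:
  fixes h :: "'a \<Rightarrow> real"
  assumes h: "integrable M h" and nn: "\<And>x. 0 \<le> h x" and M: "finite_measure M" and \<epsilon>: "0 < \<epsilon>"
  obtains r where "0 < r" "\<And>A. A \<in> sets M \<Longrightarrow> measure M A \<le> r \<Longrightarrow> (\<integral>x. indicator A x * h x \<partial>M) < \<epsilon>"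
proof -
  interpret finite_measure M by fact
  have i: "integrable M (\<lambda>x. h x - min (real n) (h x))" for n
    by (rule Bochner_Integration.integrable_bound[OF h]) (use h nn in \<open>auto simp: min_def\<close>)
  have "(\<lambda>n. \<integral>x. h x - min (real n) (h x) \<partial>M) \<longlonglongrightarrow> (\<integral>x. 0 \<partial>M)"
  proof (rule integral_dominated_convergence[where w = h])
    show "AE x in M. (\<lambda>n. h x - min (real n) (h x)) \<longlonglongrightarrow> 0"
    proof (rule AE_I2, rule tendsto_eventually)
      fix x
      obtain N where "h x \<le> real N" using real_arch_simple by blast
      then have "h x - min (real n) (h x) = 0" if "n \<ge> N" for n
        using that of_nat_mono[of N n, where 'a = real] by (simp add: min_def)
      then show "\<forall>\<^sub>F n in sequentially. h x - min (real n) (h x) = 0"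
        by (auto simp: eventually_sequentially)
    qed
  qed (use h nn i in \<open>auto simp: min_def\<close>)
  then have "eventually (\<lambda>n. (\<integral>x. h x - min (real n) (h x) \<partial>M) < \<epsilon> / 2) sequentially"
    using \<epsilon> by (intro order_tendstoD(2)) auto
  then obtain n where n: "(\<integral>x. h x - min (real n) (h x) \<partial>M) < \<epsilon> / 2"
    by (auto simp: eventually_sequentially)
  show thesis
  proof
    \<comment> \<open>Chosen so that n times this is at most \<epsilon> / 2; the + 1 covers n =
      0.\<close>
    show "0 < \<epsilon> / (2 * (real n + 1))" using \<epsilon> by simp
    fix A assume A: "A \<in> sets M" "measure M A \<le> \<epsilon> / (2 * (real n + 1))"
    have "(\<integral>x. indicator A x * h x \<partial>M) \<le> (\<integral>x. (h x - min (real n) (h x)) + real n * indicator A x \<partial>M)"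
    proof (rule integral_mono)
      show "integrable M (\<lambda>x. indicator A x * h x)"
        using integrable_real_mult_indicator[OF A(1) h] by (simp add: mult.commute)
      show "integrable M (\<lambda>x. (h x - min (real n) (h x)) + real n * indicator A x)"
        using A i by (intro Bochner_Integration.integrable_add integrable_mult_right integrable_real_indicator)
           (auto simp: less_top[symmetric])
      show "indicator A x * h x \<le> (h x - min (real n) (h x)) + real n * indicator A x" for x
        using nn[of x] by (auto simp: indicator_def min_def)
    qed
    also have "\<dots> = (\<integral>x. h x - min (real n) (h x) \<partial>M) + real n * measure M A"
      using A i by (subst Bochner_Integration.integral_add) (auto simp: less_top[symmetric])
    also have "real n * measure M A \<le> real n * (\<epsilon> / (2 * (real n + 1)))"
      using A by (intro mult_left_mono) auto
    also have "\<dots> \<le> \<epsilon> / 2"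
      using \<epsilon> by (simp add: field_simps)
    finally show "(\<integral>x. indicator A x * h x \<partial>M) < \<epsilon>" using n by simp
  qed
qed

lemma powr_norm_le_diff:
  assumes "1 \<le> p"
  shows "norm u powr p \<le> 2 powr p * (norm (u - v) powr p + norm v powr p)"
proof -
  have "norm u powr p \<le> (norm (u - v) + norm v) powr p"
    using assms norm_triangle_ineq[of "u - v" v] by (intro powr_mono2) auto
  also have "\<dots> \<le> 2 powr p * (norm (u - v) powr p + norm v powr p)"
    using assms by (intro powr_add_le) auto
  finally show ?thesis .
qed

text \<open>Absolute continuity of the integral handles the finitely many centres, and replacing g
  by its centre costs only their distance, whatever A is.\<close>

lemma Lp_totally_bounded_equiintegrable:
  fixes G :: "(real \<Rightarrow> 'e::banach) set"
  assumes p: "1 \<le> p" and G: "Lp_totally_bounded p a b G" and \<epsilon>: "0 < \<epsilon>"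
  obtains r where "0 < r"
    "\<And>g A. g \<in> G \<Longrightarrow> A \<in> sets (lebesgue_on {a<..<b}) \<Longrightarrow> measure (lebesgue_on {a<..<b}) A \<le> r \<Longrightarrow>
       (\<integral>\<theta>. indicator A \<theta> * norm (g \<theta>) powr p \<partial>lebesgue_on {a<..<b}) < \<epsilon>"
proof -
  let ?M = "lebesgue_on {a<..<b}"
  \<comment> \<open>The final bound is 2 powr p times (\<eta> + \<eta>), which equals
    \<epsilon>.\<close>
  define \<eta> where "\<eta> = \<epsilon> / (2 * 2 powr p)"
  have \<eta>: "0 < \<eta>" using \<epsilon> by (simp add: \<eta>_def)
  then have "0 < \<eta> powr (1 / p)" by simp
  from Lp_totally_boundedD[OF G this] obtain H where H: "finite H" "H \<subseteq> Lp p a b"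
    "\<forall>g\<in>G. \<exists>h\<in>H. Lp_norm p a b (\<lambda>\<theta>. g \<theta> - h \<theta>) < \<eta> powr (1 / p)"
    by (elim exE conjE) (rule that)
  have "\<forall>h\<in>H. \<exists>r>0. \<forall>A\<in>sets ?M. measure ?M A \<le> r \<longrightarrow> (\<integral>\<theta>. indicator A \<theta> * norm (h \<theta>) powr p \<partial>?M) < \<eta>"
  proof
    fix h assume "h \<in> H"
    then have "integrable ?M (\<lambda>\<theta>. norm (h \<theta>) powr p)" using H(2) by (auto simp: Lp_def)
    then show "\<exists>r>0. \<forall>A\<in>sets ?M. measure ?M A \<le> r \<longrightarrow> (\<integral>\<theta>. indicator A \<theta> * norm (h \<theta>) powr p \<partial>?M) < \<eta>"
      by (rule integrable_abs_continuous[OF _ powr_ge_zero finite_measure_lebesgue_on_Ioo \<eta>]) blast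
  qed
  then obtain r where r: "\<And>h. h \<in> H \<Longrightarrow> 0 < r h" "\<And>h A. h \<in> H \<Longrightarrow> A \<in> sets ?M \<Longrightarrow> measure ?M A \<le> r h \<Longrightarrow>
      (\<integral>\<theta>. indicator A \<theta> * norm (h \<theta>) powr p \<partial>?M) < \<eta>"
    by metis
  show thesis
  proof
    \<comment> \<open>The inserted 1 keeps the minimum meaningful when H is empty.\<close>
    show "0 < Min (insert 1 (r ` H))" using H(1) r(1) by auto
    fix g A assume g: "g \<in> G" and A: "A \<in> sets ?M" "measure ?M A \<le> Min (insert 1 (r ` H))"
    obtain h where h: "h \<in> H" "Lp_norm p a b (\<lambda>\<theta>. g \<theta> - h \<theta>) < \<eta> powr (1 / p)"
      using H(3) g by blast
    have gL: "g \<in> Lp p a b" and hL: "h \<in> Lp p a b"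
      using G g h H(2) by (auto simp: Lp_totally_bounded_def)
    have d: "(\<integral>\<theta>. norm (g \<theta> - h \<theta>) powr p \<partial>?M) < \<eta>"
      using h(2) \<eta> p by (simp add: Lp_norm_less_iff powr_powr)
    have rh: "measure ?M A \<le> r h" using A(2) h(1) H(1) by simp
    have i1: "integrable ?M (\<lambda>\<theta>. norm (g \<theta> - h \<theta>) powr p)"
      using Lp_diff[OF p gL hL] by (simp add: Lp_def)
    have i2: "integrable ?M (\<lambda>\<theta>. indicator A \<theta> * norm (v \<theta>) powr p)" if "v \<in> Lp p a b" for v :: "real \<Rightarrow> 'e"
      using integrable_real_mult_indicator[OF A(1), of "\<lambda>\<theta>. norm (v \<theta>) powr p"] that
      by (simp add: mult.commute Lp_def)
    have "(\<integral>\<theta>. indicator A \<theta> * norm (g \<theta>) powr p \<partial>?M)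
        \<le> (\<integral>\<theta>. 2 powr p * (norm (g \<theta> - h \<theta>) powr p + indicator A \<theta> * norm (h \<theta>) powr p) \<partial>?M)"
    proof (rule integral_mono)
      show "indicator A \<theta> * norm (g \<theta>) powr p
          \<le> 2 powr p * (norm (g \<theta> - h \<theta>) powr p + indicator A \<theta> * norm (h \<theta>) powr p)" for \<theta>
        using powr_norm_le_diff[OF p, of "g \<theta>" "h \<theta>"] by (auto simp: indicator_def)
    qed (use i1 i2[OF gL] i2[OF hL] in auto)
    also have "\<dots> = 2 powr p * ((\<integral>\<theta>. norm (g \<theta> - h \<theta>) powr p \<partial>?M) + (\<integral>\<theta>. indicator A \<theta> * norm (h \<theta>) powr p \<partial>?M))"
      using i1 i2[OF hL] by simp
    also have "\<dots> < 2 powr p * (\<eta> + \<eta>)"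
      using d r(2)[OF h(1) A(1) rh] by (intro mult_strict_left_mono add_strict_mono) auto
    also have "\<dots> = \<epsilon>" by (simp add: \<eta>_def)
    finally show "(\<integral>\<theta>. indicator A \<theta> * norm (g \<theta>) powr p \<partial>?M) < \<epsilon>" .
  qed
qed

lemma Lp_Markov:
  assumes p: "1 \<le> p" and u: "u \<in> Lp p a b" and c: "0 < c"
  shows "{\<theta>\<in>{a<..<b}. c \<le> norm (u \<theta>)} \<in> sets (lebesgue_on {a<..<b})"
    and "measure (lebesgue_on {a<..<b}) {\<theta>\<in>{a<..<b}. c \<le> norm (u \<theta>)} \<le> (Lp_norm p a b u / c) powr p"
proof -
  let ?M = "lebesgue_on {a<..<b}"
  have m: "(\<lambda>\<theta>. norm (u \<theta>)) \<in> borel_measurable ?M"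
    using u by (intro strongly_measurable_norm) (auto simp: Lp_def)
  have "{\<theta>\<in>space ?M. c \<le> norm (u \<theta>)} \<in> sets ?M"
    using m by measurable
  then show "{\<theta>\<in>{a<..<b}. c \<le> norm (u \<theta>)} \<in> sets ?M" by simp
  have iff: "c \<le> x \<longleftrightarrow> c powr p \<le> x powr p" if "0 \<le> x" for x
    using p c that powr_mono2[of p c x] powr_less_mono2[of p x c] by force
  have "{\<theta>\<in>{a<..<b}. c \<le> norm (u \<theta>)} = {\<theta>\<in>space ?M. c powr p \<le> norm (u \<theta>) powr p}"
    using iff by auto
  also have "measure ?M \<dots> \<le> (\<integral>\<theta>. norm (u \<theta>) powr p \<partial>?M) / c powr p"
    by (rule integral_Markov_inequality_measure[where A = "{}"]) (use u c in \<open>auto simp: Lp_def\<close>)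
  also have "\<dots> = (Lp_norm p a b u / c) powr p"
    using p c by (simp add: powr_divide Lp_norm_nonneg Lp_norm_powr)
  finally show "measure ?M {\<theta>\<in>{a<..<b}. c \<le> norm (u \<theta>)} \<le> (Lp_norm p a b u / c) powr p" .
qed

text \<open>Each g is near a centre h off a small set by Markov's inequality, and h is near a simple
  function off another small set; F collects the values of these finitely many simple
  functions.\<close>

lemma Lp_totally_bounded_near_finite:
  fixes G :: "(real \<Rightarrow> 'e::banach) set"
  assumes p: "1 \<le> p" and G: "Lp_totally_bounded p a b G" and c: "0 < c" and r: "0 < r"
  obtains F where "finite F" "F \<noteq> {}"
    "\<And>g. g \<in> G \<Longrightarrow> \<exists>A\<in>sets (lebesgue_on {a<..<b}). measure (lebesgue_on {a<..<b}) A \<le> r \<and>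
       (\<forall>\<theta>\<in>{a<..<b} - A. \<exists>y\<in>F. dist y (g \<theta>) < c)"
proof -
  let ?M = "lebesgue_on {a<..<b}"
  interpret finite_measure ?M by simp
  \<comment> \<open>Then (\<eta> / (c / 2)) powr p = r / 2, which is the Markov bound for the set
    where g and h are c / 2 apart.\<close>
  define \<eta> where "\<eta> = c / 2 * (r / 2) powr (1 / p)"
  have \<eta>: "0 < \<eta>" using c r by (simp add: \<eta>_def)
  from Lp_totally_boundedD[OF G this] obtain H where H: "finite H" "H \<subseteq> Lp p a b"
    "\<forall>g\<in>G. \<exists>h\<in>H. Lp_norm p a b (\<lambda>\<theta>. g \<theta> - h \<theta>) < \<eta>"
    by (elim exE conjE) (rule that)
  \<comment> \<open>Since c' \<le> 1, a truncated distance below c' equals the true distance, which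
    is then below c / 2.\<close>
  define c' where "c' = min 1 (c / 2)"
  have c': "0 < c'" "c' \<le> c / 2" "c' \<le> 1" using c by (auto simp: c'_def)
  have "\<forall>h\<in>H. \<exists>s. simple_function ?M s \<and> (\<lambda>\<theta>. min 1 (norm (h \<theta> - s \<theta>))) \<in> borel_measurable ?M \<and>
      (\<integral>\<theta>. min 1 (norm (h \<theta> - s \<theta>)) \<partial>?M) < c' * (r / 2)"
  proof
    fix h assume "h \<in> H"
    then have "strongly_measurable ?M h" using H(2) by (auto simp: Lp_def)
    then show "\<exists>s. simple_function ?M s \<and> (\<lambda>\<theta>. min 1 (norm (h \<theta> - s \<theta>))) \<in> borel_measurable ?M \<and>
      (\<integral>\<theta>. min 1 (norm (h \<theta> - s \<theta>)) \<partial>?M) < c' * (r / 2)"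
      by (rule strongly_measurable_approx[rotated 2, of _ _ "c' * (r / 2)"]) (use c' r in auto)
  qed
  then obtain s where s: "\<forall>h\<in>H. simple_function ?M (s h) \<and>
      (\<lambda>\<theta>. min 1 (norm (h \<theta> - s h \<theta>))) \<in> borel_measurable ?M \<and>
      (\<integral>\<theta>. min 1 (norm (h \<theta> - s h \<theta>)) \<partial>?M) < c' * (r / 2)"
    by (rule bchoice[THEN exE])
  show thesis
  proof
    show "finite (insert 0 (\<Union>h\<in>H. s h ` {a<..<b}))"
      using H(1) s by (auto simp: simple_function_def)
    fix g assume g: "g \<in> G"
    then obtain h where h: "h \<in> H" "Lp_norm p a b (\<lambda>\<theta>. g \<theta> - h \<theta>) < \<eta>"
      using H(3) by blast
    have gh: "(\<lambda>\<theta>. g \<theta> - h \<theta>) \<in> Lp p a b"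
      using G g h H(2) by (intro Lp_diff[OF p]) (auto simp: Lp_totally_bounded_def)
    let ?A = "{\<theta>\<in>{a<..<b}. c / 2 \<le> norm (g \<theta> - h \<theta>)}"
    let ?B = "{\<theta>\<in>space ?M. c' \<le> min 1 (norm (h \<theta> - s h \<theta>))}"
    have A: "?A \<in> sets ?M" "measure ?M ?A \<le> (Lp_norm p a b (\<lambda>\<theta>. g \<theta> - h \<theta>) / (c / 2)) powr p"
      by (rule Lp_Markov[OF p gh], use c in simp)+
    note A(2)
    also have "\<dots> \<le> ((r / 2) powr (1 / p)) powr p"
      using h(2) c p by (intro powr_mono2) (auto simp: \<eta>_def Lp_norm_nonneg field_simps)
    also have "\<dots> = r / 2" using p r by (simp add: powr_powr)
    finally have A': "measure ?M ?A \<le> r / 2" .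
    have "(\<lambda>\<theta>. min 1 (norm (h \<theta> - s h \<theta>))) \<in> borel_measurable ?M" using s h(1) by blast
    then have B: "?B \<in> sets ?M"
      by (rule borel_measurable_le[rotated]) simp
    have "measure ?M ?B \<le> (\<integral>\<theta>. min 1 (norm (h \<theta> - s h \<theta>)) \<partial>?M) / c'"
      using s h(1) c'(1)
      by (intro integral_Markov_inequality_measure[where A = "{}"] integrable_const_bound[where B = 1]) auto
    also have "\<dots> \<le> r / 2"
      using s h(1) c'(1) by (auto simp: field_simps intro: less_imp_le)
    finally have B': "measure ?M ?B \<le> r / 2" .
    show "\<exists>A\<in>sets ?M. measure ?M A \<le> r \<and>
       (\<forall>\<theta>\<in>{a<..<b} - A. \<exists>y\<in>insert 0 (\<Union>h\<in>H. s h ` {a<..<b}). dist y (g \<theta>) < c)"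
    proof (intro bexI[of _ "?A \<union> ?B"] conjI ballI)
      show "measure ?M (?A \<union> ?B) \<le> r"
        using measure_Un_le[OF A(1) B] A' B' by linarith
      fix \<theta> assume \<theta>: "\<theta> \<in> {a<..<b} - (?A \<union> ?B)"
      then have "norm (g \<theta> - h \<theta>) < c / 2" "norm (h \<theta> - s h \<theta>) < c / 2"
        using c' by (auto simp: min_def split: if_splits)
      then have "dist (s h \<theta>) (g \<theta>) < c"
        using norm_triangle_ineq[of "g \<theta> - h \<theta>" "h \<theta> - s h \<theta>"] by (simp add: dist_norm norm_minus_commute)
      with \<theta> h(1) show "\<exists>y\<in>insert 0 (\<Union>h\<in>H. s h ` {a<..<b}). dist y (g \<theta>) < c"
        by blast
    qed (use A B in auto)
  qed simp
qed

text \<open>For every k, off a small set, g stays within 1/(k+1) of a finite set. Intersecting the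
  corresponding finite unions of closed balls gives a closed, totally bounded and hence compact
  set.\<close>

lemma Lp_totally_bounded_tight:
  fixes G :: "(real \<Rightarrow> 'e::banach) set"
  assumes p: "1 \<le> p" and G: "Lp_totally_bounded p a b G" and r: "0 < r"
  obtains K where "compact K"
    "\<And>g. g \<in> G \<Longrightarrow> \<exists>A\<in>sets (lebesgue_on {a<..<b}). measure (lebesgue_on {a<..<b}) A \<le> r \<and>
       (\<forall>\<theta>\<in>{a<..<b} - A. g \<theta> \<in> K)"
proof -
  let ?M = "lebesgue_on {a<..<b}"
  interpret finite_measure ?M by simp
  \<comment> \<open>The measures allowed to the exceptional sets, r / 2 times (1/2)^k, add up to
    r.\<close>
  have "\<exists>F. finite F \<and> (\<forall>g\<in>G. \<exists>A\<in>sets ?M. measure ?M A \<le> r / 2 * (1/2) ^ k \<and>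
       (\<forall>\<theta>\<in>{a<..<b} - A. \<exists>y\<in>F. dist y (g \<theta>) < inverse (real (Suc k))))" for k
    by (rule Lp_totally_bounded_near_finite[OF p G, of "inverse (real (Suc k))" "r / 2 * (1/2) ^ k"])
       (use r in auto)
  then have "\<exists>F. \<forall>k. finite (F k) \<and> (\<forall>g\<in>G. \<exists>A\<in>sets ?M. measure ?M A \<le> r / 2 * (1/2) ^ k \<and>
       (\<forall>\<theta>\<in>{a<..<b} - A. \<exists>y\<in>F k. dist y (g \<theta>) < inverse (real (Suc k))))"
    by (intro choice allI)
  then obtain F where F: "\<And>k. finite (F k)" and FG: "\<And>k g. g \<in> G \<Longrightarrow>
      \<exists>A\<in>sets ?M. measure ?M A \<le> r / 2 * (1/2) ^ k \<and>
       (\<forall>\<theta>\<in>{a<..<b} - A. \<exists>y\<in>F k. dist y (g \<theta>) < inverse (real (Suc k)))"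
    by blast
  define K where "K = (\<Inter>k. \<Union>y\<in>F k. cball y (inverse (real (Suc k))))"
  show thesis
  proof
    show "compact K"
      unfolding compact_eq_totally_bounded
    proof (intro conjI allI impI)
      have "closed K"
        unfolding K_def using F by (intro closed_INT ballI closed_UN) auto
      then show "complete K" by (simp add: complete_eq_closed)
      fix e :: real assume "0 < e"
      then obtain k where k: "inverse (real (Suc k)) < e"
        using reals_Archimedean by blast
      show "\<exists>T. finite T \<and> K \<subseteq> (\<Union>x\<in>T. ball x e)"
        using k F[of k] by (intro exI[of _ "F k"]) (force simp: K_def)
    qed
    fix g assume "g \<in> G"
    then have "\<exists>A. \<forall>k. A k \<in> sets ?M \<and> measure ?M (A k) \<le> r / 2 * (1/2) ^ k \<and>
       (\<forall>\<theta>\<in>{a<..<b} - A k. \<exists>y\<in>F k. dist y (g \<theta>) < inverse (real (Suc k)))"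
      using FG by (intro choice allI) blast
    then obtain A where A: "\<And>k. A k \<in> sets ?M" "\<And>k. measure ?M (A k) \<le> r / 2 * (1/2) ^ k"
       "\<And>k \<theta>. \<theta> \<in> {a<..<b} - A k \<Longrightarrow> \<exists>y\<in>F k. dist y (g \<theta>) < inverse (real (Suc k))"
      by blast
    have sm: "summable (\<lambda>k. r / 2 * (1/2::real) ^ k)"
      by (intro summable_mult summable_geometric) simp
    have sA: "summable (\<lambda>k. measure ?M (A k))"
      by (rule summable_comparison_test'[OF sm, of 0]) (use A(2) in auto)
    show "\<exists>A\<in>sets ?M. measure ?M A \<le> r \<and> (\<forall>\<theta>\<in>{a<..<b} - A. g \<theta> \<in> K)"
    proof (intro bexI[of _ "\<Union>k. A k"] conjI ballI)
      have "measure ?M (\<Union>k. A k) \<le> (\<Sum>k. measure ?M (A k))"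
        using A(1) sA by (intro finite_measure_subadditive_countably) auto
      also have "\<dots> \<le> (\<Sum>k. r / 2 * (1/2) ^ k)"
        by (rule suminf_le[OF A(2) sA sm])
      also have "\<dots> = r"
        by (subst suminf_mult) (simp_all add: suminf_geometric summable_geometric)
      finally show "measure ?M (\<Union>k. A k) \<le> r" .
      fix \<theta> assume \<theta>: "\<theta> \<in> {a<..<b} - (\<Union>k. A k)"
      show "g \<theta> \<in> K"
        unfolding K_def using A(3)[of \<theta>] \<theta> by (force intro: less_imp_le)
    qed (use A(1) in auto)
  qed
qed

section \<open>Superposition operators on totally bounded sets of windows\<close>

lemma AE_lebesgue_on_Ioo:
  fixes a b :: real
  assumes "AE x in lebesgue. P x"
  shows "AE x in lebesgue_on {a<..<b}. P x"
  using assms by (simp add: AE_restrict_space_iff eventually_mono)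

lemma AE_lebesgue_shift:
  fixes t :: real
  assumes "AE x in lebesgue. P x"
  shows "AE x in lebesgue_on {a<..<b}. P (t + x)"
  by (rule AE_translation[OF AE_lebesgue_on_Ioo[OF assms]])

text \<open>The exponent p / q becomes p after taking q-th powers, so p-integrability of the
  argument gives q-integrability of the value.\<close>

lemma growth_powr:
  assumes p: "1 \<le> p" and q: "1 \<le> q" and a: "0 < a" and le: "norm y \<le> a * norm x powr (p / q) + c"
  shows "norm y powr q \<le> 2 powr q * (a powr q * norm x powr p + norm (c::real) powr q)"
proof -
  have "norm y powr q \<le> (a * norm x powr (p / q) + \<bar>c\<bar>) powr q"
    using le q by (intro powr_mono2) auto
  also have "\<dots> \<le> 2 powr q * ((a * norm x powr (p / q)) powr q + \<bar>c\<bar> powr q)"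
    using a q by (intro powr_add_le) auto
  also have "(a * norm x powr (p / q)) powr q = a powr q * norm x powr p"
    using a q by (simp add: powr_mult powr_powr)
  finally show ?thesis by simp
qed

text \<open>Windows have measure at most 1, so the real-valued supremum in (H3) is genuine and
  bounds every single window.\<close>

lemma measure_window_le_SUP:
  fixes N :: "real set"
  assumes "N \<in> sets lebesgue"
  shows "measure lebesgue ({t<..<t + 1} \<inter> N) \<le> (SUP t. measure lebesgue ({t<..<t + 1} \<inter> N))"
proof (rule cSUP_upper)
  show "bdd_above (range (\<lambda>t. measure lebesgue ({t<..<t + 1} \<inter> N)))"
  proof (rule bdd_aboveI2)
    fix t :: real
    have "measure lebesgue ({t<..<t + 1} \<inter> N) \<le> measure lebesgue {t<..<t + 1}"
      using assms by (intro measure_mono_fmeasurable) auto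
    then show "measure lebesgue ({t<..<t + 1} \<inter> N) \<le> 1" by simp
  qed
qed simp

text \<open>Common ground of the almost automorphic and the almost periodic part. The function c is
  the b of (H1), of which the estimates use only local integrability and total boundedness of its
  windows.\<close>

locale Nemytskii_operator =
  fixes f :: "real \<Rightarrow> 'x::banach \<Rightarrow> 'y::banach" and p q a :: real and c :: "real \<Rightarrow> real"
  assumes p: "1 \<le> p" and q: "1 \<le> q" and a: "0 < a"
    and c_loc: "c \<in> Lp_loc q"
    and c_tb: "Lp_totally_bounded q 0 1 (range (\<lambda>t \<theta>. c (t + \<theta>)))"
    and growth: "AE t in lebesgue. \<forall>x. norm (f t x) \<le> a * norm x powr (p / q) + c t"
    and continuous: "AE t in lebesgue. continuous_on UNIV (f t)"
    and equicontinuous: "\<forall>K r. compact K \<and> r > 0 \<longrightarrow>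
               (\<exists>N\<in>sets lebesgue.
                  (SUP t. measure lebesgue ({t<..<t + 1} \<inter> N)) < r \<and>
                  (\<forall>\<epsilon>>0. \<exists>\<delta>>0. \<forall>x1\<in>K. \<forall>x2\<in>K. \<forall>t\<in>-N.
                      norm (x1 - x2) \<le> \<delta> \<longrightarrow> norm (f t x1 - f t x2) \<le> \<epsilon>))"
    and f_loc: "\<And>x. (\<lambda>t. f t x) \<in> Lp_loc q"
begin

lemma Nemytskii_Lp_loc:
  assumes w: "w \<in> Lp_loc p"
  shows "Nemytskii f w \<in> Lp_loc q"
  unfolding Lp_loc_def
proof (intro CollectI allI impI)
  fix l r :: real assume "l < r"
  let ?M = "lebesgue_on {l<..<r}"
  have w': "w \<in> Lp p l r" and c': "c \<in> Lp q l r" and f': "\<And>x. (\<lambda>t. f t x) \<in> Lp q l r"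
    using w c_loc f_loc \<open>l < r\<close> by (auto simp: Lp_loc_def)
  have sm: "strongly_measurable ?M (Nemytskii f w)"
    unfolding Nemytskii_def[abs_def]
    by (rule strongly_measurable_superposition)
       (use w' f' AE_lebesgue_on_Ioo[OF continuous] in \<open>auto simp: Lp_def\<close>)
  show "Nemytskii f w \<in> Lp q l r"
  proof (rule LpI_dominated[OF sm])
    show "integrable ?M (\<lambda>t. 2 powr q * (a powr q * norm (w t) powr p + norm (c t) powr q))"
      using w' c' by (simp add: Lp_def)
    show "AE t in ?M. norm (Nemytskii f w t) powr q \<le> 2 powr q * (a powr q * norm (w t) powr p + norm (c t) powr q)"
      using AE_lebesgue_on_Ioo[OF growth]
      by eventually_elim (unfold Nemytskii_def, rule growth_powr[OF p q a], blast)
  qed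
qed

text \<open>The growth condition dominates the windows of \<open>Nemytskii f w\<close> by those of w
  and c, both equiintegrable. A whole family W is treated because continuity compares different
  functions.\<close>

lemma Nemytskii_equiintegrable:
  assumes W: "Lp_totally_bounded p 0 1 (\<Union>w\<in>W. range (\<lambda>t \<theta>. w (t + \<theta>)))" "W \<subseteq> Lp_loc p"
    and \<epsilon>: "0 < \<epsilon>"
  obtains r where "0 < r"
    "\<And>w t A. w \<in> W \<Longrightarrow> A \<in> sets (lebesgue_on {0<..<1}) \<Longrightarrow> measure (lebesgue_on {0<..<1}) A \<le> r \<Longrightarrow>
       (\<integral>\<theta>. indicator A \<theta> * norm (Nemytskii f w (t + \<theta>)) powr q \<partial>lebesgue_on {0<..<1}) < \<epsilon>"
proof -
  let ?M = "lebesgue_on {0<..<1::real}"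
  \<comment> \<open>Solves 2 powr q times (a powr q times \<kappa> + \<kappa>) = \<epsilon>, where
    \<kappa> bounds the contributions of w and of c.\<close>
  define \<kappa> where "\<kappa> = \<epsilon> / (2 powr q * (a powr q + 1))"
  have \<kappa>: "0 < \<kappa>" using \<epsilon> a by (simp add: \<kappa>_def add_pos_pos)
  obtain r1 where r1: "0 < r1" "\<And>g A. g \<in> (\<Union>w\<in>W. range (\<lambda>t \<theta>. w (t + \<theta>))) \<Longrightarrow> A \<in> sets ?M \<Longrightarrow>
      measure ?M A \<le> r1 \<Longrightarrow> (\<integral>\<theta>. indicator A \<theta> * norm (g \<theta>) powr p \<partial>?M) < \<kappa>"
    by (rule Lp_totally_bounded_equiintegrable[OF p W(1) \<kappa>]) (rule that)
  obtain r2 where r2: "0 < r2" "\<And>g A. g \<in> range (\<lambda>t \<theta>. c (t + \<theta>)) \<Longrightarrow> A \<in> sets ?M \<Longrightarrow>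
      measure ?M A \<le> r2 \<Longrightarrow> (\<integral>\<theta>. indicator A \<theta> * norm (g \<theta>) powr q \<partial>?M) < \<kappa>"
    by (rule Lp_totally_bounded_equiintegrable[OF q c_tb \<kappa>]) (rule that)
  show thesis
  proof
    show "0 < min r1 r2" using r1(1) r2(1) by simp
    fix w t A assume w: "w \<in> W" and A: "A \<in> sets ?M" "measure ?M A \<le> min r1 r2"
    let ?w = "\<lambda>\<theta>. w (t + \<theta>)" and ?c = "\<lambda>\<theta>. c (t + \<theta>)"
    have wL: "?w \<in> Lp p 0 1" and cL: "?c \<in> Lp q 0 1"
      using W(1) c_tb w unfolding Lp_totally_bounded_def by blast+
    have NL: "(\<lambda>\<theta>. Nemytskii f w (t + \<theta>)) \<in> Lp q 0 1"
      using w W(2) by (intro Lp_loc_shift Nemytskii_Lp_loc) auto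
    have i: "integrable ?M (\<lambda>\<theta>. indicator A \<theta> * h \<theta> :: real)" if "integrable ?M h" for h
      using integrable_real_mult_indicator[OF A(1) that] by (simp add: mult.commute)
    have iw: "integrable ?M (\<lambda>\<theta>. indicator A \<theta> * norm (?w \<theta>) powr p)"
      and ic: "integrable ?M (\<lambda>\<theta>. indicator A \<theta> * norm (?c \<theta>) powr q)"
      and iN: "integrable ?M (\<lambda>\<theta>. indicator A \<theta> * norm (Nemytskii f w (t + \<theta>)) powr q)"
      by (rule i, use wL cL NL in \<open>simp add: Lp_def\<close>)+
    have "(\<integral>\<theta>. indicator A \<theta> * norm (Nemytskii f w (t + \<theta>)) powr q \<partial>?M) \<le>
       (\<integral>\<theta>. 2 powr q * (a powr q * (indicator A \<theta> * norm (?w \<theta>) powr p) + indicator A \<theta> * norm (?c \<theta>) powr q) \<partial>?M)"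
    proof (rule integral_mono_AE)
      show "AE \<theta> in ?M. indicator A \<theta> * norm (Nemytskii f w (t + \<theta>)) powr q \<le>
         2 powr q * (a powr q * (indicator A \<theta> * norm (?w \<theta>) powr p) + indicator A \<theta> * norm (?c \<theta>) powr q)"
        using AE_lebesgue_shift[OF growth, where t = t]
      proof eventually_elim
        case (elim \<theta>)
        have "norm (Nemytskii f w (t + \<theta>)) powr q \<le> 2 powr q * (a powr q * norm (?w \<theta>) powr p + norm (?c \<theta>) powr q)"
          using elim by (intro growth_powr[OF p q a]) (simp add: Nemytskii_def)
        then show ?case by (simp add: indicator_def)
      qed
    qed (use iw ic iN in auto)
    also have "\<dots> = 2 powr q * (a powr q * (\<integral>\<theta>. indicator A \<theta> * norm (?w \<theta>) powr p \<partial>?M)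
        + (\<integral>\<theta>. indicator A \<theta> * norm (?c \<theta>) powr q \<partial>?M))"
      using iw ic by simp
    also have "\<dots> < 2 powr q * (a powr q * \<kappa> + \<kappa>)"
      using r1(2)[of ?w A] r2(2)[of ?c A] A w a
      by (intro mult_strict_left_mono add_strict_mono) auto
    also have "\<dots> = (2 powr q * (a powr q + 1)) * \<kappa>"
      by (simp add: algebra_simps)
    also have "\<dots> = \<epsilon>"
      using a by (simp add: \<kappa>_def add_pos_pos less_imp_neq[symmetric])
    finally show "(\<integral>\<theta>. indicator A \<theta> * norm (Nemytskii f w (t + \<theta>)) powr q \<partial>?M) < \<epsilon>" .
  qed
qed

text \<open>The central estimate, with two functions and two times so that it serves twice: w = w'
  gives control of the pseudometric of \<open>Nemytskii f w\<close>, while s = t makes the condition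
  on F trivial and gives continuity of the operator.\<close>

lemma Nemytskii_modulus:
  assumes W: "Lp_totally_bounded p 0 1 (\<Union>w\<in>W. range (\<lambda>t \<theta>. w (t + \<theta>)))" "W \<subseteq> Lp_loc p"
    and \<epsilon>: "0 < \<epsilon>"
  obtains F \<eta> where "finite F" "0 < \<eta>"
    "\<forall>w\<in>W. \<forall>w'\<in>W. \<forall>s t. Lp_norm p 0 1 (\<lambda>\<theta>. w (t + \<theta>) - w' (s + \<theta>)) < \<eta> \<longrightarrow>
       (\<forall>x\<in>F. Lp_norm q 0 1 (\<lambda>\<theta>. f (t + \<theta>) x - f (s + \<theta>) x) < \<eta>) \<longrightarrow>
       Lp_norm q 0 1 (\<lambda>\<theta>. Nemytskii f w (t + \<theta>) - Nemytskii f w' (s + \<theta>)) < \<epsilon>"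
proof -
  let ?M = "lebesgue_on {0<..<1::real}"
  interpret finite_measure ?M by simp
  \<comment> \<open>Four contributions of size \<kappa>, times 2 powr q, make \<epsilon> powr q /
    2.\<close>
  define \<kappa> where "\<kappa> = \<epsilon> powr q / (2 powr q * 8)"
  have \<kappa>: "0 < \<kappa>" using \<epsilon> by (simp add: \<kappa>_def)
  obtain r where r: "0 < r" "\<And>w t A. w \<in> W \<Longrightarrow> A \<in> sets ?M \<Longrightarrow> measure ?M A \<le> r \<Longrightarrow>
       (\<integral>\<theta>. indicator A \<theta> * norm (Nemytskii f w (t + \<theta>)) powr q \<partial>?M) < \<kappa>"
    by (rule Nemytskii_equiintegrable[OF W \<kappa>]) (rule that)
  \<comment> \<open>Five exceptional sets occur: w outside K, w' outside K, t + \<theta> in N, s +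
    \<theta> in N, and w far from w'.\<close>
  have r5: "0 < r / 5" using r(1) by simp
  obtain K where K: "compact K" "\<And>g. g \<in> (\<Union>w\<in>W. range (\<lambda>t \<theta>. w (t + \<theta>))) \<Longrightarrow>
      \<exists>A\<in>sets ?M. measure ?M A \<le> r / 5 \<and> (\<forall>\<theta>\<in>{0<..<1} - A. g \<theta> \<in> K)"
    by (rule Lp_totally_bounded_tight[OF p W(1) r5]) (rule that)
  obtain N where N: "N \<in> sets lebesgue" "(SUP t. measure lebesgue ({t<..<t + 1} \<inter> N)) < r / 5"
    and N_equi: "\<forall>\<epsilon>>0. \<exists>\<delta>>0. \<forall>x1\<in>K. \<forall>x2\<in>K. \<forall>t\<in>-N.
                      norm (x1 - x2) \<le> \<delta> \<longrightarrow> norm (f t x1 - f t x2) \<le> \<epsilon>"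
    using equicontinuous[rule_format, of K "r / 5"] K(1) r5 by auto
  \<comment> \<open>Equicontinuity is applied three times at each point, and (3 \<epsilon>') powr q
    = \<kappa>.\<close>
  define \<epsilon>' where "\<epsilon>' = \<kappa> powr (1 / q) / 3"
  have \<epsilon>': "0 < \<epsilon>'" using \<kappa> by (simp add: \<epsilon>'_def)
  obtain \<delta> where \<delta>: "0 < \<delta>" "\<And>x1 x2 t. x1 \<in> K \<Longrightarrow> x2 \<in> K \<Longrightarrow> t \<notin> N \<Longrightarrow> norm (x1 - x2) \<le> \<delta> \<Longrightarrow>
      norm (f t x1 - f t x2) \<le> \<epsilon>'"
    using N_equi[rule_format, OF \<epsilon>'] by auto
  obtain F where F: "F \<subseteq> K" "finite F" "K \<subseteq> (\<Union>x\<in>F. ball x \<delta>)"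
    by (rule compactE_image[OF K(1), of K "\<lambda>x. ball x \<delta>"]) (use \<delta>(1) in force)+
  \<comment> \<open>By Markov the first term bounds the measure of the set where w and w' are at
    least \<delta> apart by r / 5; the second keeps the sum over F of the q-th powers at most
    \<kappa>.\<close>
  define \<eta> where "\<eta> = min (\<delta> * (r / 5) powr (1 / p)) ((\<kappa> / (real (card F) + 1)) powr (1 / q))"
  show thesis
  proof
    show "finite F" by fact
    show "0 < \<eta>" using \<delta>(1) r(1) \<kappa> by (simp add: \<eta>_def)
    show "\<forall>w\<in>W. \<forall>w'\<in>W. \<forall>s t. Lp_norm p 0 1 (\<lambda>\<theta>. w (t + \<theta>) - w' (s + \<theta>)) < \<eta> \<longrightarrow>
       (\<forall>x\<in>F. Lp_norm q 0 1 (\<lambda>\<theta>. f (t + \<theta>) x - f (s + \<theta>) x) < \<eta>) \<longrightarrow>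
       Lp_norm q 0 1 (\<lambda>\<theta>. Nemytskii f w (t + \<theta>) - Nemytskii f w' (s + \<theta>)) < \<epsilon>"
    proof (intro ballI allI impI)
      fix w w' s t
      assume w: "w \<in> W" "w' \<in> W" and d: "Lp_norm p 0 1 (\<lambda>\<theta>. w (t + \<theta>) - w' (s + \<theta>)) < \<eta>"
        and df: "\<forall>x\<in>F. Lp_norm q 0 1 (\<lambda>\<theta>. f (t + \<theta>) x - f (s + \<theta>) x) < \<eta>"
      have wL: "(\<lambda>\<theta>. w (t + \<theta>)) \<in> Lp p 0 1" "(\<lambda>\<theta>. w' (s + \<theta>)) \<in> Lp p 0 1"
        using W(1) w unfolding Lp_totally_bounded_def by blast+
      define g where "g = (\<lambda>\<theta>. Nemytskii f w (t + \<theta>))"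
      define g' where "g' = (\<lambda>\<theta>. Nemytskii f w' (s + \<theta>))"
      have gL: "g \<in> Lp q 0 1" "g' \<in> Lp q 0 1"
        unfolding g_def g'_def using w W(2) by (auto intro!: Lp_loc_shift Nemytskii_Lp_loc)
      obtain A1 where A1: "A1 \<in> sets ?M" "measure ?M A1 \<le> r / 5" "\<forall>\<theta>\<in>{0<..<1} - A1. w (t + \<theta>) \<in> K"
        using K(2)[of "\<lambda>\<theta>. w (t + \<theta>)"] w by auto
      obtain A2 where A2: "A2 \<in> sets ?M" "measure ?M A2 \<le> r / 5" "\<forall>\<theta>\<in>{0<..<1} - A2. w' (s + \<theta>) \<in> K"
        using K(2)[of "\<lambda>\<theta>. w' (s + \<theta>)"] w by auto
      define B where "B t = {\<theta>. 0 < \<theta> \<and> \<theta> < 1 \<and> t + \<theta> \<in> N}" for t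
      have B: "B t \<in> sets ?M" "measure ?M (B t) \<le> r / 5" for t
        unfolding B_def using measure_translation_lebesgue_on[OF N(1), of 0 1 t]
          measure_window_le_SUP[OF N(1), of t] N(2) by auto
      define D where "D = {\<theta>\<in>{0<..<1}. \<delta> \<le> norm (w (t + \<theta>) - w' (s + \<theta>))}"
      have D: "D \<in> sets ?M" "measure ?M D \<le> (Lp_norm p 0 1 (\<lambda>\<theta>. w (t + \<theta>) - w' (s + \<theta>)) / \<delta>) powr p"
        unfolding D_def by (rule Lp_Markov[OF p Lp_diff[OF p wL] \<delta>(1)])+
      note D(2)
      also have "(Lp_norm p 0 1 (\<lambda>\<theta>. w (t + \<theta>) - w' (s + \<theta>)) / \<delta>) powr p \<le> ((r / 5) powr (1 / p)) powr p"
        using d \<delta>(1) p by (intro powr_mono2) (auto simp: \<eta>_def Lp_norm_nonneg field_simps)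
      also have "\<dots> = r / 5" using p r(1) by (simp add: powr_powr)
      finally have D': "measure ?M D \<le> r / 5" .
      define A where "A = A1 \<union> (A2 \<union> (B t \<union> (B s \<union> D)))"
      have A: "A \<in> sets ?M" unfolding A_def using A1 A2 B D by (intro sets.Un) auto
      have "measure ?M A \<le> measure ?M A1 + (measure ?M A2 + (measure ?M (B t) + (measure ?M (B s) + measure ?M D)))"
        unfolding A_def
        by (intro order_trans[OF measure_Un_le] add_left_mono sets.Un A1 A2 B D order_refl)
      then have Ar: "measure ?M A \<le> r"
        using A1(2) A2(2) B(2)[of t] B(2)[of s] D' by linarith
      have iA: "integrable ?M (\<lambda>\<theta>. indicator A \<theta> * norm (h \<theta>) powr q)" if "h \<in> Lp q 0 1" for h :: "real \<Rightarrow> 'y"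
        using integrable_real_mult_indicator[OF A, of "\<lambda>\<theta>. norm (h \<theta>) powr q"] that
        by (simp add: mult.commute Lp_def)
      have fL: "(\<lambda>\<theta>. f (t + \<theta>) x - f (s + \<theta>) x) \<in> Lp q 0 1" for x
        by (intro Lp_diff q Lp_loc_shift f_loc)
      have fi: "integrable ?M (\<lambda>\<theta>. norm (f (t + \<theta>) x - f (s + \<theta>) x) powr q)" for x
        using fL by (simp add: Lp_def)
      \<comment> \<open>On A the two values are estimated separately by equiintegrability. Off A the
        net point x depends on \<theta>; summing over all of F removes this dependence and keeps the
        bound integrable.\<close>
      let ?bound = "\<lambda>\<theta>. 2 powr q * ((indicator A \<theta> * norm (g \<theta>) powr q + indicator A \<theta> * norm (g' \<theta>) powr q)
           + (\<kappa> + (\<Sum>x\<in>F. norm (f (t + \<theta>) x - f (s + \<theta>) x) powr q)))"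
      have "(\<integral>\<theta>. norm (g \<theta> - g' \<theta>) powr q \<partial>?M) \<le> (\<integral>\<theta>. ?bound \<theta> \<partial>?M)"
      proof (rule integral_mono)
        show "integrable ?M (\<lambda>\<theta>. norm (g \<theta> - g' \<theta>) powr q)"
          using Lp_diff[OF q gL] by (simp add: Lp_def)
        show "integrable ?M ?bound"
          using iA[OF gL(1)] iA[OF gL(2)] fi
          by (intro integrable_mult_right Bochner_Integration.integrable_add Bochner_Integration.integrable_sum) auto
        fix \<theta> assume "\<theta> \<in> space ?M"
        then have \<theta>: "\<theta> \<in> {0<..<1}" by simp
        have sum_nn: "0 \<le> (\<Sum>x\<in>F. norm (f (t + \<theta>) x - f (s + \<theta>) x) powr q)"
          by (intro sum_nonneg) simp
        show "norm (g \<theta> - g' \<theta>) powr q \<le> ?bound \<theta>"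
        proof (cases "\<theta> \<in> A")
          case True
          have "norm (g \<theta> - g' \<theta>) powr q \<le> (norm (g \<theta>) + norm (g' \<theta>)) powr q"
            using q by (intro powr_mono2 norm_triangle_ineq4) auto
          also have "\<dots> \<le> 2 powr q * (norm (g \<theta>) powr q + norm (g' \<theta>) powr q)"
            using q by (intro powr_add_le) auto
          also have "\<dots> \<le> ?bound \<theta>"
            using True sum_nn \<kappa> by (intro mult_left_mono) auto
          finally show ?thesis .
        next
          case False
          have wK: "w (t + \<theta>) \<in> K" "w' (s + \<theta>) \<in> K" and tN: "t + \<theta> \<notin> N" "s + \<theta> \<notin> N"
            and near: "norm (w (t + \<theta>) - w' (s + \<theta>)) \<le> \<delta>"
            using False A1(3) A2(3) \<theta> by (auto simp: A_def B_def D_def)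
          obtain x where x: "x \<in> F" "norm (x - w (t + \<theta>)) \<le> \<delta>"
            using F(3) wK(1) by (force simp: dist_norm)
          have xK: "x \<in> K" using x F by auto
          let ?e = "norm (f (t + \<theta>) x - f (s + \<theta>) x)"
          have "norm (f (t + \<theta>) (w (t + \<theta>)) - f (t + \<theta>) x) \<le> \<epsilon>'"
            "norm (f (s + \<theta>) x - f (s + \<theta>) (w (t + \<theta>))) \<le> \<epsilon>'"
            "norm (f (s + \<theta>) (w (t + \<theta>)) - f (s + \<theta>) (w' (s + \<theta>))) \<le> \<epsilon>'"
            using \<delta>(2) wK tN near x(2) xK by (auto simp: norm_minus_commute)
          \<comment> \<open>The path first exchanges w(t + \<theta>) for x at time t + \<theta>,
            then changes time with x fixed, then returns to w(t + \<theta>) and passes to w'(s +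
            \<theta>) at time s + \<theta>. Only the change of time is not covered by equicontinuity
            on K.\<close>
          moreover have "g \<theta> - g' \<theta> = (f (t + \<theta>) (w (t + \<theta>)) - f (t + \<theta>) x) + ((f (t + \<theta>) x - f (s + \<theta>) x)
             + ((f (s + \<theta>) x - f (s + \<theta>) (w (t + \<theta>))) + (f (s + \<theta>) (w (t + \<theta>)) - f (s + \<theta>) (w' (s + \<theta>)))))"
            by (simp add: g_def g'_def Nemytskii_def)
          ultimately have "norm (g \<theta> - g' \<theta>) \<le> \<epsilon>' + (?e + (\<epsilon>' + \<epsilon>'))"
            by (simp only:) (intro norm_triangle_le add_mono norm_triangle_mono, auto)
          then have "norm (g \<theta> - g' \<theta>) powr q \<le> (3 * \<epsilon>' + ?e) powr q"
            using q by (intro powr_mono2) auto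
          also have "\<dots> \<le> 2 powr q * ((3 * \<epsilon>') powr q + ?e powr q)"
            using q \<epsilon>' by (intro powr_add_le) auto
          also have "(3 * \<epsilon>') powr q = \<kappa>"
            using q \<kappa> by (simp add: \<epsilon>'_def powr_powr)
          also have "2 powr q * (\<kappa> + ?e powr q) \<le> ?bound \<theta>"
            using False member_le_sum[OF x(1), of "\<lambda>x. norm (f (t + \<theta>) x - f (s + \<theta>) x) powr q"] F(2)
            by (intro mult_left_mono) auto
          finally show ?thesis .
        qed
      qed
      also have "(\<integral>\<theta>. ?bound \<theta> \<partial>?M) = 2 powr q * (((\<integral>\<theta>. indicator A \<theta> * norm (g \<theta>) powr q \<partial>?M)
           + (\<integral>\<theta>. indicator A \<theta> * norm (g' \<theta>) powr q \<partial>?M))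
           + (\<kappa> + (\<Sum>x\<in>F. \<integral>\<theta>. norm (f (t + \<theta>) x - f (s + \<theta>) x) powr q \<partial>?M)))"
        using iA[OF gL(1)] iA[OF gL(2)] fi
        by (simp add: Bochner_Integration.integral_add Bochner_Integration.integral_sum
              Bochner_Integration.integrable_sum measure_restrict_space)
      also have "\<dots> \<le> 2 powr q * ((\<kappa> + \<kappa>) + (\<kappa> + \<kappa>))"
      proof (intro mult_left_mono add_mono order_refl)
        show "(\<integral>\<theta>. indicator A \<theta> * norm (g \<theta>) powr q \<partial>?M) \<le> \<kappa>"
          "(\<integral>\<theta>. indicator A \<theta> * norm (g' \<theta>) powr q \<partial>?M) \<le> \<kappa>"
          unfolding g_def g'_def using r(2)[OF _ A Ar] w by (auto intro: less_imp_le)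
        have "(\<integral>\<theta>. norm (f (t + \<theta>) x - f (s + \<theta>) x) powr q \<partial>?M) \<le> \<kappa> / (real (card F) + 1)" if "x \<in> F" for x
        proof -
          have "Lp_norm q 0 1 (\<lambda>\<theta>. f (t + \<theta>) x - f (s + \<theta>) x) < (\<kappa> / (real (card F) + 1)) powr (1 / q)"
            using df that by (simp add: \<eta>_def)
          then show ?thesis
            using \<kappa> q by (subst (asm) Lp_norm_less_iff) (auto simp: powr_powr)
        qed
        then have "(\<Sum>x\<in>F. \<integral>\<theta>. norm (f (t + \<theta>) x - f (s + \<theta>) x) powr q \<partial>?M) \<le> real (card F) * (\<kappa> / (real (card F) + 1))"
          by (rule sum_bounded_above)
        also have "\<dots> \<le> \<kappa>" using \<kappa> by (simp add: field_simps)
        finally show "(\<Sum>x\<in>F. \<integral>\<theta>. norm (f (t + \<theta>) x - f (s + \<theta>) x) powr q \<partial>?M) \<le> \<kappa>" .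
      qed simp
      also have "\<dots> < \<epsilon> powr q" using \<epsilon> by (simp add: \<kappa>_def)
      finally show "Lp_norm q 0 1 (\<lambda>\<theta>. Nemytskii f w (t + \<theta>) - Nemytskii f w' (s + \<theta>)) < \<epsilon>"
        using q \<epsilon> by (simp add: Lp_norm_less_iff g_def g'_def)
    qed
  qed
qed

end

section \<open>Stepanov spaces as spaces of pseudometrics\<close>

lemma limitin_sequentially_mdist_iff:
  assumes "range f \<subseteq> mspace m"
  shows "limitin (mtopology_of m) f l sequentially \<longleftrightarrow>
     l \<in> mspace m \<and> (\<forall>\<epsilon>>0. \<exists>N. \<forall>n\<ge>N. mdist m (f n) l < \<epsilon>)"
  unfolding mtopology_of_def Metric_space.limit_metric_sequentially[OF Metric_space_mspace_mdist]
  using assms by (auto simp: image_subset_iff)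

lemma continuous_map_real_mdist_iff:
  assumes "range U \<subseteq> mspace m"
  shows "continuous_map euclideanreal (mtopology_of m) U \<longleftrightarrow> continuous_pm (\<lambda>s t. mdist m (U s) (U t))"
proof -
  have "continuous_map (mtopology_of euclidean_metric) (mtopology_of m) U \<longleftrightarrow>
     (\<forall>a :: real. \<forall>\<epsilon>>0. \<exists>\<delta>>0. \<forall>x. dist a x < \<delta> \<longrightarrow> mdist m (U a) (U x) < \<epsilon>)"
    using Metric_space.metric_continuous_map[OF Metric_space_mspace_mdist Metric_space_mspace_mdist,
        of euclidean_metric m U] assms unfolding mtopology_of_def by simp
  then show ?thesis
    by (simp add: continuous_pm_def dist_real_def abs_minus_commute mdist_commute)
qed

lemma pseudometric_mdist:
  assumes "range U \<subseteq> mspace m"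
  shows "pseudometric (\<lambda>s t. mdist m (U s) (U t))"
  unfolding pseudometric_def using assms
  by (auto simp: mdist_commute image_subset_iff intro: mdist_triangle)

lemma almost_periodic_iff:
  assumes U: "range U \<subseteq> mspace m"
  shows "almost_periodic m U \<longleftrightarrow>
     continuous_pm (\<lambda>s t. mdist m (U s) (U t)) \<and> translates_tb (\<lambda>s t. mdist m (U s) (U t))"
  unfolding almost_periodic_def continuous_map_real_mdist_iff[OF U]
  using translates_tb_if_almost_periodic[OF pseudometric_mdist[OF U]] relatively_dense_if_translates_tb
  by blast

text \<open>The limit function V is eliminated by the triangle inequality: V(t) links any two late
  translates at t, and V at t - \<sigma>(r k) links the translates of U there with U(t).\<close>

lemma automorphic_pm_if_almost_automorphic:
  assumes U: "range U \<subseteq> mspace m" and aa: "almost_automorphic m U"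
  shows "automorphic_pm (\<lambda>s t. mdist m (U s) (U t))"
  unfolding automorphic_pm_def
proof
  fix \<sigma> :: "nat \<Rightarrow> real"
  have "\<exists>r. strict_mono r \<and> (\<exists>V. range V \<subseteq> mspace m \<and>
          (\<forall>t. limitin (mtopology_of m) (\<lambda>k. U (t + \<sigma> (r k))) (V t) sequentially \<and>
               limitin (mtopology_of m) (\<lambda>k. V (t - \<sigma> (r k))) (U t) sequentially))"
    using aa by (simp add: almost_automorphic_def)
  then obtain r V where r: "strict_mono r" and V: "range V \<subseteq> mspace m"
    and lim: "\<forall>t. limitin (mtopology_of m) (\<lambda>k. U (t + \<sigma> (r k))) (V t) sequentially \<and>
      limitin (mtopology_of m) (\<lambda>k. V (t - \<sigma> (r k))) (U t) sequentially"
    by (elim exE conjE) (rule that)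
  have mem: "U t \<in> mspace m" "V t \<in> mspace m" for t
    using U V by auto
  have lim1: "\<exists>N. \<forall>n\<ge>N. mdist m (U (t + \<sigma> (r n))) (V t) < \<epsilon>" if "0 < \<epsilon>" for t \<epsilon>
    using lim that mem by (subst (asm) (1 2) limitin_sequentially_mdist_iff) auto
  have lim2: "\<exists>N. \<forall>n\<ge>N. mdist m (V (t - \<sigma> (r n))) (U t) < \<epsilon>" if "0 < \<epsilon>" for t \<epsilon>
    using lim that mem by (subst (asm) (1 2) limitin_sequentially_mdist_iff) auto
  have "returning (\<lambda>s t. mdist m (U s) (U t)) (\<sigma> \<circ> r)"
    unfolding returning_def
  proof (intro allI impI conjI)
    fix t \<epsilon> :: real assume "0 < \<epsilon>"
    then have \<epsilon>: "0 < \<epsilon> / 2" by simp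
    obtain N where N: "\<forall>n\<ge>N. mdist m (U (t + \<sigma> (r n))) (V t) < \<epsilon> / 2"
      using lim1[OF \<epsilon>] by blast
    show "\<exists>k0. \<forall>k\<ge>k0. \<forall>l\<ge>k0. mdist m (U (t + (\<sigma> \<circ> r) k)) (U (t + (\<sigma> \<circ> r) l)) < \<epsilon>"
    proof (rule exI, intro allI impI)
      fix k l assume "N \<le> k" "N \<le> l"
      then have "mdist m (U (t + \<sigma> (r k))) (V t) < \<epsilon> / 2" "mdist m (U (t + \<sigma> (r l))) (V t) < \<epsilon> / 2"
        using N by auto
      moreover have "mdist m (U (t + \<sigma> (r k))) (U (t + \<sigma> (r l)))
          \<le> mdist m (U (t + \<sigma> (r k))) (V t) + mdist m (V t) (U (t + \<sigma> (r l)))"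
        by (intro mdist_triangle mem)
      ultimately show "mdist m (U (t + (\<sigma> \<circ> r) k)) (U (t + (\<sigma> \<circ> r) l)) < \<epsilon>"
        using mdist_commute[of m "V t" "U (t + \<sigma> (r l))"] by simp
    qed
    obtain M where M: "\<forall>n\<ge>M. mdist m (V (t - \<sigma> (r n))) (U t) < \<epsilon> / 2"
      using lim2[OF \<epsilon>] by blast
    show "\<exists>k0. \<forall>k\<ge>k0. \<exists>m0. \<forall>ma\<ge>m0. mdist m (U (t - (\<sigma> \<circ> r) k + (\<sigma> \<circ> r) ma)) (U t) < \<epsilon>"
    proof (rule exI, intro allI impI)
      fix k assume k: "M \<le> k"
      obtain N' where N': "\<forall>n\<ge>N'. mdist m (U (t - \<sigma> (r k) + \<sigma> (r n))) (V (t - \<sigma> (r k))) < \<epsilon> / 2"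
        using lim1[OF \<epsilon>] by blast
      have "mdist m (U (t - \<sigma> (r k) + \<sigma> (r n))) (U t) < \<epsilon>" if "N' \<le> n" for n
      proof -
        have "mdist m (U (t - \<sigma> (r k) + \<sigma> (r n))) (V (t - \<sigma> (r k))) < \<epsilon> / 2"
          "mdist m (V (t - \<sigma> (r k))) (U t) < \<epsilon> / 2"
          using M N' k that by auto
        moreover have "mdist m (U (t - \<sigma> (r k) + \<sigma> (r n))) (U t)
          \<le> mdist m (U (t - \<sigma> (r k) + \<sigma> (r n))) (V (t - \<sigma> (r k))) + mdist m (V (t - \<sigma> (r k))) (U t)"
          by (intro mdist_triangle mem)
        ultimately show ?thesis by linarith
      qed
      then show "\<exists>m0. \<forall>ma\<ge>m0. mdist m (U (t - (\<sigma> \<circ> r) k + (\<sigma> \<circ> r) ma)) (U t) < \<epsilon>"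
        by auto
    qed
  qed
  with r show "\<exists>r. strict_mono r \<and> returning (\<lambda>s t. mdist m (U s) (U t)) (\<sigma> \<circ> r)"
    by blast
qed

text \<open>Completeness rebuilds V as the pointwise limit of the Cauchy translates. Its return to U
  follows by choosing, for each late k, one index large enough for both approximations.\<close>

lemma almost_automorphic_if_automorphic_pm:
  assumes U: "range U \<subseteq> mspace m" and c: "continuous_pm (\<lambda>s t. mdist m (U s) (U t))"
    and aa: "automorphic_pm (\<lambda>s t. mdist m (U s) (U t))"
    and complete: "\<And>\<sigma> :: nat \<Rightarrow> 'a. range \<sigma> \<subseteq> mspace m \<Longrightarrow>
      (\<And>\<epsilon>. 0 < \<epsilon> \<Longrightarrow> \<exists>N. \<forall>i\<ge>N. \<forall>j\<ge>N. mdist m (\<sigma> i) (\<sigma> j) < \<epsilon>) \<Longrightarrow>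
      \<exists>l\<in>mspace m. \<forall>\<epsilon>>0. \<exists>N. \<forall>n\<ge>N. mdist m (\<sigma> n) l < \<epsilon>"
  shows "almost_automorphic m U"
  unfolding almost_automorphic_def continuous_map_real_mdist_iff[OF U]
proof (intro conjI c allI)
  fix \<sigma> :: "nat \<Rightarrow> real"
  obtain r where r: "strict_mono r" and ret: "returning (\<lambda>s t. mdist m (U s) (U t)) (\<sigma> \<circ> r)"
    using aa unfolding automorphic_pm_def by blast
  have "\<exists>l\<in>mspace m. \<forall>\<epsilon>>0. \<exists>N. \<forall>n\<ge>N. mdist m (U (t + \<sigma> (r n))) l < \<epsilon>" for t
    using U returning_CauchyD[OF ret, of _ t] by (intro complete) auto
  then have "\<forall>t. \<exists>l. l \<in> mspace m \<and> (\<forall>\<epsilon>>0. \<exists>N. \<forall>n\<ge>N. mdist m (U (t + \<sigma> (r n))) l < \<epsilon>)"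
    by blast
  from choice[OF this] obtain V where V': "\<forall>t. V t \<in> mspace m \<and> (\<forall>\<epsilon>>0. \<exists>N. \<forall>n\<ge>N. mdist m (U (t + \<sigma> (r n))) (V t) < \<epsilon>)"
    by (elim exE)
  then have V: "range V \<subseteq> mspace m"
    and lim: "\<And>t \<epsilon>. 0 < \<epsilon> \<Longrightarrow> \<exists>N. \<forall>n\<ge>N. mdist m (U (t + \<sigma> (r n))) (V t) < \<epsilon>"
    by auto
  have mem: "U t \<in> mspace m" "V t \<in> mspace m" for t
    using U V by auto
  have lim': "\<exists>N. \<forall>n\<ge>N. mdist m (V (t - \<sigma> (r n))) (U t) < \<epsilon>" if "0 < \<epsilon>" for t \<epsilon>
  proof -
    have \<epsilon>: "0 < \<epsilon> / 2" using that by simp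
    obtain N where N: "\<forall>k\<ge>N. \<exists>m0. \<forall>n\<ge>m0. mdist m (U (t - (\<sigma> \<circ> r) k + (\<sigma> \<circ> r) n)) (U t) < \<epsilon> / 2"
      using returning_returnD[OF ret \<epsilon>] by blast
    have "mdist m (V (t - \<sigma> (r k))) (U t) < \<epsilon>" if k: "k \<ge> N" for k
    proof -
      obtain m0 where m0: "\<forall>n\<ge>m0. mdist m (U (t - \<sigma> (r k) + \<sigma> (r n))) (U t) < \<epsilon> / 2"
        using N k by auto
      obtain m1 where m1: "\<forall>n\<ge>m1. mdist m (U (t - \<sigma> (r k) + \<sigma> (r n))) (V (t - \<sigma> (r k))) < \<epsilon> / 2"
        using lim[OF \<epsilon>] by blast
      let ?x = "U (t - \<sigma> (r k) + \<sigma> (r (max m0 m1)))"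
      have "mdist m ?x (U t) < \<epsilon> / 2" "mdist m ?x (V (t - \<sigma> (r k))) < \<epsilon> / 2"
        using m0 m1 by auto
      moreover have "mdist m (V (t - \<sigma> (r k))) (U t) \<le> mdist m (V (t - \<sigma> (r k))) ?x + mdist m ?x (U t)"
        by (intro mdist_triangle mem)
      ultimately show ?thesis
        using mdist_commute[of m "V (t - \<sigma> (r k))" ?x] by linarith
    qed
    then show ?thesis by blast
  qed
  show "\<exists>r. strict_mono r \<and> (\<exists>v. range v \<subseteq> mspace m \<and>
          (\<forall>t. limitin (mtopology_of m) (\<lambda>k. U (t + \<sigma> (r k))) (v t) sequentially \<and>
               limitin (mtopology_of m) (\<lambda>k. v (t - \<sigma> (r k))) (U t) sequentially))"
  proof (rule exI[of _ r], intro conjI exI[of _ V] allI)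
    show "limitin (mtopology_of m) (\<lambda>k. U (t + \<sigma> (r k))) (V t) sequentially" for t
      using lim mem by (subst limitin_sequentially_mdist_iff) auto
    show "limitin (mtopology_of m) (\<lambda>k. V (t - \<sigma> (r k))) (U t) sequentially" for t
      using lim' mem by (subst limitin_sequentially_mdist_iff) auto
  qed (use r V in auto)
qed

definition window_dist :: "real \<Rightarrow> (real \<Rightarrow> 'e::banach) \<Rightarrow> real \<Rightarrow> real \<Rightarrow> real" where
  "window_dist p u s t = Lp_norm p 0 1 (\<lambda>\<theta>. u (s + \<theta>) - u (t + \<theta>))"

lemma window_dist_nonneg: "0 \<le> window_dist p u s t"
  by (simp add: window_dist_def Lp_norm_nonneg)

lemma range_bochner_transform:
  assumes "1 \<le> p" "u \<in> Lp_loc p"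
  shows "range (bochner_transform p u) \<subseteq> mspace (Lp_metric p 0 1)"
  using assms by (auto simp: mspace_Lp_metric bochner_transform_def intro!: Lp_class_in_space Lp_loc_shift)

lemma mdist_bochner_transform:
  assumes "1 \<le> p" "u \<in> Lp_loc p"
  shows "(\<lambda>s t. mdist (Lp_metric p 0 1) (bochner_transform p u s) (bochner_transform p u t)) = window_dist p u"
  using assms by (simp add: fun_eq_iff mdist_Lp_metric bochner_transform_def window_dist_def Lp_dist_class Lp_loc_shift)

lemma pseudometric_window_dist:
  assumes "1 \<le> p" "u \<in> Lp_loc p"
  shows "pseudometric (window_dist p u)"
  using pseudometric_mdist[OF range_bochner_transform[OF assms]]
  unfolding mdist_bochner_transform[OF assms] .

lemma Lp_metric_complete:
  fixes \<sigma> :: "nat \<Rightarrow> (real \<Rightarrow> 'e::banach) set"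
  assumes p: "1 \<le> p" and \<sigma>: "range \<sigma> \<subseteq> mspace (Lp_metric p a b)"
    and Cauchy: "\<And>\<epsilon>. 0 < \<epsilon> \<Longrightarrow> \<exists>N. \<forall>i\<ge>N. \<forall>j\<ge>N. mdist (Lp_metric p a b) (\<sigma> i) (\<sigma> j) < \<epsilon>"
  shows "\<exists>l\<in>mspace (Lp_metric p a b). \<forall>\<epsilon>>0. \<exists>N. \<forall>n\<ge>N. mdist (Lp_metric p a b) (\<sigma> n) l < \<epsilon>"
proof -
  have "\<exists>h. h \<in> Lp p a b \<and> \<sigma> n = Lp_class p a b h" for n
    using \<sigma> p by (metis Lp_space_cases mspace_Lp_metric range_subsetD)
  then have "\<exists>h. \<forall>n. h n \<in> Lp p a b \<and> \<sigma> n = Lp_class p a b (h n)"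
    by (intro choice allI)
  then obtain h where h: "\<And>n. h n \<in> Lp p a b" "\<And>n. \<sigma> n = Lp_class p a b (h n)"
    by blast
  obtain g where g: "g \<in> Lp p a b" "\<forall>\<epsilon>>0. \<exists>N. \<forall>n\<ge>N. Lp_norm p a b (\<lambda>\<theta>. h n \<theta> - g \<theta>) < \<epsilon>"
    using Lp_complete[OF p h(1) Cauchy[unfolded h(2) mdist_Lp_metric[OF p] Lp_dist_class[OF p h(1) h(1)]]]
    by blast
  then show ?thesis
    using p h by (intro bexI[of _ "Lp_class p a b g"])
      (auto simp: mdist_Lp_metric mspace_Lp_metric Lp_dist_class Lp_class_in_space)
qed

lemma Stepanov_aa_iff:
  assumes p: "1 \<le> p"
  shows "u \<in> Stepanov_aa p \<longleftrightarrow> u \<in> Lp_loc p \<and> continuous_pm (window_dist p u) \<and> automorphic_pm (window_dist p u)"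
proof (cases "u \<in> Lp_loc p")
  case True
  note U = range_bochner_transform[OF p True] and eq = mdist_bochner_transform[OF p True]
  have "almost_automorphic (Lp_metric p 0 1) (bochner_transform p u) \<longleftrightarrow>
     continuous_pm (window_dist p u) \<and> automorphic_pm (window_dist p u)"
  proof
    assume aa: "almost_automorphic (Lp_metric p 0 1) (bochner_transform p u)"
    then have "continuous_map euclideanreal (mtopology_of (Lp_metric p 0 1)) (bochner_transform p u)"
      by (simp add: almost_automorphic_def)
    then show "continuous_pm (window_dist p u) \<and> automorphic_pm (window_dist p u)"
      using automorphic_pm_if_almost_automorphic[OF U aa]
      unfolding continuous_map_real_mdist_iff[OF U] eq by blast
  next
    assume "continuous_pm (window_dist p u) \<and> automorphic_pm (window_dist p u)"
    then show "almost_automorphic (Lp_metric p 0 1) (bochner_transform p u)"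
      using almost_automorphic_if_automorphic_pm[OF U, unfolded eq] Lp_metric_complete[OF p] by blast
  qed
  with True show ?thesis by (simp add: Stepanov_aa_def)
qed (simp add: Stepanov_aa_def)

lemma Stepanov_ap_iff:
  assumes p: "1 \<le> p"
  shows "u \<in> Stepanov_ap p \<longleftrightarrow> u \<in> Lp_loc p \<and> continuous_pm (window_dist p u) \<and> translates_tb (window_dist p u)"
  using almost_periodic_iff[OF range_bochner_transform[OF p], of u] mdist_bochner_transform[OF p, of u]
  by (auto simp: Stepanov_ap_def)

lemma Lp_totally_bounded_windows:
  assumes u: "u \<in> Lp_loc p" and tb: "tb_pm (window_dist p u)"
  shows "Lp_totally_bounded p 0 1 (range (\<lambda>t \<theta>. u (t + \<theta>)))"
  unfolding Lp_totally_bounded_def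
proof (intro conjI allI impI)
  show "range (\<lambda>t \<theta>. u (t + \<theta>)) \<subseteq> Lp p 0 1"
    using Lp_loc_shift[OF u] by blast
  fix \<epsilon> :: real assume "0 < \<epsilon>"
  then obtain T where T: "finite T" "\<forall>t. \<exists>s\<in>T. window_dist p u t s < \<epsilon>"
    using tb unfolding tb_pm_def by blast
  show "\<exists>H. finite H \<and> H \<subseteq> Lp p 0 1 \<and>
      (\<forall>g\<in>range (\<lambda>t \<theta>. u (t + \<theta>)). \<exists>h\<in>H. Lp_norm p 0 1 (\<lambda>\<theta>. g \<theta> - h \<theta>) < \<epsilon>)"
  proof (intro exI conjI ballI)
    show "finite ((\<lambda>t \<theta>. u (t + \<theta>)) ` T)" using T by simp
    show "(\<lambda>t \<theta>. u (t + \<theta>)) ` T \<subseteq> Lp p 0 1" using Lp_loc_shift[OF u] by blast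
    fix g assume "g \<in> range (\<lambda>t \<theta>. u (t + \<theta>))"
    then show "\<exists>h\<in>(\<lambda>t \<theta>. u (t + \<theta>)) ` T. Lp_norm p 0 1 (\<lambda>\<theta>. g \<theta> - h \<theta>) < \<epsilon>"
      using T(2) by (auto simp: window_dist_def)
  qed
qed

lemma Lp_norm_triangle_diff:
  assumes p: "1 \<le> p" and "u \<in> Lp p a b" "v \<in> Lp p a b" "w \<in> Lp p a b"
  shows "Lp_norm p a b (\<lambda>\<theta>. u \<theta> - w \<theta>)
    \<le> Lp_norm p a b (\<lambda>\<theta>. u \<theta> - v \<theta>) + Lp_norm p a b (\<lambda>\<theta>. v \<theta> - w \<theta>)"
proof (rule Lp_norm_triangle[OF p])
  have "norm (u \<theta> - w \<theta>) \<le> norm (u \<theta> - v \<theta>) + norm (v \<theta> - w \<theta>)" for \<theta>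
    using norm_triangle_ineq[of "u \<theta> - v \<theta>" "v \<theta> - w \<theta>"] by simp
  then show "AE \<theta> in lebesgue_on {a<..<b}. norm (u \<theta> - w \<theta>) \<le> norm (u \<theta> - v \<theta>) + norm (v \<theta> - w \<theta>)"
    by simp
qed (use assms in \<open>auto intro: Lp_diff\<close>)

text \<open>The content is that the supremum is finite: totally bounded windows stay at bounded
  distance from the window at 0.\<close>

lemma Lp_norm_le_Stepanov_norm:
  assumes p: "1 \<le> p" and u: "u \<in> Lp_loc p" "tb_pm (window_dist p u)"
    and v: "v \<in> Lp_loc p" "tb_pm (window_dist p v)"
  shows "Lp_norm p 0 1 (\<lambda>\<theta>. v (t + \<theta>) - u (t + \<theta>)) \<le> Stepanov_norm p (\<lambda>t. v t - u t)"
  unfolding Stepanov_norm_def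
proof (rule cSUP_upper)
  have bounded: "\<exists>B. \<forall>t. window_dist p w t 0 \<le> B" if w: "w \<in> Lp_loc p" "tb_pm (window_dist p w)"
    for w :: "real \<Rightarrow> 'a"
  proof -
    obtain T where T: "finite T" "\<forall>t. \<exists>s\<in>T. window_dist p w t s < 1"
      using w(2) zero_less_one unfolding tb_pm_def by blast
    have "window_dist p w t 0 \<le> 1 + Max ((\<lambda>s. window_dist p w s 0) ` T)" for t
    proof -
      obtain s where s: "s \<in> T" "window_dist p w t s < 1" using T(2) by blast
      have "window_dist p w s 0 \<le> Max ((\<lambda>s. window_dist p w s 0) ` T)"
        using T(1) s(1) by simp
      moreover have "window_dist p w t 0 \<le> window_dist p w t s + window_dist p w s 0"
        using pseudometric_window_dist[OF p w(1)] unfolding pseudometric_def by blast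
      ultimately show ?thesis using s(2) by linarith
    qed
    then show ?thesis by blast
  qed
  obtain B C where B: "\<forall>t. window_dist p u t 0 \<le> B" and C: "\<forall>t. window_dist p v t 0 \<le> C"
    using bounded[OF u] bounded[OF v] by blast
  show "bdd_above (range (\<lambda>t. Lp_norm p 0 1 (\<lambda>\<theta>. v (t + \<theta>) - u (t + \<theta>))))"
  proof (rule bdd_aboveI2)
    fix t
    note L = Lp_loc_shift[OF u(1)] Lp_loc_shift[OF v(1)]
    have "Lp_norm p 0 1 (\<lambda>\<theta>. v (t + \<theta>) - u (t + \<theta>)) \<le> window_dist p v t 0
        + Lp_norm p 0 1 (\<lambda>\<theta>. v (0 + \<theta>) - u (t + \<theta>))"
      unfolding window_dist_def by (rule Lp_norm_triangle_diff[OF p L(2) L(2) L(1)])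
    moreover have "Lp_norm p 0 1 (\<lambda>\<theta>. v (0 + \<theta>) - u (t + \<theta>))
        \<le> Lp_norm p 0 1 (\<lambda>\<theta>. v (0 + \<theta>) - u (0 + \<theta>)) + window_dist p u 0 t"
      unfolding window_dist_def by (rule Lp_norm_triangle_diff[OF p L(2) L(1) L(1)])
    moreover have "window_dist p u 0 t = window_dist p u t 0"
      using pseudometric_window_dist[OF p u(1)] unfolding pseudometric_def by blast
    ultimately show "Lp_norm p 0 1 (\<lambda>\<theta>. v (t + \<theta>) - u (t + \<theta>))
        \<le> C + (Lp_norm p 0 1 (\<lambda>\<theta>. v (0 + \<theta>) - u (0 + \<theta>)) + B)"
      using B[rule_format, of t] C[rule_format, of t] by linarith
  qed
qed simp

text \<open>From some index N on, a net for the windows of u also serves those of v n; the finitely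
  many earlier v n bring their own nets.\<close>

lemma Lp_totally_bounded_uniform_limit:
  fixes u :: "real \<Rightarrow> 'e::banach" and v :: "nat \<Rightarrow> real \<Rightarrow> 'e"
  assumes p: "1 \<le> p" and u: "Lp_totally_bounded p 0 1 (range (\<lambda>t \<theta>. u (t + \<theta>)))"
    and v: "\<And>n. Lp_totally_bounded p 0 1 (range (\<lambda>t \<theta>. v n (t + \<theta>)))"
    and lim: "\<And>\<epsilon>. 0 < \<epsilon> \<Longrightarrow> \<exists>N. \<forall>n\<ge>N. \<forall>t. Lp_norm p 0 1 (\<lambda>\<theta>. v n (t + \<theta>) - u (t + \<theta>)) < \<epsilon>"
  shows "Lp_totally_bounded p 0 1 (\<Union>w\<in>insert u (range v). range (\<lambda>t \<theta>. w (t + \<theta>)))"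
  unfolding Lp_totally_bounded_def
proof (intro conjI allI impI)
  have uL: "(\<lambda>\<theta>. u (t + \<theta>)) \<in> Lp p 0 1" for t
    using u unfolding Lp_totally_bounded_def by blast
  have vL: "(\<lambda>\<theta>. v n (t + \<theta>)) \<in> Lp p 0 1" for n t
    using v[of n] unfolding Lp_totally_bounded_def by blast
  show "(\<Union>w\<in>insert u (range v). range (\<lambda>t \<theta>. w (t + \<theta>))) \<subseteq> Lp p 0 1"
    using uL vL by auto
  fix \<epsilon> :: real assume \<epsilon>: "0 < \<epsilon>"
  then have \<epsilon>2: "0 < \<epsilon> / 2" by simp
  obtain N where N: "\<forall>n\<ge>N. \<forall>t. Lp_norm p 0 1 (\<lambda>\<theta>. v n (t + \<theta>) - u (t + \<theta>)) < \<epsilon> / 2"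
    using lim[OF \<epsilon>2] by blast
  obtain H where H: "finite H" "H \<subseteq> Lp p 0 1"
    "\<forall>g\<in>range (\<lambda>t \<theta>. u (t + \<theta>)). \<exists>h\<in>H. Lp_norm p 0 1 (\<lambda>\<theta>. g \<theta> - h \<theta>) < \<epsilon> / 2"
    using Lp_totally_boundedD[OF u \<epsilon>2] by (elim exE conjE) (rule that)
  have "\<exists>H'. \<forall>n. finite (H' n) \<and> H' n \<subseteq> Lp p 0 1 \<and>
      (\<forall>g\<in>range (\<lambda>t \<theta>. v n (t + \<theta>)). \<exists>h\<in>H' n. Lp_norm p 0 1 (\<lambda>\<theta>. g \<theta> - h \<theta>) < \<epsilon>)"
    by (intro choice allI Lp_totally_boundedD[OF v \<epsilon>])
  then obtain H' where H': "\<forall>n. finite (H' n) \<and> H' n \<subseteq> Lp p 0 1 \<and>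
      (\<forall>g\<in>range (\<lambda>t \<theta>. v n (t + \<theta>)). \<exists>h\<in>H' n. Lp_norm p 0 1 (\<lambda>\<theta>. g \<theta> - h \<theta>) < \<epsilon>)"
    by (elim exE)
  let ?H = "H \<union> (\<Union>n<N. H' n)"
  have u_near: "\<exists>h\<in>H. Lp_norm p 0 1 (\<lambda>\<theta>. u (t + \<theta>) - h \<theta>) < \<epsilon> / 2" for t
    using H(3) by simp
  have v_near: "\<exists>h\<in>?H. Lp_norm p 0 1 (\<lambda>\<theta>. v n (t + \<theta>) - h \<theta>) < \<epsilon>" for n t
  proof (cases "n < N")
    case True
    have "\<exists>h\<in>H' n. Lp_norm p 0 1 (\<lambda>\<theta>. v n (t + \<theta>) - h \<theta>) < \<epsilon>"
      using H' by simp
    with True show ?thesis by (auto intro: bexI)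
  next
    case False
    obtain h where h: "h \<in> H" "Lp_norm p 0 1 (\<lambda>\<theta>. u (t + \<theta>) - h \<theta>) < \<epsilon> / 2"
      using u_near[of t] by (elim bexE) (rule that)
    have "Lp_norm p 0 1 (\<lambda>\<theta>. v n (t + \<theta>) - u (t + \<theta>)) < \<epsilon> / 2"
      using N False by simp
    moreover have "Lp_norm p 0 1 (\<lambda>\<theta>. v n (t + \<theta>) - h \<theta>)
        \<le> Lp_norm p 0 1 (\<lambda>\<theta>. v n (t + \<theta>) - u (t + \<theta>)) + Lp_norm p 0 1 (\<lambda>\<theta>. u (t + \<theta>) - h \<theta>)"
      using H(2) h(1) by (intro Lp_norm_triangle_diff[OF p vL uL]) auto
    ultimately show ?thesis using h by (intro bexI[of _ h]) auto
  qed
  show "\<exists>H. finite H \<and> H \<subseteq> Lp p 0 1 \<and>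
      (\<forall>g\<in>\<Union>w\<in>insert u (range v). range (\<lambda>t \<theta>. w (t + \<theta>)). \<exists>h\<in>H. Lp_norm p 0 1 (\<lambda>\<theta>. g \<theta> - h \<theta>) < \<epsilon>)"
  proof (intro exI[of _ ?H] conjI ballI)
    fix g assume "g \<in> (\<Union>w\<in>insert u (range v). range (\<lambda>t \<theta>. w (t + \<theta>)))"
    then consider t where "g = (\<lambda>\<theta>. u (t + \<theta>))" | n t where "g = (\<lambda>\<theta>. v n (t + \<theta>))"
      by auto
    then show "\<exists>h\<in>?H. Lp_norm p 0 1 (\<lambda>\<theta>. g \<theta> - h \<theta>) < \<epsilon>"
    proof cases
      case 1
      obtain h where "h \<in> H" "Lp_norm p 0 1 (\<lambda>\<theta>. u (t + \<theta>) - h \<theta>) < \<epsilon> / 2"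
        using u_near[of t] by (elim bexE) (rule that)
      then show ?thesis unfolding 1 using \<epsilon> by (intro bexI[of _ h]) auto
    next
      case 2
      show ?thesis unfolding 2 by (rule v_near)
    qed
  qed (use H(1,2) H' in auto)
qed

section \<open>Superposition operators on Stepanov spaces\<close>

context Nemytskii_operator
begin

text \<open>Running the modulus through the tolerances 1/(n+1) leaves countably many finite sets F
  n, as the diagonal argument requires. A small sum bounds each of its nonnegative terms, so one
  pseudometric per n encodes all conditions.\<close>

lemma Nemytskii_controlled:
  assumes w: "w \<in> Lp_loc p" "tb_pm (window_dist p w)"
  obtains F :: "nat \<Rightarrow> 'x set" where "\<And>n. finite (F n)"
    "controlled_by (window_dist q (Nemytskii f w))
       (\<lambda>n s t. window_dist p w s t + (\<Sum>x\<in>F n. window_dist q (\<lambda>t. f t x) s t))"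
proof -
  have W: "Lp_totally_bounded p 0 1 (\<Union>w\<in>{w}. range (\<lambda>t \<theta>. w (t + \<theta>)))"
    using Lp_totally_bounded_windows[OF w] by simp
  have W_loc: "{w} \<subseteq> Lp_loc p" using w(1) by simp
  have inverse_Suc: "0 < inverse (real (Suc n))" for n by simp
  have "\<exists>F. finite F \<and> (\<exists>\<eta>>0. \<forall>s t. window_dist p w s t < \<eta> \<longrightarrow>
      (\<forall>x\<in>F. window_dist q (\<lambda>t. f t x) s t < \<eta>) \<longrightarrow> window_dist q (Nemytskii f w) s t < inverse (real (Suc n)))" for n
  proof -
    obtain F \<eta> where F: "finite F" "0 < \<eta>"
      "\<forall>v\<in>{w}. \<forall>v'\<in>{w}. \<forall>s t. Lp_norm p 0 1 (\<lambda>\<theta>. v (t + \<theta>) - v' (s + \<theta>)) < \<eta> \<longrightarrow>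
       (\<forall>x\<in>F. Lp_norm q 0 1 (\<lambda>\<theta>. f (t + \<theta>) x - f (s + \<theta>) x) < \<eta>) \<longrightarrow>
       Lp_norm q 0 1 (\<lambda>\<theta>. Nemytskii f v (t + \<theta>) - Nemytskii f v' (s + \<theta>)) < inverse (real (Suc n))"
      by (rule Nemytskii_modulus[OF W W_loc inverse_Suc]) (rule that)
    then show ?thesis
      by (intro exI[of _ F] conjI exI[of _ \<eta>]) (simp_all add: window_dist_def)
  qed
  then have "\<forall>n. \<exists>F. finite F \<and> (\<exists>\<eta>>0. \<forall>s t. window_dist p w s t < \<eta> \<longrightarrow>
      (\<forall>x\<in>F. window_dist q (\<lambda>t. f t x) s t < \<eta>) \<longrightarrow> window_dist q (Nemytskii f w) s t < inverse (real (Suc n)))"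
    by (rule allI)
  from choice[OF this] obtain F where F: "\<forall>n. finite (F n) \<and> (\<exists>\<eta>>0. \<forall>s t. window_dist p w s t < \<eta> \<longrightarrow>
      (\<forall>x\<in>F n. window_dist q (\<lambda>t. f t x) s t < \<eta>) \<longrightarrow> window_dist q (Nemytskii f w) s t < inverse (real (Suc n)))"
    by (elim exE)
  show thesis
  proof
    show fin: "finite (F n)" for n using F by blast
    show "controlled_by (window_dist q (Nemytskii f w))
       (\<lambda>n s t. window_dist p w s t + (\<Sum>x\<in>F n. window_dist q (\<lambda>t. f t x) s t))"
      unfolding controlled_by_def
    proof (intro allI impI)
      fix \<epsilon> :: real assume "0 < \<epsilon>"
      then obtain n where n: "inverse (real (Suc n)) < \<epsilon>"
        using reals_Archimedean by blast
      obtain \<eta> where \<eta>: "\<eta> > 0" "\<forall>s t. window_dist p w s t < \<eta> \<longrightarrow>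
          (\<forall>x\<in>F n. window_dist q (\<lambda>t. f t x) s t < \<eta>) \<longrightarrow> window_dist q (Nemytskii f w) s t < inverse (real (Suc n))"
        using F by blast
      have "window_dist q (Nemytskii f w) s t < \<epsilon>"
        if lt: "window_dist p w s t + (\<Sum>x\<in>F n. window_dist q (\<lambda>t. f t x) s t) < \<eta>" for s t
      proof -
        have "window_dist q (\<lambda>t. f t x) s t \<le> (\<Sum>x\<in>F n. window_dist q (\<lambda>t. f t x) s t)" if "x \<in> F n" for x
          using that fin[of n] by (intro member_le_sum) (auto simp: window_dist_nonneg)
        then have "\<forall>x\<in>F n. window_dist q (\<lambda>t. f t x) s t < \<eta>"
          using lt window_dist_nonneg[of p w s t] by fastforce
        moreover have "window_dist p w s t < \<eta>"
          using lt sum_nonneg[of "F n" "\<lambda>x. window_dist q (\<lambda>t. f t x) s t"]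
          by (simp add: window_dist_nonneg)
        ultimately show ?thesis using \<eta>(2) n by fastforce
      qed
      then show "\<exists>n. \<exists>\<eta>>0. \<forall>s t. window_dist p w s t + (\<Sum>x\<in>F n. window_dist q (\<lambda>t. f t x) s t) < \<eta> \<longrightarrow>
          window_dist q (Nemytskii f w) s t < \<epsilon>"
        using \<eta>(1) by blast
    qed
  qed
qed

lemma Nemytskii_Stepanov_aa:
  assumes f: "\<And>x. (\<lambda>t. f t x) \<in> Stepanov_aa q" and w: "w \<in> Stepanov_aa p"
  shows "Nemytskii f w \<in> Stepanov_aa q"
proof -
  have w': "w \<in> Lp_loc p" "continuous_pm (window_dist p w)" "automorphic_pm (window_dist p w)"
    using w Stepanov_aa_iff[OF p] by auto
  obtain F :: "nat \<Rightarrow> 'x set" where fin: "\<And>n. finite (F n)" and control: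
    "controlled_by (window_dist q (Nemytskii f w))
       (\<lambda>n s t. window_dist p w s t + (\<Sum>x\<in>F n. window_dist q (\<lambda>t. f t x) s t))"
    using Nemytskii_controlled[OF w'(1) tb_pm_if_automorphic[OF pseudometric_window_dist[OF p w'(1)] w'(3)]]
    by blast
  have fx: "continuous_pm (window_dist q (\<lambda>t. f t x))" "automorphic_pm (window_dist q (\<lambda>t. f t x))" for x
    using f[of x] Stepanov_aa_iff[OF q] by auto
  have "continuous_pm (window_dist q (Nemytskii f w))"
    by (rule continuous_pm_controlled[OF control], rule pm_sum_induct[where P = continuous_pm])
       (use w' fx fin continuous_pm_add in auto)
  moreover have "automorphic_pm (window_dist q (Nemytskii f w))"
    by (rule automorphic_pm_controlled[OF control], rule pm_sum_induct[where P = automorphic_pm])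
       (use w' fx fin automorphic_pm_add in auto)
  ultimately show ?thesis
    using Nemytskii_Lp_loc[OF w'(1)] Stepanov_aa_iff[OF q] by blast
qed

lemma Nemytskii_Stepanov_ap:
  assumes f: "\<And>x. (\<lambda>t. f t x) \<in> Stepanov_ap q" and w: "w \<in> Stepanov_ap p"
  shows "Nemytskii f w \<in> Stepanov_ap q"
proof -
  have w': "w \<in> Lp_loc p" "continuous_pm (window_dist p w)" "translates_tb (window_dist p w)"
    using w Stepanov_ap_iff[OF p] by auto
  obtain F :: "nat \<Rightarrow> 'x set" where fin: "\<And>n. finite (F n)" and control:
    "controlled_by (window_dist q (Nemytskii f w))
       (\<lambda>n s t. window_dist p w s t + (\<Sum>x\<in>F n. window_dist q (\<lambda>t. f t x) s t))"
    using Nemytskii_controlled[OF w'(1) tb_pm_if_translates_tb[OF w'(3)]] by blast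
  have fx: "continuous_pm (window_dist q (\<lambda>t. f t x))" "translates_tb (window_dist q (\<lambda>t. f t x))"
    "pseudometric (window_dist q (\<lambda>t. f t x))" for x
    using f[of x] Stepanov_ap_iff[OF q] pseudometric_window_dist[OF q] by auto
  have "continuous_pm (window_dist q (Nemytskii f w))"
    by (rule continuous_pm_controlled[OF control], rule pm_sum_induct[where P = continuous_pm])
       (use w' fx fin continuous_pm_add in auto)
  moreover have "pseudometric (\<lambda>s t. window_dist p w s t + (\<Sum>x\<in>F n. window_dist q (\<lambda>t. f t x) s t)) \<and>
      translates_tb (\<lambda>s t. window_dist p w s t + (\<Sum>x\<in>F n. window_dist q (\<lambda>t. f t x) s t))" for n
    by (rule pm_sum_induct[where P = "\<lambda>D. pseudometric D \<and> translates_tb D"])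
       (use w' fx fin pseudometric_window_dist[OF p w'(1)] pseudometric_add translates_tb_add in auto)
  then have "translates_tb (window_dist q (Nemytskii f w))"
    by (intro translates_tb_controlled[OF control]) blast
  ultimately show ?thesis
    using Nemytskii_Lp_loc[OF w'(1)] Stepanov_ap_iff[OF q] by blast
qed

text \<open>
  A sequence converging in the Stepanov norm has, together with its limit, a totally bounded set of
  windows, so that a single compact set \<open>K\<close> serves all its members; this is why sequences are used.
\<close>

lemma Nemytskii_Stepanov_continuous_on:
  assumes A: "\<And>u. u \<in> A \<Longrightarrow> u \<in> Lp_loc p \<and> tb_pm (window_dist p u)"
  shows "Stepanov_continuous_on p q A (Nemytskii f)"
  unfolding Stepanov_continuous_on_def
proof (intro ballI allI impI, rule ccontr)
  fix u and \<epsilon> :: real assume u: "u \<in> A" and \<epsilon>: "0 < \<epsilon>"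
  assume "\<not> (\<exists>\<delta>>0. \<forall>v\<in>A. Stepanov_norm p (\<lambda>t. v t - u t) < \<delta> \<longrightarrow>
      Stepanov_norm q (\<lambda>t. Nemytskii f v t - Nemytskii f u t) < \<epsilon>)"
  then have "\<exists>v. v \<in> A \<and> Stepanov_norm p (\<lambda>t. v t - u t) < inverse (real (Suc n)) \<and>
      \<not> Stepanov_norm q (\<lambda>t. Nemytskii f v t - Nemytskii f u t) < \<epsilon>" for n
    by (metis inverse_positive_iff_positive of_nat_0_less_iff zero_less_Suc)
  then have "\<exists>v. \<forall>n. v n \<in> A \<and> Stepanov_norm p (\<lambda>t. v n t - u t) < inverse (real (Suc n)) \<and>
      \<not> Stepanov_norm q (\<lambda>t. Nemytskii f (v n) t - Nemytskii f u t) < \<epsilon>"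
    by (intro choice allI)
  then obtain v where v: "\<And>n. v n \<in> A" "\<And>n. Stepanov_norm p (\<lambda>t. v n t - u t) < inverse (real (Suc n))"
    "\<And>n. \<not> Stepanov_norm q (\<lambda>t. Nemytskii f (v n) t - Nemytskii f u t) < \<epsilon>"
    by blast
  have near: "Lp_norm p 0 1 (\<lambda>\<theta>. v n (t + \<theta>) - u (t + \<theta>)) < inverse (real (Suc n))" for n t
    using Lp_norm_le_Stepanov_norm[OF p, of u "v n" t] A[OF u] A[OF v(1)[of n]] v(2)[of n] by simp
  have lim: "\<exists>N. \<forall>n\<ge>N. \<forall>t. Lp_norm p 0 1 (\<lambda>\<theta>. v n (t + \<theta>) - u (t + \<theta>)) < e" if e: "0 < e" for e
  proof -
    obtain N where N: "inverse (real (Suc N)) < e"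
      using reals_Archimedean[OF e] by blast
    have "Lp_norm p 0 1 (\<lambda>\<theta>. v n (t + \<theta>) - u (t + \<theta>)) < e" if "n \<ge> N" for n t
    proof -
      have "inverse (real (Suc n)) \<le> inverse (real (Suc N))"
        using that by (intro le_imp_inverse_le) auto
      with near[of n t] N show ?thesis by linarith
    qed
    then show ?thesis by blast
  qed
  define W where "W = insert u (range v)"
  have tb: "Lp_totally_bounded p 0 1 (\<Union>w\<in>W. range (\<lambda>t \<theta>. w (t + \<theta>)))"
    unfolding W_def using A u v(1) lim
    by (intro Lp_totally_bounded_uniform_limit[OF p] Lp_totally_bounded_windows) auto
  have W_loc: "W \<subseteq> Lp_loc p" using A u v(1) by (auto simp: W_def)
  have \<epsilon>2: "0 < \<epsilon> / 2" using \<epsilon> by simp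
  obtain F \<eta> where \<eta>: "0 < \<eta>"
    "\<forall>w\<in>W. \<forall>w'\<in>W. \<forall>s t. Lp_norm p 0 1 (\<lambda>\<theta>. w (t + \<theta>) - w' (s + \<theta>)) < \<eta> \<longrightarrow>
       (\<forall>x\<in>F. Lp_norm q 0 1 (\<lambda>\<theta>. f (t + \<theta>) x - f (s + \<theta>) x) < \<eta>) \<longrightarrow>
       Lp_norm q 0 1 (\<lambda>\<theta>. Nemytskii f w (t + \<theta>) - Nemytskii f w' (s + \<theta>)) < \<epsilon> / 2"
    by (rule Nemytskii_modulus[OF tb W_loc \<epsilon>2]) (rule that)
  obtain n where n: "\<forall>t. Lp_norm p 0 1 (\<lambda>\<theta>. v n (t + \<theta>) - u (t + \<theta>)) < \<eta>"
    using lim[OF \<eta>(1)] by blast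
  have "Lp_norm q 0 1 (\<lambda>\<theta>. Nemytskii f (v n) (t + \<theta>) - Nemytskii f u (t + \<theta>)) < \<epsilon> / 2" for t
    \<comment> \<open>Both times are t, so the differences of f(.,x) vanish and the condition on F
      holds for any \<eta>.\<close>
    using \<eta>(2)[rule_format, of "v n" u t t] \<eta>(1) n q by (simp add: W_def Lp_norm_def)
  \<comment> \<open>Passing to the supremum weakens < to \<le>, hence the modulus was taken at
    \<epsilon> / 2.\<close>
  then have "Stepanov_norm q (\<lambda>t. Nemytskii f (v n) t - Nemytskii f u t) \<le> \<epsilon> / 2"
    unfolding Stepanov_norm_def by (intro cSUP_least) (auto intro: less_imp_le)
  with v(3)[of n] \<epsilon> show False by simp
qed

end

lemma Stepanov_aa_tb:
  assumes "1 \<le> p" "u \<in> Stepanov_aa p"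
  shows "u \<in> Lp_loc p \<and> tb_pm (window_dist p u)"
  using assms by (auto simp: Stepanov_aa_iff intro: tb_pm_if_automorphic pseudometric_window_dist)

lemma Stepanov_ap_tb:
  assumes "1 \<le> p" "u \<in> Stepanov_ap p"
  shows "u \<in> Lp_loc p \<and> tb_pm (window_dist p u)"
  using assms by (auto simp: Stepanov_ap_iff intro: tb_pm_if_translates_tb)

theorem theorem6p4:
  fixes f :: "real \<Rightarrow> 'x::banach \<Rightarrow> 'y::banach"
    and p q :: real
  assumes p: "1 \<le> p" and q: "1 \<le> q"
    and H1: "\<exists>a>0. \<exists>b\<in>(Stepanov_aa q :: (real \<Rightarrow> real) set).
               AE t in lebesgue. \<forall>x. norm (f t x) \<le> a * norm x powr (p / q) + b t"
    and H2: "AE t in lebesgue. continuous_on UNIV (f t)"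
    and H3: "\<forall>K r. compact K \<and> r > 0 \<longrightarrow>
               (\<exists>N\<in>sets lebesgue.
                  (SUP t. measure lebesgue ({t<..<t + 1} \<inter> N)) < r \<and>
                  (\<forall>\<epsilon>>0. \<exists>\<delta>>0. \<forall>x1\<in>K. \<forall>x2\<in>K. \<forall>t\<in>-N.
                      norm (x1 - x2) \<le> \<delta> \<longrightarrow> norm (f t x1 - f t x2) \<le> \<epsilon>))"
  shows "((\<forall>x. (\<lambda>t. f t x) \<in> Stepanov_aa q) \<longrightarrow>
            Nemytskii f ` Stepanov_aa p \<subseteq> Stepanov_aa q \<and>
            Stepanov_continuous_on p q (Stepanov_aa p) (Nemytskii f)) \<and>
         ((\<forall>x. (\<lambda>t. f t x) \<in> Stepanov_ap q) \<longrightarrow>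
            Nemytskii f ` Stepanov_ap p \<subseteq> Stepanov_ap q \<and>
            Stepanov_continuous_on p q (Stepanov_ap p) (Nemytskii f))"
proof -
  obtain a b where a: "0 < a" and b: "b \<in> (Stepanov_aa q :: (real \<Rightarrow> real) set)"
    and growth: "AE t in lebesgue. \<forall>x. norm (f t x) \<le> a * norm x powr (p / q) + b t"
    using H1 by blast
  have b': "b \<in> Lp_loc q" "Lp_totally_bounded q 0 1 (range (\<lambda>t \<theta>. b (t + \<theta>)))"
    using Stepanov_aa_tb[OF q b] Lp_totally_bounded_windows by auto
  \<comment> \<open>Local integrability of f(.,x) is the one locale assumption that comes from the
    hypothesis special to each part.\<close>
  have operator: "Nemytskii_operator f p q a b" if "\<And>x. (\<lambda>t. f t x) \<in> Lp_loc q"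
    by (rule Nemytskii_operator.intro[OF p q a b' growth H2 H3 that])
  show ?thesis
  proof (intro conjI impI)
    assume f: "\<forall>x. (\<lambda>t. f t x) \<in> Stepanov_aa q"
    then interpret Nemytskii_operator f p q a b
      using Stepanov_aa_tb[OF q] by (intro operator) blast
    show "Nemytskii f ` Stepanov_aa p \<subseteq> Stepanov_aa q"
      using Nemytskii_Stepanov_aa f by blast
    show "Stepanov_continuous_on p q (Stepanov_aa p) (Nemytskii f)"
      by (rule Nemytskii_Stepanov_continuous_on) (rule Stepanov_aa_tb[OF p])
  next
    assume f: "\<forall>x. (\<lambda>t. f t x) \<in> Stepanov_ap q"
    then interpret Nemytskii_operator f p q a b
      using Stepanov_ap_tb[OF q] by (intro operator) blast
    show "Nemytskii f ` Stepanov_ap p \<subseteq> Stepanov_ap q"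
      using Nemytskii_Stepanov_ap f by blast
    show "Stepanov_continuous_on p q (Stepanov_ap p) (Nemytskii f)"
      by (rule Nemytskii_Stepanov_continuous_on) (rule Stepanov_ap_tb[OF p])
  qed
qed

end
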